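(* Let $k$ be a finite field of odd characteristic, let $\Pi$ be an irreducible generic cuspidal representation of $\mathrm{G}_2(k)$ and let $\chi$ be a character of $k^\times$. Then there is a number $\gamma(\Pi\times \chi,\psi)\in \mathbb{C}$ such that $$Z(W,\phi,M(f))=\gamma(\Pi\times \chi,\psi)\,Z(W,\phi,f)$$ for all $W\in \mathcal{W}(\Pi,\psi)$, $\phi\in \mathcal{S}(k)$, $f\in I(\chi)$.
   Context: All representations are complex and finite dimensional. $k$ is a finite field of odd characteristic, $\psi$ a fixed nontrivial additive character of $k$, $\epsilon$ the quadratic character of $k^\times$, $\mathcal{S}(k)$ the space of functions $k\to\mathbb{C}$. $E_{ij}$ are the $7\times 7$ matrix units, $I=I_7$. For $r\in k$ put $\mathbf{x}_\alpha(r)=I-2rE_{24}-r^2E_{26}+rE_{46}-rE_{51}-rE_{73}$, $\mathbf{x}_{-\alpha}(r)=I-rE_{15}-rE_{37}-rE_{42}-r^2E_{62}+2rE_{64}$, $\mathbf{x}_\beta(r)=I+rE_{12}-rE_{67}$, $\mathbf{x}_{-\beta}(r)={}^t\mathbf{x}_\beta(r)$, $\mathbf{x}_{\alpha+\beta}(r)=I-2rE_{14}-r^2E_{17}+rE_{47}+rE_{52}+rE_{63}$, $\mathbf{x}_{2\alpha+\beta}(r)=I-rE_{16}+rE_{27}-rE_{43}+r^2E_{53}-2rE_{54}$, $\mathbf{x}_{3\alpha+\beta}(r)=I+rE_{23}+rE_{56}$, $\mathbf{x}_{3\alpha+2\beta}(r)=I+rE_{13}+rE_{57}$. $\mathrm{G}_2(k)\subset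 \mathrm{GL}_7(k)$ is the group generated by all $\mathbf{x}_{\pm\alpha}(r),\mathbf{x}_{\pm\beta}(r)$; it is the split group of type $\mathrm{G}_2$ with short simple root $\alpha$ and long simple root $\beta$. Let $U_\gamma=\{\mathbf{x}_\gamma(r)\}$, $w_\gamma=\mathbf{x}_\gamma(1)\mathbf{x}_{-\gamma}(-1)\mathbf{x}_\gamma(1)$ for $\gamma\in\{\alpha,\beta\}$, $h(a,b)=\mathrm{diag}(a,b,(ab)^{-1},1,ab,b^{-1},a^{-1})$, and $U$ the group generated by all $U_\gamma$, $\gamma>0$. With $m^*=\begin{pmatrix}0&1\\1&0\end{pmatrix}{}^tm^{-1}\begin{pmatrix}0&1\\1&0\end{pmatrix}$, let $M=\{\mathrm{diag}(m,\det(m)^{-1},1,\det(m),m^* ):m\in\mathrm{GL}_2(k)\}\cong\mathrm{GL}_2(k)$, $V$ the group generated by $U_\alpha,U_{\alpha+\beta},U_{2\alpha+\beta},U_{3\alpha+\beta},U_{3\alpha+2\beta}$, and $J=\mathrm{SL}_2(k)\ltimes V$ with $\mathrm{SL}_2(k)\subset\mathrm{GL}_2(k)\cong M$. $\psi_U$ is the character of $U$ with $\psi_U(\mathbf{x}_\alpha(r))=\psi_U(\mathbf{x}_\beta(r))=\psi(r)$, trivial on the other positive root subgroups. An irreducible $\Pi$ is generic if $\mathrm{Hom}_U(\Pi,\psi_U)\ne0$ (then one-dimensional); for $0\ne l$ in it, $\mathcal{W}(\Pi,\psi)=\{g\mapsto l(\Pi(g)v):v\in\Pi\}$. $\omega_{\psi'}$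 (for a nontrivial additive character $\psi'$ of $k$) is the Weil representation of $J$ on $\mathcal{S}(k)$, the unique representation with $\omega_{\psi'}(\mathbf{x}_\alpha(r_1)\mathbf{x}_{2\alpha+\beta}(r_3)\mathbf{x}_{3\alpha+\beta}(r_4)\mathbf{x}_{3\alpha+2\beta}(r_5))\phi(\xi)=\psi'(r_3)\phi(\xi+r_1)$, $\omega_{\psi'}(\mathbf{x}_{\alpha+\beta}(r_2))\phi(\xi)=\psi'(-2\xi r_2)\phi(\xi)$, $\omega_{\psi'}(h(a,a^{-1}))\phi(\xi)=\epsilon(a)\phi(a\xi)$, $\omega_{\psi'}(\mathbf{x}_\beta(b))\phi(\xi)=\psi'(b\xi^2)\phi(\xi)$. $I(\chi)$ is the space of $f:\mathrm{SL}_2(k)\to\mathbb{C}$ with $f\left(\begin{pmatrix}a&b\\0&a^{-1}\end{pmatrix}g\right)=\chi(a)f(g)$; $N_{\mathrm{SL}_2}$ is the upper triangular unipotent subgroup of $\mathrm{SL}_2(k)$; $j(g)=w_\beta w_\alpha gw_\alpha^{-1}w_\beta^{-1}$ for $g\in\mathrm{G}_2(k)$. For any character $\chi$, $$Z(W,\phi,f)=\sum_{g\in N_{\mathrm{SL}_2}\backslash\mathrm{SL}_2(k)}\ \sum_{x,y\in k}W\big(j(\mathbf{x}_{3\alpha+\beta}(y)\mathbf{x}_\alpha(x)g)\big)(\omega_{\psi^{-1}}(g)\phi)(x)f(g),$$ for $W\in\mathcal{W}(\Pi,\psi)$, $\phi\in\mathcal{S}(k)$, $f\in I(\chi)$, which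 is well defined. $M:I(\chi)\to I(\chi^{-1})$ is $M(f)(g)=\sum_{x\in k}f\left((w^1)^{-1}\begin{pmatrix}1&x\\0&1\end{pmatrix}g\right)$ with $w^1=\begin{pmatrix}0&1\\-1&0\end{pmatrix}$. *)

theory Defs
  imports
    "HOL-Analysis.Analysis"
    "HOL-Algebra.Coset"
    "HOL-Algebra.Generated_Groups"
    "HOL-Library.Function_Algebras"
begin

unbundle vec_syntax

section \<open>Characters\<close>

definition additive_group :: "'a::ab_group_add monoid" where
  "additive_group = \<lparr>carrier = UNIV, mult = (+), one = 0\<rparr>"

definition units_group :: "'a::field monoid" where
  "units_group = \<lparr>carrier = UNIV - {0}, mult = (*), one = 1\<rparr>"

definition nontrivial_additive_character :: "('k::field \<Rightarrow> complex) \<Rightarrow> bool" where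
  "nontrivial_additive_character \<psi> \<longleftrightarrow>
     \<psi> \<in> hom additive_group units_group \<and> (\<exists>r. \<psi> r \<noteq> 1)"

text \<open>The quadratic character; only its values on nonzero elements are used.\<close>

definition quad_char :: "'k::field \<Rightarrow> complex" where
  "quad_char a = (if \<exists>b. a = b\<^sup>2 then 1 else - 1)"


section \<open>Finite-dimensional complex representations\<close>

text \<open>
  The representation space is a whole type \<open>'v\<close> with complex scalar multiplication \<open>s\<close>;
  only the values of \<open>\<pi>\<close> on \<open>carrier G\<close> matter.
\<close>

definition representation ::
  "(complex \<Rightarrow> 'v::ab_group_add \<Rightarrow> 'v) \<Rightarrow> ('g, 'm) monoid_scheme \<Rightarrow> ('g \<Rightarrow> 'v \<Rightarrow> 'v) \<Rightarrow> bool" where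
  "representation s G \<pi> \<longleftrightarrow>
     vector_space s \<and> (\<exists>B. finite B \<and> module.span s B = UNIV) \<and>
     (\<forall>g\<in>carrier G. Vector_Spaces.linear s s (\<pi> g)) \<and>
     \<pi> \<one>\<^bsub>G\<^esub> = id \<and>
     (\<forall>g\<in>carrier G. \<forall>h\<in>carrier G. \<pi> (g \<otimes>\<^bsub>G\<^esub> h) = \<pi> g \<circ> \<pi> h)"

definition irreducible_rep ::
  "(complex \<Rightarrow> 'v::ab_group_add \<Rightarrow> 'v) \<Rightarrow> ('g, 'm) monoid_scheme \<Rightarrow> ('g \<Rightarrow> 'v \<Rightarrow> 'v) \<Rightarrow> bool" where
  "irreducible_rep s G \<pi> \<longleftrightarrow>
     representation s G \<pi> \<and> (\<exists>v::'v. v \<noteq> 0) \<and>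
     (\<forall>S. module.subspace s S \<and> (\<forall>g\<in>carrier G. \<pi> g ` S \<subseteq> S) \<longrightarrow> S = {0} \<or> S = UNIV)"


section \<open>The group \<open>G\<^sub>2(k)\<close>\<close>

text \<open>Rows and columns are indexed by the seven-element type \<open>7\<close>, in which \<open>7 = 0\<close>.\<close>

definition E :: "7 \<Rightarrow> 7 \<Rightarrow> 'k::field \<Rightarrow> 'k^7^7" where
  "E i j r = (\<chi> p q. if p = i \<and> q = j then r else 0)"

definition x_a :: "'k::field \<Rightarrow> 'k^7^7" where
  "x_a r = mat 1 - E 2 4 (2 * r) - E 2 6 (r\<^sup>2) + E 4 6 r - E 5 1 r - E 7 3 r"

definition x_ma :: "'k::field \<Rightarrow> 'k^7^7" where
  "x_ma r = mat 1 - E 1 5 r - E 3 7 r - E 4 2 r - E 6 2 (r\<^sup>2) + E 6 4 (2 * r)"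

definition x_b :: "'k::field \<Rightarrow> 'k^7^7" where
  "x_b r = mat 1 + E 1 2 r - E 6 7 r"

definition x_mb :: "'k::field \<Rightarrow> 'k^7^7" where
  "x_mb r = transpose (x_b r)"

definition x_ab :: "'k::field \<Rightarrow> 'k^7^7" where
  "x_ab r = mat 1 - E 1 4 (2 * r) - E 1 7 (r\<^sup>2) + E 4 7 r + E 5 2 r + E 6 3 r"

definition x_2ab :: "'k::field \<Rightarrow> 'k^7^7" where
  "x_2ab r = mat 1 - E 1 6 r + E 2 7 r - E 4 3 r + E 5 3 (r\<^sup>2) - E 5 4 (2 * r)"

definition x_3ab :: "'k::field \<Rightarrow> 'k^7^7" where
  "x_3ab r = mat 1 + E 2 3 r + E 5 6 r"

definition x_3a2b :: "'k::field \<Rightarrow> 'k^7^7" where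
  "x_3a2b r = mat 1 + E 1 3 r + E 5 7 r"

definition GL7 :: "('k::field^7^7) monoid" where
  "GL7 = \<lparr>carrier = {A. invertible A}, mult = (**), one = mat 1\<rparr>"

definition G2 :: "('k::field^7^7) monoid" where
  "G2 = GL7\<lparr>carrier := generate GL7 (range x_a \<union> range x_ma \<union> range x_b \<union> range x_mb)\<rparr>"

definition w_a :: "'k::field^7^7" where
  "w_a = x_a 1 ** x_ma (- 1) ** x_a 1"

definition w_b :: "'k::field^7^7" where
  "w_b = x_b 1 ** x_mb (- 1) ** x_b 1"

definition h :: "'k::field \<Rightarrow> 'k \<Rightarrow> 'k^7^7" where
  "h a b = E 1 1 a + E 2 2 b + E 3 3 (inverse (a * b)) + E 4 4 1
         + E 5 5 (a * b) + E 6 6 (inverse b) + E 7 7 (inverse a)"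

definition U :: "('k::field^7^7) monoid" where
  "U = GL7\<lparr>carrier := generate GL7
     (range x_a \<union> range x_b \<union> range x_ab \<union> range x_2ab \<union> range x_3ab \<union> range x_3a2b)\<rparr>"

definition V :: "('k::field^7^7) set" where
  "V = generate GL7 (range x_a \<union> range x_ab \<union> range x_2ab \<union> range x_3ab \<union> range x_3a2b)"

text \<open>The unipotent radical of the other standard maximal parabolic subgroup, whose Levi
  subgroup contains the root subgroups of \<open>\<plusminus>\<alpha>\<close>.\<close>

definition V' :: "('k::field^7^7) set" where
  "V' = generate GL7 (range x_b \<union> range x_ab \<union> range x_2ab \<union> range x_3ab \<union> range x_3a2b)"

definition mat2 :: "'k::field \<Rightarrow> 'k \<Rightarrow> 'k \<Rightarrow> 'k \<Rightarrow> 'k^2^2" where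
  "mat2 a b c d = vector [vector [a, b], vector [c, d]]"

definition SL2 :: "('k::field^2^2) monoid" where
  "SL2 = \<lparr>carrier = {A. det A = 1}, mult = (**), one = mat 1\<rparr>"

definition N_SL2 :: "('k::field^2^2) set" where
  "N_SL2 = range (\<lambda>x. mat2 1 x 0 1)"

definition star :: "'k::field^2^2 \<Rightarrow> 'k^2^2" where
  "star m = mat2 0 1 1 0 ** transpose (matrix_inv m) ** mat2 0 1 1 0"

text \<open>The isomorphism of \<open>GL\<^sub>2(k)\<close> onto the Levi subgroup \<open>M\<close>,
  \<open>m \<mapsto> diag (m, det(m)\<^sup>-\<^sup>1, 1, det(m), m\<^sup>*)\<close>.\<close>

definition levi :: "'k::field^2^2 \<Rightarrow> 'k^7^7" where
  "levi m = E 1 1 (m $ 1 $ 1) + E 1 2 (m $ 1 $ 2) + E 2 1 (m $ 2 $ 1) + E 2 2 (m $ 2 $ 2)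
          + E 3 3 (inverse (det m)) + E 4 4 1 + E 5 5 (det m)
          + E 6 6 (star m $ 1 $ 1) + E 6 7 (star m $ 1 $ 2)
          + E 7 6 (star m $ 2 $ 1) + E 7 7 (star m $ 2 $ 2)"

definition J :: "('k::field^7^7) monoid" where
  "J = GL7\<lparr>carrier := levi ` carrier SL2 <#>\<^bsub>GL7\<^esub> V\<rparr>"


section \<open>Cuspidal and generic representations\<close>

text \<open>Every proper parabolic subgroup of \<open>G\<^sub>2(k)\<close> is conjugate to the Borel subgroup with
  unipotent radical \<open>U\<close> or to one of the two standard maximal parabolic subgroups.\<close>

definition unipotent_radicals :: "('k::field^7^7) set set" where
  "unipotent_radicals =
     {(\<lambda>n. g ** n ** matrix_inv g) ` N | g N. g \<in> carrier G2 \<and> N \<in> {carrier U, V, V'}}"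

definition cuspidal :: "('k::field^7^7 \<Rightarrow> 'v::ab_group_add \<Rightarrow> 'v) \<Rightarrow> bool" where
  "cuspidal \<pi> \<longleftrightarrow> (\<forall>N\<in>unipotent_radicals. \<forall>v. (\<forall>n\<in>N. \<pi> n v = v) \<longrightarrow> v = 0)"

text \<open>\<open>\<theta>\<close> is the character \<open>\<psi>\<^sub>U\<close> of \<open>U\<close>.\<close>

definition is_psi_U :: "('k::field \<Rightarrow> complex) \<Rightarrow> ('k^7^7 \<Rightarrow> complex) \<Rightarrow> bool" where
  "is_psi_U \<psi> \<theta> \<longleftrightarrow>
     \<theta> \<in> hom U units_group \<and>
     (\<forall>r. \<theta> (x_a r) = \<psi> r \<and> \<theta> (x_b r) = \<psi> r \<and>
          \<theta> (x_ab r) = 1 \<and> \<theta> (x_2ab r) = 1 \<and> \<theta> (x_3ab r) = 1 \<and> \<theta> (x_3a2b r) = 1)"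

definition Hom_U ::
  "(complex \<Rightarrow> 'v::ab_group_add \<Rightarrow> 'v) \<Rightarrow> ('k::field^7^7 \<Rightarrow> 'v \<Rightarrow> 'v) \<Rightarrow>
   ('k^7^7 \<Rightarrow> complex) \<Rightarrow> ('v \<Rightarrow> complex) set" where
  "Hom_U s \<pi> \<theta> =
     {l. Vector_Spaces.linear s (*) l \<and> (\<forall>u\<in>carrier U. \<forall>v. l (\<pi> u v) = \<theta> u * l v)}"

definition generic ::
  "(complex \<Rightarrow> 'v::ab_group_add \<Rightarrow> 'v) \<Rightarrow> ('k::field^7^7 \<Rightarrow> 'v \<Rightarrow> 'v) \<Rightarrow>
   ('k^7^7 \<Rightarrow> complex) \<Rightarrow> bool" where
  "generic s \<pi> \<theta> \<longleftrightarrow> (\<exists>l\<in>Hom_U s \<pi> \<theta>. \<exists>v. l v \<noteq> 0)"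

text \<open>The Whittaker model; since \<open>Hom_U\<close> is one-dimensional, letting \<open>l\<close> vary over all its
  nonzero elements gives the same set as fixing one of them.\<close>

definition whittaker_model ::
  "(complex \<Rightarrow> 'v::ab_group_add \<Rightarrow> 'v) \<Rightarrow> ('k::field^7^7 \<Rightarrow> 'v \<Rightarrow> 'v) \<Rightarrow>
   ('k^7^7 \<Rightarrow> complex) \<Rightarrow> ('k^7^7 \<Rightarrow> complex) set" where
  "whittaker_model s \<pi> \<theta> =
     {\<lambda>g. l (\<pi> g v) | l v. l \<in> Hom_U s \<pi> \<theta> \<and> (\<exists>v'. l v' \<noteq> 0)}"


section \<open>The Weil representation, induced representations and the zeta sums\<close>

definition is_weil ::
  "('k::field \<Rightarrow> complex) \<Rightarrow> ('k^7^7 \<Rightarrow> ('k \<Rightarrow> complex) \<Rightarrow> ('k \<Rightarrow> complex)) \<Rightarrow> bool" where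
  "is_weil \<psi>' \<omega> \<longleftrightarrow>
     representation (\<lambda>c \<phi> \<xi>. c * \<phi> \<xi>) J \<omega> \<and>
     (\<forall>r\<^sub>1 r\<^sub>3 r\<^sub>4 r\<^sub>5 \<phi> \<xi>.
        \<omega> (x_a r\<^sub>1 ** x_2ab r\<^sub>3 ** x_3ab r\<^sub>4 ** x_3a2b r\<^sub>5) \<phi> \<xi> = \<psi>' r\<^sub>3 * \<phi> (\<xi> + r\<^sub>1)) \<and>
     (\<forall>r\<^sub>2 \<phi> \<xi>. \<omega> (x_ab r\<^sub>2) \<phi> \<xi> = \<psi>' (- 2 * \<xi> * r\<^sub>2) * \<phi> \<xi>) \<and>
     (\<forall>a \<phi> \<xi>. a \<noteq> 0 \<longrightarrow> \<omega> (h a (inverse a)) \<phi> \<xi> = quad_char a * \<phi> (a * \<xi>)) \<and>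
     (\<forall>b \<phi> \<xi>. \<omega> (x_b b) \<phi> \<xi> = \<psi>' (b * \<xi>\<^sup>2) * \<phi> \<xi>)"

text \<open>Elements of \<open>I(chi)\<close> are total functions; only their values on \<open>SL\<^sub>2(k)\<close> matter.\<close>

definition induced :: "('k::field \<Rightarrow> complex) \<Rightarrow> ('k^2^2 \<Rightarrow> complex) set" where
  "induced chi =
     {f. \<forall>a b. \<forall>g\<in>carrier SL2. a \<noteq> 0 \<longrightarrow> f (mat2 a b 0 (inverse a) ** g) = chi a * f g}"

definition intertwiner :: "('k::{field,finite}^2^2 \<Rightarrow> complex) \<Rightarrow> 'k^2^2 \<Rightarrow> complex" where
  "intertwiner f g = (\<Sum>x\<in>UNIV. f (matrix_inv (mat2 0 1 (- 1) 0) ** mat2 1 x 0 1 ** g))"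

definition j :: "'k::field^7^7 \<Rightarrow> 'k^7^7" where
  "j g = w_b ** w_a ** g ** matrix_inv w_a ** matrix_inv w_b"

text \<open>The summand depends only on the coset of \<open>g\<close>, so any representative may be chosen.\<close>

definition zeta_sum ::
  "('k::{field,finite}^7^7 \<Rightarrow> ('k \<Rightarrow> complex) \<Rightarrow> ('k \<Rightarrow> complex)) \<Rightarrow>
   ('k^7^7 \<Rightarrow> complex) \<Rightarrow> ('k \<Rightarrow> complex) \<Rightarrow> ('k^2^2 \<Rightarrow> complex) \<Rightarrow> complex" where
  "zeta_sum \<omega> W \<phi> f =
     (\<Sum>C\<in>rcosets\<^bsub>SL2\<^esub> N_SL2.
        let g = (SOME g. g \<in> C)
        in \<Sum>x\<in>UNIV. \<Sum>y\<in>UNIV.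
             W (j (x_3ab y ** x_a x ** levi g)) * \<omega> (levi g) \<phi> x * f g)"

end

theory Submission
  imports Defs "HOL-Computational_Algebra.Fundamental_Theorem_Algebra"
begin

text \<open>
  The zeta sum is, up to a constant, the sum over \<open>SL\<^sub>2(k)\<close> of \<open>f(g) L(\<Pi>(g)v, \<omega>(g)\<phi>)\<close> for a bilinear form
  \<open>L\<close> invariant under \<open>N\<close> and \<open>V\<close>, and applying \<open>M\<close> to \<open>f\<close> amounts to replacing \<open>L\<close> by its translate
  under the Weyl element. Averaging over the Borel subgroup turns both forms into forms
  that are equivariant under the Borel subgroup of \<open>J\<close>. Such a form is determined by its
  restriction to \<open>\<phi> = \<delta>\<^sub>0\<close>, a functional on \<open>\<Pi>\<close> on which \<open>V'\<close> acts by the character \<open>\<psi>\<close> of the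
  \<open>2\<alpha>+\<beta>\<close> coordinate and the torus of \<open>SL\<^sub>2\<close> by a fixed character. By root exchange, Fourier
  expansion along \<open>U\<^sub>\<beta>\<close> and cuspidality, every functional of the first kind is a combination of
  torus translates of a single one that comes from the Whittaker functional; equivariance under the
  torus then leaves one dimension, so the two forms are proportional.

  This uses that the Whittaker functional is unique. Following Gelfand and Graev, the
  anti-involution \<open>g \<mapsto> t g\<^bsup>-1\<^esup> t\<close> with \<open>t = h 1 (- 1)\<close> preserves \<open>U\<close> and \<open>\<psi>\<^sub>U\<close>, and by the Bruhat decomposition
  it fixes every operator \<open>e \<Pi>(g) e\<close>, where \<open>e\<close> is the projection onto the \<open>\<psi>\<^sub>U\<close>-eigenspace;
  hence these operators commute.
\<close>

section \<open>Matrix identities in the seven-dimensional representation\<close>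

text \<open>The argument is uniform in \<open>chi\<close>, including the characters for which I(chi)
  is reducible: f enters only as a weight on cosets of the Borel subgroup, and what is compared are
  two forms on \<pi> and S(k).

  The function \<delta>_0 is singled out because N fixes it (the multiplier \<psi>(b \<xi>^2) is 1
  at \<xi> = 0), as do the root subgroups of \<alpha>+\<beta>, 3\<alpha>+\<beta> and
  3\<alpha>+2\<beta>, while 2\<alpha>+\<beta> and the torus of SL_2 act on it by scalars.
  Translations by U_\<alpha> carry it to every other \<delta>_x, so nothing is lost by restricting
  to it.

  Proportionality alone would not give the theorem, since the form on the right-hand side could be
  zero and the other one not. This is excluded by computing the average for the identity explicitly:
  at \<delta>_0 it is q times the torus eigenprojection of the basic functional, and every
  equivariant functional is a multiple of that projection.

  Uniqueness of the Whittaker functional enters twice: in the Fourier expansion, where each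
  nontrivial component is moved into the Whittaker space, and at the end, where an arbitrary W is
  reduced to one fixed functional.\<close>

lemma exhaust_7:
  fixes x :: 7
  shows "x = 1 \<or> x = 2 \<or> x = 3 \<or> x = 4 \<or> x = 5 \<or> x = 6 \<or> x = 7"
proof (induct x)
  case (of_int z)
  then have "0 \<le> z" and "z < 7" by simp_all
  then have "z = 0 \<or> z = 1 \<or> z = 2 \<or> z = 3 \<or> z = 4 \<or> z = 5 \<or> z = 6" by arith
  \<comment> \<open>The residue \<open>0\<close> is the index written \<open>7\<close>.\<close>
  then show ?case by auto
qed

lemma forall_7: "(\<forall>i::7. P i) \<longleftrightarrow> P 1 \<and> P 2 \<and> P 3 \<and> P 4 \<and> P 5 \<and> P 6 \<and> P 7"
  by (metis exhaust_7)

definition vec7 :: "'a \<Rightarrow> 'a \<Rightarrow> 'a \<Rightarrow> 'a \<Rightarrow> 'a \<Rightarrow> 'a \<Rightarrow> 'a \<Rightarrow> 'a^7" where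
  "vec7 a b c d e f g = (\<chi> i. if i = 1 then a else if i = 2 then b else if i = 3 then c
     else if i = 4 then d else if i = 5 then e else if i = 6 then f else g)"

text \<open>In the index type the numerals \<open>7\<close> and \<open>0\<close> denote the same
  element, so the last coordinate gets a rule under both names.\<close>

lemma vec7_nth [simp]:
  "vec7 a b c d e f g $ 1 = a" "vec7 a b c d e f g $ 2 = b" "vec7 a b c d e f g $ 3 = c"
  "vec7 a b c d e f g $ 4 = d" "vec7 a b c d e f g $ 5 = e" "vec7 a b c d e f g $ 6 = f"
  "vec7 a b c d e f g $ 7 = g" "vec7 a b c d e f g $ 0 = g"
  by (simp_all add: vec7_def)

lemma vec7_eqI:
  "\<lbrakk>x $ 1 = y $ 1; x $ 2 = y $ 2; x $ 3 = y $ 3; x $ 4 = y $ 4; x $ 5 = y $ 5; x $ 6 = y $ 6;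
    x $ 7 = y $ 7\<rbrakk> \<Longrightarrow> x = (y::'a^7)"
  by (subst vec_eq_iff, subst forall_7) simp

lemma vec7_inject [simp]:
  "vec7 a b c d e f g = vec7 a' b' c' d' e' f' g' \<longleftrightarrow>
   a = a' \<and> b = b' \<and> c = c' \<and> d = d' \<and> e = e' \<and> f = f' \<and> g = g'"
  by (metis vec7_nth(1-7))

lemma vec7_cases: obtains a b c d e f g where "x = vec7 a b c d e f g"
proof
  show "x = vec7 (x$1) (x$2) (x$3) (x$4) (x$5) (x$6) (x$7)"
    by (rule vec7_eqI) simp_all
qed

text \<open>Comparing the actions on a vector with symbolic coordinates turns a product of matrices
  into iterated substitution, so that no product of 7x7 matrices has to be expanded entry by
  entry.\<close>

lemma matrix7_eqI:
  fixes A B :: "'k::field^7^7"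
  assumes "\<And>a b c d e f g. A *v vec7 a b c d e f g = B *v vec7 a b c d e f g"
  shows "A = B"
  unfolding matrix_eq using assms by (metis vec7_cases)

lemma E_mult_vec: "E i n r *v x = (\<chi> p. if p = i then r * x $ n else 0)"
  by (simp add: vec_eq_iff E_def matrix_vector_mult_def if_distrib if_distribR cong: if_cong)

lemma matrix_vector_mult_diff: "(A - B) *v x = A *v x - B *v (x::'k::field^'n)"
  by (simp add: vec_eq_iff matrix_vector_mult_def sum_subtractf left_diff_distrib)

lemma transpose_E: "transpose (E i n r) = E n i r"
  by (simp add: vec_eq_iff E_def transpose_def)

lemma transpose_add: "transpose (A + B) = transpose A + transpose B"
  by (simp add: vec_eq_iff transpose_def)

lemma transpose_diff: "transpose (A - B) = transpose A - transpose B"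
  by (simp add: vec_eq_iff transpose_def)

lemmas E_expand = E_mult_vec matrix_vector_mult_diff matrix_vector_mult_add_rdistrib

lemma x_a_act: "x_a r *v vec7 a b c d e f g =
  vec7 a (b - 2 * r * d - r\<^sup>2 * f) c (d + r * f) (e - r * a) f (g - r * c)"
  by (rule vec7_eqI) (simp_all add: x_a_def E_expand)

lemma x_ma_act: "x_ma r *v vec7 a b c d e f g =
  vec7 (a - r * e) b (c - r * g) (d - r * b) e (f - r\<^sup>2 * b + 2 * r * d) g"
  by (rule vec7_eqI) (simp_all add: x_ma_def E_expand)

lemma x_b_act: "x_b r *v vec7 a b c d e f g = vec7 (a + r * b) b c d e (f - r * g) g"
  by (rule vec7_eqI) (simp_all add: x_b_def E_expand)

lemma x_mb_act: "x_mb r *v vec7 a b c d e f g = vec7 a (b + r * a) c d e f (g - r * f)"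
  by (rule vec7_eqI) (simp_all add: x_mb_def x_b_def transpose_add transpose_diff transpose_E
      transpose_mat E_expand)

lemma x_ab_act: "x_ab r *v vec7 a b c d e f g =
  vec7 (a - 2 * r * d - r\<^sup>2 * g) b c (d + r * g) (e + r * b) (f + r * c) g"
  by (rule vec7_eqI) (simp_all add: x_ab_def E_expand)

lemma x_2ab_act: "x_2ab r *v vec7 a b c d e f g =
  vec7 (a - r * f) (b + r * g) c (d - r * c) (e + r\<^sup>2 * c - 2 * r * d) f g"
  by (rule vec7_eqI) (simp_all add: x_2ab_def E_expand)

lemma x_3ab_act: "x_3ab r *v vec7 a b c d e f g = vec7 a (b + r * c) c d (e + r * f) f g"
  by (rule vec7_eqI) (simp_all add: x_3ab_def E_expand)

lemma x_3a2b_act: "x_3a2b r *v vec7 a b c d e f g = vec7 (a + r * c) b c d (e + r * g) f g"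
  by (rule vec7_eqI) (simp_all add: x_3a2b_def E_expand)

lemma h_act: "h p q *v vec7 a b c d e f g =
  vec7 (p * a) (q * b) (inverse (p * q) * c) d (p * q * e) (inverse q * f) (inverse p * g)"
  by (rule vec7_eqI) (simp_all add: h_def E_expand)

lemma mult_act: "(A ** B) *v (x::'k::field^'n) = A *v (B *v x)"
  by (simp add: matrix_vector_mul_assoc)

lemma w_a_act: "w_a *v vec7 a b c d e f g = vec7 e (- f) g (- d) (- a) (- b) (- (c::'k::field))"
  by (simp add: w_a_def mult_act x_a_act x_ma_act algebra_simps)

lemma w_b_act: "w_b *v vec7 a b c d e f g = vec7 b (- a) c d e (- g) (f::'k::field)"
  by (simp add: w_b_def mult_act x_b_act x_mb_act algebra_simps)

lemmas act_simps = mult_act x_a_act x_ma_act x_b_act x_mb_act x_ab_act x_2ab_act x_3ab_act x_3a2b_act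
  h_act w_a_act w_b_act matrix_vector_mul_lid

section \<open>Root subgroups as one-parameter groups\<close>

lemma x_a_0: "x_a 0 = mat 1"
  by (rule matrix7_eqI) (simp add: act_simps algebra_simps power2_eq_square)

lemma x_a_add: "x_a r ** x_a s = x_a (r + s)"
  by (rule matrix7_eqI) (simp add: act_simps algebra_simps power2_eq_square)

lemma x_b_0: "x_b 0 = mat 1"
  by (rule matrix7_eqI) (simp add: act_simps algebra_simps power2_eq_square)

lemma x_b_add: "x_b r ** x_b s = x_b (r + s)"
  by (rule matrix7_eqI) (simp add: act_simps algebra_simps power2_eq_square)

lemma x_ab_0: "x_ab 0 = mat 1"
  by (rule matrix7_eqI) (simp add: act_simps algebra_simps power2_eq_square)

lemma x_ab_add: "x_ab r ** x_ab s = x_ab (r + s)"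
  by (rule matrix7_eqI) (simp add: act_simps algebra_simps power2_eq_square)

lemma x_2ab_0: "x_2ab 0 = mat 1"
  by (rule matrix7_eqI) (simp add: act_simps algebra_simps power2_eq_square)

lemma x_2ab_add: "x_2ab r ** x_2ab s = x_2ab (r + s)"
  by (rule matrix7_eqI) (simp add: act_simps algebra_simps power2_eq_square)

lemma x_3ab_0: "x_3ab 0 = mat 1"
  by (rule matrix7_eqI) (simp add: act_simps algebra_simps power2_eq_square)

lemma x_3ab_add: "x_3ab r ** x_3ab s = x_3ab (r + s)"
  by (rule matrix7_eqI) (simp add: act_simps algebra_simps power2_eq_square)

lemma x_3a2b_0: "x_3a2b 0 = mat 1"
  by (rule matrix7_eqI) (simp add: act_simps algebra_simps power2_eq_square)

lemma x_3a2b_add: "x_3a2b r ** x_3a2b s = x_3a2b (r + s)"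
  by (rule matrix7_eqI) (simp add: act_simps algebra_simps power2_eq_square)

lemma x_ma_0: "x_ma 0 = mat 1"
  by (rule matrix7_eqI) (simp add: act_simps algebra_simps power2_eq_square)

lemma x_ma_add: "x_ma r ** x_ma s = x_ma (r + s)"
  by (rule matrix7_eqI) (simp add: act_simps algebra_simps power2_eq_square)

lemma x_mb_0: "x_mb 0 = mat 1"
  by (rule matrix7_eqI) (simp add: act_simps algebra_simps power2_eq_square)

lemma x_mb_add: "x_mb r ** x_mb s = x_mb (r + s)"
  by (rule matrix7_eqI) (simp add: act_simps algebra_simps power2_eq_square)

section \<open>Action of the torus on the root subgroups\<close>

lemma h_x_a:
  assumes "a \<noteq> 0" "b \<noteq> 0"
  shows "h a b ** x_a r = x_a (b * r) ** h a b"
  by (rule matrix7_eqI) (use assms in \<open>simp add: act_simps field_simps power2_eq_square\<close>)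

lemma h_x_b:
  assumes "a \<noteq> 0" "b \<noteq> 0"
  shows "h a b ** x_b r = x_b (a / b * r) ** h a b"
  by (rule matrix7_eqI) (use assms in \<open>simp add: act_simps field_simps power2_eq_square\<close>)

lemma h_x_ab:
  assumes "a \<noteq> 0" "b \<noteq> 0"
  shows "h a b ** x_ab r = x_ab (a * r) ** h a b"
  by (rule matrix7_eqI) (use assms in \<open>simp add: act_simps field_simps power2_eq_square\<close>)

lemma h_x_2ab:
  assumes "a \<noteq> 0" "b \<noteq> 0"
  shows "h a b ** x_2ab r = x_2ab (a * b * r) ** h a b"
  by (rule matrix7_eqI) (use assms in \<open>simp add: act_simps field_simps power2_eq_square\<close>)

lemma h_x_3ab:
  assumes "a \<noteq> 0" "b \<noteq> 0"
  shows "h a b ** x_3ab r = x_3ab (a * b\<^sup>2 * r) ** h a b"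
  by (rule matrix7_eqI) (use assms in \<open>simp add: act_simps field_simps power2_eq_square\<close>)

lemma h_x_3a2b:
  assumes "a \<noteq> 0" "b \<noteq> 0"
  shows "h a b ** x_3a2b r = x_3a2b (a\<^sup>2 * b * r) ** h a b"
  by (rule matrix7_eqI) (use assms in \<open>simp add: act_simps field_simps power2_eq_square\<close>)

lemma h_mult: "h a b ** h c d = h (a * c) (b * d)"
  by (rule matrix7_eqI) (simp add: act_simps algebra_simps)

lemma h_1_1: "h 1 1 = mat 1"
  by (rule matrix7_eqI) (simp add: act_simps algebra_simps power2_eq_square)

section \<open>Weyl elements acting on the torus and on the root subgroups\<close>

lemma w_a_h:
  assumes "a \<noteq> 0" "b \<noteq> 0"
  shows "w_a ** h a b = h (a * b) (inverse b) ** w_a"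
  by (rule matrix7_eqI) (use assms in \<open>simp add: act_simps field_simps power2_eq_square\<close>)

lemma w_b_h: "w_b ** h a b = h b a ** w_b"
  by (rule matrix7_eqI) (simp add: act_simps algebra_simps power2_eq_square)

lemma w_a_w_a: "w_a ** w_a = h (- 1) 1"
  by (rule matrix7_eqI) (simp add: act_simps algebra_simps power2_eq_square)

lemma w_b_w_b: "w_b ** w_b = h (- 1) (- 1)"
  by (rule matrix7_eqI) (simp add: act_simps algebra_simps power2_eq_square)

lemma w_a_x_a: "w_a ** x_a r = x_ma (- r) ** w_a"
  by (rule matrix7_eqI) (simp add: act_simps algebra_simps power2_eq_square)

lemma w_a_x_b: "w_a ** x_b r = x_3ab r ** w_a"
  by (rule matrix7_eqI) (simp add: act_simps algebra_simps power2_eq_square)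

lemma w_a_x_ab: "w_a ** x_ab r = x_2ab r ** w_a"
  by (rule matrix7_eqI) (simp add: act_simps algebra_simps power2_eq_square)

lemma w_a_x_2ab: "w_a ** x_2ab r = x_ab (- r) ** w_a"
  by (rule matrix7_eqI) (simp add: act_simps algebra_simps power2_eq_square)

lemma w_a_x_3ab: "w_a ** x_3ab r = x_b (- r) ** w_a"
  by (rule matrix7_eqI) (simp add: act_simps algebra_simps power2_eq_square)

lemma w_a_x_3a2b: "w_a ** x_3a2b r = x_3a2b r ** w_a"
  by (rule matrix7_eqI) (simp add: act_simps algebra_simps power2_eq_square)

lemma w_b_x_a: "w_b ** x_a r = x_ab r ** w_b"
  by (rule matrix7_eqI) (simp add: act_simps algebra_simps power2_eq_square)

lemma w_b_x_b: "w_b ** x_b r = x_mb (- r) ** w_b"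
  by (rule matrix7_eqI) (simp add: act_simps algebra_simps power2_eq_square)

lemma w_b_x_ab: "w_b ** x_ab r = x_a (- r) ** w_b"
  by (rule matrix7_eqI) (simp add: act_simps algebra_simps power2_eq_square)

lemma w_b_x_2ab: "w_b ** x_2ab r = x_2ab r ** w_b"
  by (rule matrix7_eqI) (simp add: act_simps algebra_simps power2_eq_square)

lemma w_b_x_3ab: "w_b ** x_3ab r = x_3a2b r ** w_b"
  by (rule matrix7_eqI) (simp add: act_simps algebra_simps power2_eq_square)

lemma w_b_x_3a2b: "w_b ** x_3a2b r = x_3ab (- r) ** w_b"
  by (rule matrix7_eqI) (simp add: act_simps algebra_simps power2_eq_square)

section \<open>Commutation relations between positive root subgroups\<close>

lemma x_ab_x_b: "x_ab r ** x_b s = x_b s ** x_ab r"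
  by (rule matrix7_eqI) (simp add: act_simps algebra_simps power2_eq_square)

lemma x_2ab_x_b: "x_2ab r ** x_b s = x_b s ** x_2ab r"
  by (rule matrix7_eqI) (simp add: act_simps algebra_simps power2_eq_square)

lemma x_3ab_x_a: "x_3ab r ** x_a s = x_a s ** x_3ab r"
  by (rule matrix7_eqI) (simp add: act_simps algebra_simps power2_eq_square)

lemma x_3ab_x_ab: "x_3ab r ** x_ab s = x_ab s ** x_3ab r"
  by (rule matrix7_eqI) (simp add: act_simps algebra_simps power2_eq_square)

lemma x_3a2b_x_a: "x_3a2b r ** x_a s = x_a s ** x_3a2b r"
  by (rule matrix7_eqI) (simp add: act_simps algebra_simps power2_eq_square)

lemma x_3a2b_x_b: "x_3a2b r ** x_b s = x_b s ** x_3a2b r"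
  by (rule matrix7_eqI) (simp add: act_simps algebra_simps power2_eq_square)

lemma x_3a2b_x_ab: "x_3a2b r ** x_ab s = x_ab s ** x_3a2b r"
  by (rule matrix7_eqI) (simp add: act_simps algebra_simps power2_eq_square)

text \<open>All positive roots occur in this commutator. The elements of \<open>V'\<close> are
  collected on the left and \<open>x_a s\<close> on the right, because the functionals used later
  absorb a left factor from \<open>V'\<close> and are then summed over \<open>x_a\<close>.\<close>

lemma x_a_x_b: "x_a s ** x_b r = x_b r ** x_ab (- (r * s)) ** x_2ab (r * s\<^sup>2) ** x_3ab (r * s ^ 3) ** x_3a2b (r\<^sup>2 * s ^ 3) ** x_a s"
  by (rule matrix7_eqI) (simp add: act_simps algebra_simps power2_eq_square power3_eq_cube)

lemma x_a_x_ab: "x_a s ** x_ab r = x_ab r ** x_2ab (- (2 * r * s)) ** x_3ab (- (3 * r * s\<^sup>2)) ** x_3a2b (3 * r\<^sup>2 * s) ** x_a s"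
  by (rule matrix7_eqI) (simp add: act_simps algebra_simps power2_eq_square power3_eq_cube)

lemma x_a_x_2ab: "x_a s ** x_2ab r = x_2ab r ** x_3ab (3 * r * s) ** x_a s"
  by (rule matrix7_eqI) (simp add: act_simps algebra_simps power2_eq_square power3_eq_cube)

lemma x_ab_x_2ab: "x_ab s ** x_2ab r = x_2ab r ** x_3a2b (3 * r * s) ** x_ab s"
  by (rule matrix7_eqI) (simp add: act_simps algebra_simps power2_eq_square power3_eq_cube)

lemma x_b_x_3ab: "x_b s ** x_3ab r = x_3ab r ** x_3a2b (r * s) ** x_b s"
  by (rule matrix7_eqI) (simp add: act_simps algebra_simps power2_eq_square power3_eq_cube)

section \<open>Subgroups of the matrix group\<close>

lemma group_GL7: "group (GL7 :: ('k::field^7^7) monoid)"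
proof (rule groupI)
  fix x y :: "'k^7^7"
  assume "x \<in> carrier GL7" "y \<in> carrier GL7"
  then show "x \<otimes>\<^bsub>GL7\<^esub> y \<in> carrier GL7"
    by (simp add: GL7_def invertible_mult)
next
  fix x :: "'k^7^7"
  assume "x \<in> carrier GL7"
  then obtain y where "x ** y = mat 1" "y ** x = mat 1"
    by (auto simp: GL7_def invertible_def)
  then show "\<exists>y\<in>carrier GL7. y \<otimes>\<^bsub>GL7\<^esub> x = \<one>\<^bsub>GL7\<^esub>"
    by (auto simp: GL7_def invertible_def)
qed (auto simp: GL7_def matrix_mul_assoc invertible_def intro: exI[of _ "mat 1"])

lemma GL7_simps [simp]:
  "x \<otimes>\<^bsub>GL7\<^esub> y = x ** y" "\<one>\<^bsub>GL7\<^esub> = mat 1" "x \<in> carrier GL7 \<longleftrightarrow> invertible x"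
  by (simp_all add: GL7_def)

lemma G2_simps [simp]: "x \<otimes>\<^bsub>G2\<^esub> y = x ** y" "\<one>\<^bsub>G2\<^esub> = mat 1"
  by (simp_all add: G2_def GL7_def)

lemma U_simps [simp]: "x \<otimes>\<^bsub>U\<^esub> y = x ** y" "\<one>\<^bsub>U\<^esub> = mat 1"
  by (simp_all add: U_def GL7_def)

lemma J_simps [simp]: "x \<otimes>\<^bsub>J\<^esub> y = x ** y" "\<one>\<^bsub>J\<^esub> = mat 1"
  by (simp_all add: J_def GL7_def)

lemma matrix_inv_unique:
  assumes "A ** B = mat 1" "B ** A = mat 1"
  shows "matrix_inv A = (B::'k::field^'n^'n)"
proof -
  have "A ** matrix_inv A = mat 1"
    unfolding matrix_inv_def by (rule someI2[of _ B]) (use assms in auto)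
  then have "B ** (A ** matrix_inv A) = B" by simp
  then show ?thesis by (simp add: matrix_mul_assoc assms)
qed

lemma matrix_inv_cancel:
  assumes "invertible (A::'k::field^'n^'n)"
  shows "A ** matrix_inv A = mat 1" "matrix_inv A ** A = mat 1"
proof -
  obtain B where "A ** B = mat 1" "B ** A = mat 1"
    using assms by (auto simp: invertible_def)
  with matrix_inv_unique[OF this]
  show "A ** matrix_inv A = mat 1" "matrix_inv A ** A = mat 1" by simp_all
qed

lemma inv_GL7: "invertible A \<Longrightarrow> inv\<^bsub>GL7\<^esub> A = matrix_inv A"
  using group.inv_equality[OF group_GL7, of "matrix_inv A" A] matrix_inv_cancel[of A]
  by (auto simp: invertible_def)

context
  fixes x :: "'k::field \<Rightarrow> 'k^7^7"
  assumes add: "\<And>r s. x r ** x s = x (r + s)" and zero: "x 0 = mat 1"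
begin

lemma one_param_inv: "matrix_inv (x r) = x (- r)"
  by (rule matrix_inv_unique) (simp_all add: add zero)

lemma one_param_invertible: "invertible (x r)"
  unfolding invertible_def by (rule exI[of _ "x (- r)"]) (simp add: add zero)

end

lemmas x_inv [simp] =
  one_param_inv[OF x_a_add x_a_0] one_param_inv[OF x_b_add x_b_0] one_param_inv[OF x_ab_add x_ab_0]
  one_param_inv[OF x_2ab_add x_2ab_0] one_param_inv[OF x_3ab_add x_3ab_0]
  one_param_inv[OF x_3a2b_add x_3a2b_0] one_param_inv[OF x_ma_add x_ma_0]
  one_param_inv[OF x_mb_add x_mb_0]

lemmas x_invertible [simp] =
  one_param_invertible[OF x_a_add x_a_0] one_param_invertible[OF x_b_add x_b_0]
  one_param_invertible[OF x_ab_add x_ab_0] one_param_invertible[OF x_2ab_add x_2ab_0]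
  one_param_invertible[OF x_3ab_add x_3ab_0] one_param_invertible[OF x_3a2b_add x_3a2b_0]
  one_param_invertible[OF x_ma_add x_ma_0] one_param_invertible[OF x_mb_add x_mb_0]

lemma w_invertible [simp]: "invertible w_a" "invertible w_b"
  by (simp_all add: w_a_def w_b_def invertible_mult)

lemma h_invertible: "a \<noteq> 0 \<Longrightarrow> b \<noteq> 0 \<Longrightarrow> invertible (h a b)"
  unfolding invertible_def
  by (rule exI[of _ "h (inverse a) (inverse b)"]) (simp add: h_mult h_1_1)

text \<open>For generators closed under inverses every element is a word in them, so one can induct
  by prepending a single letter.\<close>

lemma (in group) generate_left_induct [consumes 1, case_names subset inv one mult]:
  assumes "x \<in> generate G S"
    and S: "S \<subseteq> carrier G" "\<And>x. x \<in> S \<Longrightarrow> inv x \<in> S"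
    and one: "P \<one>"
    and step: "\<And>x y. x \<in> S \<Longrightarrow> y \<in> generate G S \<Longrightarrow> P y \<Longrightarrow> P (x \<otimes> y)"
  shows "P x"
proof -
  \<comment> \<open>Generalising over a right factor \<open>y\<close> turns the product of two
    arbitrary elements into two successive prependings.\<close>
  have "P (x \<otimes> y)" if "y \<in> generate G S" "P y" for y
    using assms(1) that
  proof (induction arbitrary: y rule: generate.induct)
    case one
    then show ?case using generate_in_carrier[OF S(1)] by simp
  next
    case (incl g)
    then show ?case by (auto intro: step)
  next
    case (inv g)
    then show ?case by (auto intro: step S)
  next
    case (eng g1 g2)
    then have "P (g1 \<otimes> (g2 \<otimes> y))" by (auto intro: generate.eng)
    then show ?case
      using eng generate_in_carrier[OF S(1)] by (simp add: m_assoc)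
  qed
  from this[OF generate.one one] show ?thesis
    using generate_in_carrier[OF S(1) assms(1)] by simp
qed

lemma generate_GL7_induct [consumes 1, case_names inv one mult]:
  assumes "g \<in> generate GL7 S"
    and inv: "\<And>x. x \<in> S \<Longrightarrow> invertible x \<and> matrix_inv x \<in> S"
    and one: "P (mat 1)"
    and step: "\<And>x y. x \<in> S \<Longrightarrow> y \<in> generate GL7 S \<Longrightarrow> P y \<Longrightarrow> P (x ** y)"
  shows "P (g::'k::field^7^7)"
proof (rule group.generate_left_induct[OF group_GL7 assms(1)])
  show "S \<subseteq> carrier GL7" using inv by auto
  show "inv\<^bsub>GL7\<^esub> x \<in> S" if "x \<in> S" for x using inv[OF that] by (simp add: inv_GL7)
qed (use one step in auto)

text \<open>Conjugates multiply, so normalization can be tested on generators. The form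
  \<open>n ** x = y ** n\<close> keeps the inverse of \<open>n\<close> out of the matrix
  identities.\<close>

lemma generate_GL7_conj:
  fixes g :: "'k::field^7^7"
  assumes "g \<in> generate GL7 S"
    and inv: "\<And>x. x \<in> S \<Longrightarrow> invertible x \<and> matrix_inv x \<in> S"
    and conj: "\<And>x. x \<in> S \<Longrightarrow> \<exists>y\<in>generate GL7 S. n ** x = y ** n"
  shows "\<exists>y\<in>generate GL7 S. n ** g = y ** n"
  using assms(1)
proof (induction rule: generate_GL7_induct)
  case (inv x)
  then show ?case using assms(2) by simp
next
  case one
  show ?case using generate.one[of GL7 S] by (auto intro!: bexI[of _ "mat 1"])
next
  case (mult x y)
  obtain x' where x': "x' \<in> generate GL7 S" "n ** x = x' ** n" using conj[OF mult(1)] by blast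
  obtain y' where y': "y' \<in> generate GL7 S" "n ** y = y' ** n" using mult by blast
  have "n ** (x ** y) = (x' ** y') ** n"
    by (metis matrix_mul_assoc x'(2) y'(2))
  moreover have "x' ** y' \<in> generate GL7 S" using generate.eng[OF x'(1) y'(1)] by simp
  ultimately show ?case by blast
qed

lemma invertible_generate_GL7:
  assumes "g \<in> generate GL7 S" "\<And>x. x \<in> S \<Longrightarrow> invertible x"
  shows "invertible (g::'k::field^7^7)"
  using group.generate_in_carrier[OF group_GL7 _ assms(1)] assms(2) by (auto simp: subset_iff)

lemma generate_GL7_inv:
  assumes "g \<in> generate GL7 S" "\<And>x. x \<in> S \<Longrightarrow> invertible x"
  shows "matrix_inv (g::'k::field^7^7) \<in> generate GL7 S"
  using group.generate_m_inv_closed[OF group_GL7 _ assms(1)] assms(2)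
    invertible_generate_GL7[OF assms] by (force simp: inv_GL7)

section \<open>Membership in U, V, V' and G2\<close>

lemma U_carrier: "carrier U = generate GL7
     (range x_a \<union> range x_b \<union> range x_ab \<union> range x_2ab \<union> range x_3ab \<union> range x_3a2b)"
  by (simp add: U_def)

lemma G2_carrier: "carrier G2 = generate GL7 (range x_a \<union> range x_ma \<union> range x_b \<union> range x_mb)"
  by (simp add: G2_def)

lemma mult_generate: "g \<in> generate GL7 S \<Longrightarrow> g' \<in> generate GL7 S \<Longrightarrow> g ** g' \<in> generate GL7 S"
  using generate.eng[of g GL7 S g'] by simp

lemma one_generate: "mat 1 \<in> generate GL7 S"
  using generate.one[of GL7 S] by simp

lemma G2_mult [intro, simp]: "g \<in> carrier G2 \<Longrightarrow> g' \<in> carrier G2 \<Longrightarrow> g ** g' \<in> carrier G2"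
  by (simp add: G2_carrier mult_generate)

lemma G2_one [intro, simp]: "mat 1 \<in> carrier G2"
  by (simp add: G2_carrier one_generate)

lemma U_mult [intro, simp]: "g \<in> carrier U \<Longrightarrow> g' \<in> carrier U \<Longrightarrow> g ** g' \<in> carrier U"
  by (simp add: U_carrier mult_generate)

lemma U_one [intro, simp]: "mat 1 \<in> carrier U"
  by (simp add: U_carrier one_generate)

lemma V_mult [intro, simp]: "g \<in> V \<Longrightarrow> g' \<in> V \<Longrightarrow> g ** g' \<in> V"
  by (simp add: V_def mult_generate)

lemma V_one [intro, simp]: "mat 1 \<in> V"
  by (simp add: V_def one_generate)

lemma V'_mult [intro, simp]: "g \<in> V' \<Longrightarrow> g' \<in> V' \<Longrightarrow> g ** g' \<in> V'"
  by (simp add: V'_def mult_generate)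

lemma V'_one [intro, simp]: "mat 1 \<in> V'"
  by (simp add: V'_def one_generate)

lemma G2_inv [intro, simp]: "g \<in> carrier G2 \<Longrightarrow> matrix_inv g \<in> carrier G2"
  unfolding G2_carrier by (rule generate_GL7_inv) auto

lemma U_inv [intro, simp]: "g \<in> carrier U \<Longrightarrow> matrix_inv g \<in> carrier U"
  unfolding U_carrier by (rule generate_GL7_inv) auto

lemma G2_invertible: "g \<in> carrier G2 \<Longrightarrow> invertible g"
  unfolding G2_carrier by (rule invertible_generate_GL7) auto

lemma x_in_U [simp]:
  "x_a r \<in> carrier U" "x_b r \<in> carrier U" "x_ab r \<in> carrier U" "x_2ab r \<in> carrier U"
  "x_3ab r \<in> carrier U" "x_3a2b r \<in> carrier U"
  unfolding U_carrier by (intro generate.incl, blast)+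

lemma x_in_V [simp]:
  "x_a r \<in> V" "x_ab r \<in> V" "x_2ab r \<in> V" "x_3ab r \<in> V" "x_3a2b r \<in> V"
  unfolding V_def by (intro generate.incl, blast)+

lemma x_in_V' [simp]:
  "x_b r \<in> V'" "x_ab r \<in> V'" "x_2ab r \<in> V'" "x_3ab r \<in> V'" "x_3a2b r \<in> V'"
  unfolding V'_def by (intro generate.incl, blast)+

text \<open>\<open>G2\<close> is generated by the simple roots and their negatives only; every other
  root element enters it as a Weyl conjugate of one already known to lie there.\<close>

lemma G2_conj_closed:
  assumes "A \<in> carrier G2" "B \<in> carrier G2" "A ** B = C ** A"
  shows "C \<in> carrier G2"
proof -
  have "C = A ** B ** matrix_inv A"
    using assms(3) matrix_inv_cancel(1)[OF G2_invertible[OF assms(1)]]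
    by (metis matrix_mul_assoc matrix_mul_rid)
  moreover have "A ** B ** matrix_inv A \<in> carrier G2" using assms(1,2) by simp
  ultimately show ?thesis by metis
qed

lemma simple_in_G2 [simp]:
  "x_a r \<in> carrier G2" "x_b r \<in> carrier G2" "x_ma r \<in> carrier G2" "x_mb r \<in> carrier G2"
  unfolding G2_carrier by (intro generate.incl, blast)+

lemma w_in_G2 [simp]: "w_a \<in> carrier G2" "w_b \<in> carrier G2"
  by (simp_all add: w_a_def w_b_def)

lemma x_ab_in_G2 [simp]: "x_ab r \<in> carrier G2"
  by (rule G2_conj_closed[OF _ _ w_b_x_a]) simp_all

lemma x_2ab_in_G2 [simp]: "x_2ab r \<in> carrier G2"
  by (rule G2_conj_closed[OF _ _ w_a_x_ab]) simp_all

lemma x_3ab_in_G2 [simp]: "x_3ab r \<in> carrier G2"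
  by (rule G2_conj_closed[OF _ _ w_a_x_b]) simp_all

lemma x_3a2b_in_G2 [simp]: "x_3a2b r \<in> carrier G2"
  by (rule G2_conj_closed[OF _ _ w_b_x_3ab]) simp_all

lemma generate_subset_G2: "S \<subseteq> carrier G2 \<Longrightarrow> generate GL7 S \<subseteq> carrier G2"
proof
  fix g assume S: "S \<subseteq> carrier G2" and "g \<in> generate GL7 S"
  from this(2) show "g \<in> carrier G2"
    by induction (use S in \<open>auto simp: inv_GL7 G2_invertible subset_iff\<close>)
qed

lemma U_subset_G2: "carrier U \<subseteq> carrier G2"
  unfolding U_carrier by (rule generate_subset_G2) auto

lemma V_subset_G2: "V \<subseteq> carrier G2"
  unfolding V_def by (rule generate_subset_G2) auto

lemma V'_subset_G2: "V' \<subseteq> carrier G2"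
  unfolding V'_def by (rule generate_subset_G2) auto

lemma V'_subset_U: "V' \<subseteq> carrier U"
  unfolding V'_def U_carrier by (rule group.mono_generate[OF group_GL7]) blast

lemma V_subset_U: "V \<subseteq> carrier U"
  unfolding V_def U_carrier by (rule group.mono_generate[OF group_GL7]) blast

text \<open>The Bruhat decomposition inside the SL_2 attached to \<alpha>: a nontrivial lower
  unipotent element lies in the big cell. With its analogue for \<beta> this is the rank-one input
  of the decomposition of \<open>G2\<close>.\<close>

lemma x_ma_decomp:
  assumes "s \<noteq> 0"
  shows "x_ma s = x_a (inverse s) ** h (- s) (inverse (s\<^sup>2)) ** w_a ** x_a (inverse s)"
  by (rule matrix7_eqI) (use assms in \<open>simp add: act_simps field_simps power2_eq_square\<close>)

lemma x_mb_decomp: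
  assumes "s \<noteq> 0"
  shows "x_mb s = x_b (inverse s) ** h (- inverse s) (- s) ** w_b ** x_b (inverse s)"
  by (rule matrix7_eqI) (use assms in \<open>simp add: act_simps field_simps power2_eq_square\<close>)

section \<open>Elements normalizing V and V'\<close>

lemma conj_V:
  assumes "g \<in> V" "\<And>r. \<exists>y\<in>V. n ** x_a r = y ** n" "\<And>r. \<exists>y\<in>V. n ** x_ab r = y ** n"
    "\<And>r. \<exists>y\<in>V. n ** x_2ab r = y ** n" "\<And>r. \<exists>y\<in>V. n ** x_3ab r = y ** n"
    "\<And>r. \<exists>y\<in>V. n ** x_3a2b r = y ** n"
  shows "\<exists>y\<in>V. n ** g = y ** n"
  unfolding V_def
  by (rule generate_GL7_conj[OF assms(1)[unfolded V_def]]) (use assms(2-) in \<open>auto simp: V_def\<close>)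

lemma conj_V':
  assumes "g \<in> V'" "\<And>r. \<exists>y\<in>V'. n ** x_b r = y ** n" "\<And>r. \<exists>y\<in>V'. n ** x_ab r = y ** n"
    "\<And>r. \<exists>y\<in>V'. n ** x_2ab r = y ** n" "\<And>r. \<exists>y\<in>V'. n ** x_3ab r = y ** n"
    "\<And>r. \<exists>y\<in>V'. n ** x_3a2b r = y ** n"
  shows "\<exists>y\<in>V'. n ** g = y ** n"
  unfolding V'_def
  by (rule generate_GL7_conj[OF assms(1)[unfolded V'_def]]) (use assms(2-) in \<open>auto simp: V'_def\<close>)

text \<open>The same commutator as in \<open>x_a_x_b\<close>, now with the elements of
  \<open>V\<close> collected on the left and \<open>x_b r\<close> on the right.\<close>

lemma x_b_x_a_conj: "x_b r ** x_a s =
  x_a s ** x_ab (r * s) ** x_2ab (r * s\<^sup>2) ** x_3ab (- (r * s ^ 3)) ** x_3a2b (- (2 * r\<^sup>2 * s ^ 3)) ** x_b r"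
  by (rule matrix7_eqI) (simp add: act_simps algebra_simps power2_eq_square power3_eq_cube)

lemma x_b_conj_V: "g \<in> V \<Longrightarrow> \<exists>y\<in>V. x_b s ** g = y ** x_b s"
  by (erule conj_V)
     (subst x_b_x_a_conj x_b_x_3ab x_ab_x_b[symmetric] x_2ab_x_b[symmetric] x_3a2b_x_b[symmetric],
      (rule bexI, rule refl, simp))+

lemma x_a_conj_V': "g \<in> V' \<Longrightarrow> \<exists>y\<in>V'. x_a s ** g = y ** x_a s"
  by (erule conj_V')
     (subst x_a_x_b x_a_x_ab x_a_x_2ab x_3ab_x_a[symmetric] x_3a2b_x_a[symmetric],
      (rule bexI, rule refl, simp))+

lemma w_b_conj_V: "g \<in> V \<Longrightarrow> \<exists>y\<in>V. w_b ** g = y ** w_b"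
  by (erule conj_V)
     (subst w_b_x_a w_b_x_ab w_b_x_2ab w_b_x_3ab w_b_x_3a2b, (rule bexI, rule refl, simp))+

lemma w_a_conj_V': "g \<in> V' \<Longrightarrow> \<exists>y\<in>V'. w_a ** g = y ** w_a"
  by (erule conj_V')
     (subst w_a_x_b w_a_x_ab w_a_x_2ab w_a_x_3ab w_a_x_3a2b, (rule bexI, rule refl, simp))+

lemma h_conj_V:
  assumes "a \<noteq> 0" "b \<noteq> 0"
  shows "g \<in> V \<Longrightarrow> \<exists>y\<in>V. h a b ** g = y ** h a b"
  by (erule conj_V)
     (subst h_x_a[OF assms] h_x_ab[OF assms] h_x_2ab[OF assms] h_x_3ab[OF assms] h_x_3a2b[OF assms],
      (rule bexI, rule refl, simp))+

section \<open>SL_2 inside the Levi subgroup M\<close>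

lemma mat2_nth [simp]:
  "mat2 a b c d $ 1 $ 1 = a" "mat2 a b c d $ 1 $ 2 = b" "mat2 a b c d $ 2 $ 1 = c" "mat2 a b c d $ 2 $ 2 = d"
  by (simp_all add: mat2_def)

lemma mat2_mult:
  "mat2 a b c d ** mat2 a' b' c' d' = mat2 (a * a' + b * c') (a * b' + b * d') (c * a' + d * c') (c * b' + d * d')"
  by (simp add: vec_eq_iff forall_2 matrix_matrix_mult_def sum_2)

lemma mat2_eq_iff [simp]: "mat2 a b c d = mat2 a' b' c' d' \<longleftrightarrow> a = a' \<and> b = b' \<and> c = c' \<and> d = d'"
  by (metis mat2_nth)

lemma mat2_1: "mat2 1 0 0 1 = mat 1"
  by (simp add: vec_eq_iff forall_2 mat_def)

lemma det_mat2: "det (mat2 a b c d) = a * d - b * c"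
  by (simp add: det_2)

lemma mat2_cases: obtains a b c d where "A = mat2 a b c d"
  by (rule that[of "A $ 1 $ 1" "A $ 1 $ 2" "A $ 2 $ 1" "A $ 2 $ 2"])
     (simp add: vec_eq_iff forall_2)

lemma SL2_simps [simp]: "x \<otimes>\<^bsub>SL2\<^esub> y = x ** y" "\<one>\<^bsub>SL2\<^esub> = mat 1"
  by (simp_all add: SL2_def)

lemma mat2_in_SL2 [simp]: "mat2 a b c d \<in> carrier SL2 \<longleftrightarrow> a * d - b * c = 1"
  by (simp add: SL2_def det_mat2)

lemma SL2_cases:
  assumes "A \<in> carrier SL2"
  obtains a b c d where "A = mat2 a b c d" "a * d - b * c = 1"
  using assms by (metis mat2_cases mat2_in_SL2)

lemma SL2_mult [simp]: "A \<in> carrier SL2 \<Longrightarrow> B \<in> carrier SL2 \<Longrightarrow> A ** B \<in> carrier SL2"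
  by (simp add: SL2_def det_mul)

lemma SL2_one [simp]: "mat 1 \<in> carrier SL2"
  by (simp add: SL2_def)

lemma matrix_inv_mat2: "a * d - b * c = 1 \<Longrightarrow> matrix_inv (mat2 a b c d) = mat2 d (- b) (- c) a"
  by (rule matrix_inv_unique) (simp_all add: mat2_mult mat2_1[symmetric] algebra_simps)

lemma SL2_inv:
  assumes "A \<in> carrier SL2"
  shows "matrix_inv A \<in> carrier SL2" "A ** matrix_inv A = mat 1" "matrix_inv A ** A = mat 1"
proof -
  from assms obtain a b c d where A: "A = mat2 a b c d" "a * d - b * c = 1" by (rule SL2_cases)
  show "matrix_inv A \<in> carrier SL2" "A ** matrix_inv A = mat 1" "matrix_inv A ** A = mat 1"
    using A(2) by (simp_all add: A(1) matrix_inv_mat2 mat2_mult mat2_1[symmetric] algebra_simps)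
qed

lemma group_SL2: "group SL2"
proof (rule groupI)
  show "\<exists>y\<in>carrier SL2. y \<otimes>\<^bsub>SL2\<^esub> x = \<one>\<^bsub>SL2\<^esub>" if "x \<in> carrier SL2" for x :: "'a^2^2"
    using SL2_inv[OF that] by auto
qed (simp_all add: matrix_mul_assoc)

lemma star_mat2: "a * d - b * c = 1 \<Longrightarrow> star (mat2 a b c d) = mat2 a (- b) (- c) d"
proof -
  have "transpose (mat2 p q r t) = mat2 p r q t" for p q r t :: 'a
    by (simp add: vec_eq_iff forall_2 transpose_def)
  then show "a * d - b * c = 1 \<Longrightarrow> ?thesis"
    by (simp add: star_def matrix_inv_mat2 mat2_mult)
qed

lemma levi_act:
  assumes "a * d - b * c = 1"
  shows "levi (mat2 a b c d) *v vec7 v1 v2 v3 v4 v5 v6 v7 =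
    vec7 (a * v1 + b * v2) (c * v1 + d * v2) v3 v4 v5 (a * v6 - b * v7) (d * v7 - c * v6)"
  by (rule vec7_eqI) (simp_all add: levi_def star_mat2[OF assms] det_mat2 assms E_expand)

lemma levi_mult:
  assumes "A \<in> carrier SL2" "B \<in> carrier SL2"
  shows "levi (A ** B) = levi A ** levi B"
proof -
  from assms(1) obtain a b c d where A: "A = mat2 a b c d" "a * d - b * c = 1" by (rule SL2_cases)
  from assms(2) obtain a' b' c' d' where B: "B = mat2 a' b' c' d'" "a' * d' - b' * c' = 1"
    by (rule SL2_cases)
  have "A ** B \<in> carrier SL2" using assms by simp
  then show ?thesis unfolding A(1) B(1) mat2_mult
    by (intro matrix7_eqI) (simp add: levi_act A(2) B(2) mult_act algebra_simps)
qed

lemma levi_upper: "levi (mat2 1 r 0 1) = x_b r"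
  by (rule matrix7_eqI) (simp add: levi_act act_simps)

lemma levi_one: "levi (mat 1) = mat 1"
  using levi_upper[of 0] by (simp add: mat2_1 x_b_0)

lemma levi_diag: "a \<noteq> 0 \<Longrightarrow> levi (mat2 a 0 0 (inverse a)) = h a (inverse a)"
  by (rule matrix7_eqI) (simp add: levi_act act_simps)

lemma levi_weyl: "levi (mat2 0 1 (- 1) 0) = w_b"
  by (rule matrix7_eqI) (simp add: levi_act act_simps)

lemma SL2_bruhat:
  fixes A :: "'k::field^2^2"
  assumes "A \<in> carrier SL2"
  shows "(\<exists>t r. t \<noteq> 0 \<and> A = mat2 t 0 0 (inverse t) ** mat2 1 r 0 1) \<or>
    (\<exists>t r s. t \<noteq> 0 \<and> A = mat2 1 s 0 1 ** mat2 t 0 0 (inverse t) ** mat2 0 1 (- 1) 0 ** mat2 1 r 0 1)"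
proof -
  from assms obtain a b c d where A: "A = mat2 a b c d" "a * d - b * c = 1" by (rule SL2_cases)
  show ?thesis
  proof (cases "c = 0")
    case True
    then have "a \<noteq> 0" "d = inverse a" using A(2) inverse_unique[of a d] by auto
    then have "A = mat2 a 0 0 (inverse a) ** mat2 1 (b / a) 0 1"
      using True by (simp add: A mat2_mult)
    then show ?thesis using \<open>a \<noteq> 0\<close> by blast
  next
    case False
    then have "b = (a * d - 1) / c" using A(2) by (simp add: field_simps)
    then have "A = mat2 1 (a / c) 0 1 ** mat2 (- inverse c) 0 0 (inverse (- inverse c)) **
      mat2 0 1 (- 1) 0 ** mat2 1 (d / c) 0 1"
      using False by (simp add: A mat2_mult field_simps)
    then show ?thesis using False by (metis inverse_zero_imp_zero neg_equal_0_iff_equal)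
  qed
qed

lemma h_in_G2 [simp]: "a \<noteq> 0 \<Longrightarrow> h a (inverse a) \<in> carrier G2"
proof -
  assume "a \<noteq> 0"
  \<comment> \<open>The coroot formula w_\<beta>(a) w_\<beta>(1)^(-1): the first three factors are
    w_\<beta>(a), and \<open>w_b ** h (- 1) (- 1)\<close> is the inverse of
    \<open>w_b\<close>.\<close>
  then have "h a (inverse a) = x_b a ** x_mb (- inverse a) ** x_b a ** w_b ** h (- 1) (- 1)"
    by (intro matrix7_eqI) (simp add: act_simps field_simps)
  moreover have "(h (- 1) (- 1) :: 'a^7^7) \<in> carrier G2"
    unfolding w_b_w_b[symmetric] by simp
  ultimately show ?thesis by simp
qed

lemma SL2_gen_induct [consumes 1, case_names upper diag weyl mult]:
  assumes "A \<in> carrier SL2"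
    and "\<And>r. P (mat2 1 r 0 1)" "\<And>t. t \<noteq> 0 \<Longrightarrow> P (mat2 t 0 0 (inverse t))" "P (mat2 0 1 (- 1) 0)"
    and "\<And>A B. A \<in> carrier SL2 \<Longrightarrow> B \<in> carrier SL2 \<Longrightarrow> P A \<Longrightarrow> P B \<Longrightarrow> P (A ** B)"
  shows "P (A::'k::field^2^2)"
  using SL2_bruhat[OF assms(1)]
proof (elim disjE exE conjE)
  fix t r :: 'k
  assume "t \<noteq> 0" "A = mat2 t 0 0 (inverse t) ** mat2 1 r 0 1"
  then show ?thesis using assms(2-) by simp
next
  fix t r s :: 'k
  assume t: "t \<noteq> 0"
    and A: "A = mat2 1 s 0 1 ** mat2 t 0 0 (inverse t) ** mat2 0 1 (- 1) 0 ** mat2 1 r 0 1"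
  show ?thesis unfolding A
    by (intro assms(2-) SL2_mult) (simp_all add: t)
qed

lemma levi_in_G2 [simp]: "A \<in> carrier SL2 \<Longrightarrow> levi A \<in> carrier G2"
  by (induction rule: SL2_gen_induct) (simp_all add: levi_mult levi_upper levi_diag levi_weyl)

lemma levi_conj_V:
  assumes "A \<in> carrier SL2" "g \<in> V"
  shows "\<exists>y\<in>V. levi A ** g = y ** levi A"
  using assms
proof (induction arbitrary: g rule: SL2_gen_induct)
  case (mult A B)
  then obtain y where y: "y \<in> V" "levi B ** g = y ** levi B" by blast
  then obtain z where z: "z \<in> V" "levi A ** y = z ** levi A" using mult by blast
  have "levi (A ** B) ** g = z ** levi (A ** B)"
    using y(2) z(2) mult(1,2) by (metis levi_mult matrix_mul_assoc)
  then show ?case using z(1) by blast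
qed (simp_all add: levi_upper levi_diag levi_weyl x_b_conj_V h_conj_V w_b_conj_V)

lemma J_carrier: "carrier J = {levi A ** v | A v. A \<in> carrier SL2 \<and> v \<in> V}"
  by (auto simp: J_def set_mult_def)

lemma levi_in_J [simp]: "A \<in> carrier SL2 \<Longrightarrow> levi A \<in> carrier J"
  unfolding J_carrier using V_one by (force intro: exI[of _ A] exI[of _ "mat 1"])

lemma V_in_J [simp]: "g \<in> V \<Longrightarrow> g \<in> carrier J"
  unfolding J_carrier by (rule CollectI, rule exI[of _ "mat 1"]) (auto simp: levi_one)

section \<open>The Bruhat decomposition\<close>

text \<open>The Weyl group is dihedral of order 12, so its elements are represented by alternating
  words of length at most six; the flag says whether the first letter is \<open>w_a\<close>.\<close>

fun alt_word :: "bool \<Rightarrow> nat \<Rightarrow> 'k::field^7^7" where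
  "alt_word b 0 = mat 1"
| "alt_word b (Suc i) = (if b then w_a else w_b) ** alt_word (\<not> b) i"

definition cell :: "'k::field^7^7 \<Rightarrow> ('k^7^7) set" where
  "cell n = {u ** h a b ** n ** u' | u u' a b. u \<in> carrier U \<and> u' \<in> carrier U \<and> a \<noteq> 0 \<and> b \<noteq> 0}"

lemma cellI: "\<lbrakk>u \<in> carrier U; u' \<in> carrier U; a \<noteq> 0; b \<noteq> 0\<rbrakk> \<Longrightarrow> u ** h a b ** n ** u' \<in> cell n"
  by (auto simp: cell_def)

lemma cellE:
  assumes "g \<in> cell n"
  obtains u u' a b where "g = u ** (h a b ** (n ** u'))" "u \<in> carrier U" "u' \<in> carrier U" "a \<noteq> 0" "b \<noteq> 0"
  using assms unfolding cell_def by (auto simp: matrix_mul_assoc)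

lemma cellI2:
  assumes "g = u ** (h a b ** (n ** u'))" "u \<in> carrier U" "u' \<in> carrier U" "a \<noteq> 0" "b \<noteq> 0"
  shows "g \<in> cell n"
  using assms cellI[of u u' a b n] by (simp add: matrix_mul_assoc)

lemma mult_ext: "A ** B = C ** D \<Longrightarrow> A ** (B ** X) = C ** (D ** (X::'k::field^'n^'n))"
  by (simp add: matrix_mul_assoc)

text \<open>\<open>w_a\<close> normalizes \<open>V'\<close>, so in the factorization of U as V'
  times U_\<alpha> only the second factor obstructs moving \<open>w_a\<close> past U.
  \<open>U_decomp_b\<close> plays the same part for \<open>w_b\<close> and \<open>V\<close>.\<close>

lemma U_decomp_a:
  assumes "u \<in> carrier U"
  shows "\<exists>v\<in>V'. \<exists>r. u = v ** x_a r"
  using assms unfolding U_carrier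
proof (induction rule: generate_GL7_induct)
  case (inv x)
  then show ?case by auto
next
  case one
  show ?case using V'_one x_a_0 by (metis matrix_mul_lid)
next
  case (mult x y)
  then obtain v r where v: "v \<in> V'" "y = v ** x_a r" by blast
  show ?case
  proof (cases "x \<in> range x_a")
    case True
    then obtain s where s: "x = x_a s" by blast
    obtain v' where v': "v' \<in> V'" "x_a s ** v = v' ** x_a s" using x_a_conj_V'[OF v(1)] by blast
    have "x ** y = v' ** x_a (s + r)"
      unfolding s v(2) by (simp add: mult_ext[OF v'(2)] x_a_add flip: matrix_mul_assoc)
    then show ?thesis using v'(1) by blast
  next
    case False
    then have "x \<in> V'" using mult(1) by auto
    then show ?thesis using v(1) by (auto simp: v(2) matrix_mul_assoc)
  qed
qed

lemma U_decomp_b: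
  assumes "u \<in> carrier U"
  shows "\<exists>v\<in>V. \<exists>r. u = v ** x_b r"
  using assms unfolding U_carrier
proof (induction rule: generate_GL7_induct)
  case (inv x)
  then show ?case by auto
next
  case one
  show ?case using V_one x_b_0 by (metis matrix_mul_lid)
next
  case (mult x y)
  then obtain v r where v: "v \<in> V" "y = v ** x_b r" by blast
  show ?case
  proof (cases "x \<in> range x_b")
    case True
    then obtain s where s: "x = x_b s" by blast
    obtain v' where v': "v' \<in> V" "x_b s ** v = v' ** x_b s" using x_b_conj_V[OF v(1)] by blast
    have "x ** y = v' ** x_b (s + r)"
      unfolding s v(2) by (simp add: mult_ext[OF v'(2)] x_b_add flip: matrix_mul_assoc)
    then show ?thesis using v'(1) by blast
  next
    case False
    then have "x \<in> V" using mult(1) by auto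
    then show ?thesis using v(1) by (auto simp: v(2) matrix_mul_assoc)
  qed
qed

text \<open>A word n of length below six beginning with \<open>w_a\<close> becomes longer when
  \<open>w_b\<close> is prepended, which means that n^(-1) carries \<beta> to a positive root. The
  list gives the resulting root element for each length.\<close>

lemma alt_word_a_x_b:
  assumes "i < 6"
  shows "\<exists>u\<in>carrier U. x_b r ** alt_word True i = alt_word True i ** u"
proof -
  have "x_b r ** alt_word True i = alt_word True i **
    ([x_b r, x_3ab (- r), x_3a2b r, x_3a2b r, x_3ab r, x_b r] ! i)"
    using assms by (auto simp: less_Suc_eq numeral_eq_Suc)
       (rule matrix7_eqI, simp add: act_simps)+
  moreover have "[x_b r, x_3ab (- r), x_3a2b r, x_3a2b r, x_3ab r, x_b r] ! i \<in> carrier U"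
    using assms by (auto simp: less_Suc_eq numeral_eq_Suc)
  ultimately show ?thesis by blast
qed

lemma alt_word_b_x_a:
  assumes "i < 6"
  shows "\<exists>u\<in>carrier U. x_a r ** alt_word False i = alt_word False i ** u"
proof -
  have "x_a r ** alt_word False i = alt_word False i **
    ([x_a r, x_ab (- r), x_2ab r, x_2ab r, x_ab r, x_a r] ! i)"
    using assms by (auto simp: less_Suc_eq numeral_eq_Suc)
       (rule matrix7_eqI, simp add: act_simps algebra_simps)+
  moreover have "[x_a r, x_ab (- r), x_2ab r, x_2ab r, x_ab r, x_a r] ! i \<in> carrier U"
    using assms by (auto simp: less_Suc_eq numeral_eq_Suc)
  ultimately show ?thesis by blast
qed

text \<open>The length-increasing case of the multiplication rule of a BN-pair: \<open>good\<close>
  says that n^(-1) makes \<alpha> positive, so the U_\<alpha> part of the left factor passes through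
  the torus and through n into the right factor.\<close>

lemma w_a_cell:
  assumes good: "\<And>r. \<exists>u\<in>carrier U. x_a r ** n = n ** u" and g: "g \<in> cell n"
  shows "w_a ** g \<in> cell (w_a ** n)"
proof -
  from g obtain u u' a b where g: "g = u ** (h a b ** (n ** u'))" and u: "u \<in> carrier U" "u' \<in> carrier U"
    and ab: "a \<noteq> 0" "b \<noteq> 0" by (rule cellE)
  obtain v r where v: "v \<in> V'" "u = v ** x_a r" using U_decomp_a[OF u(1)] by blast
  obtain v' where v': "v' \<in> V'" "w_a ** v = v' ** w_a" using w_a_conj_V'[OF v(1)] by blast
  obtain y where y: "y \<in> carrier U" "x_a (r / b) ** n = n ** y" using good by blast
  have hx: "x_a r ** h a b = h a b ** x_a (r / b)" using ab h_x_a[of a b "r / b"] by simp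
  have "w_a ** g = v' ** (h (a * b) (inverse b) ** ((w_a ** n) ** (y ** u')))"
    unfolding g v(2)
    by (simp add: mult_ext[OF v'(2)] mult_ext[OF y(2)] mult_ext[OF hx] mult_ext[OF w_a_h[OF ab]] flip: matrix_mul_assoc)
  then show ?thesis by (rule cellI2) (use v'(1) V'_subset_U y(1) u ab in auto)
qed

text \<open>The length-decreasing case. After removal of the \<open>V'\<close> part an element
  \<open>x_a r\<close> and a torus element stand between two copies of \<open>w_a\<close>: for r = 0
  the copies merge into the torus, otherwise the rank-one decomposition leaves exactly one of
  them.\<close>

lemma w_a_cell':
  assumes good: "\<And>r. \<exists>u\<in>carrier U. x_a r ** n = n ** u" and g: "g \<in> cell (w_a ** n)"
  shows "w_a ** g \<in> cell n \<union> cell (w_a ** n)"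
proof -
  from g obtain u u' a b where g: "g = u ** (h a b ** ((w_a ** n) ** u'))"
    and u: "u \<in> carrier U" "u' \<in> carrier U"
    and ab: "a \<noteq> 0" "b \<noteq> 0" by (rule cellE)
  obtain v r where v: "v \<in> V'" "u = v ** x_a r" using U_decomp_a[OF u(1)] by blast
  obtain v' where v': "v' \<in> V'" "w_a ** v = v' ** w_a" using w_a_conj_V'[OF v(1)] by blast
  have wh: "w_a ** h a b ** w_a = h (- (a * b)) (inverse b)"
    by (simp add: w_a_h[OF ab] w_a_w_a h_mult flip: matrix_mul_assoc)
  show ?thesis
  proof (cases "r = 0")
    case True
    have wh': "w_a ** (h a b ** (w_a ** X)) = h (- (a * b)) (inverse b) ** X" for X
      unfolding wh[symmetric] by (simp add: matrix_mul_assoc)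
    have "w_a ** g = v' ** (h (- (a * b)) (inverse b) ** (n ** u'))"
      unfolding g v(2) True x_a_0 by (simp add: mult_ext[OF v'(2)] wh' flip: matrix_mul_assoc)
    then have "w_a ** g \<in> cell n" by (rule cellI2) (use v'(1) V'_subset_U u ab in auto)
    then show ?thesis by simp
  next
    case False
    \<comment> \<open>\<open>w_a ** x_a r\<close> equals \<open>x_ma (- r) ** w_a\<close>, and
      \<open>x_ma_decomp\<close> is applied to the parameter - r; this is the source of t and of the
      torus element \<open>h r (inverse (r\<^sup>2))\<close>.\<close>
    define t where "t = inverse (- r)"
    have t: "- r \<noteq> 0" "t \<noteq> 0" using False by (simp_all add: t_def)
    obtain y where y: "y \<in> carrier U" "x_a (t * b) ** n = n ** y" using good by blast
    have 1: "w_a ** x_a r = x_a t ** h r (inverse (r\<^sup>2)) ** w_a ** x_a t ** w_a"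
      using x_ma_decomp[OF t(1)] w_a_x_a[of r] by (simp add: t_def)
    have 2: "x_a t ** h (- (a * b)) (inverse b) = h (- (a * b)) (inverse b) ** x_a (t * b)"
      using ab h_x_a[of "- (a * b)" "inverse b" "t * b"] by (simp add: mult.commute[of t b] flip: mult.assoc)
    have 3: "w_a ** h (- (a * b)) (inverse b) = h (- a) b ** w_a"
      using ab w_a_h[of "- (a * b)" "inverse b"] by (simp add: mult.assoc)
    have "w_a ** g = v' ** (w_a ** x_a r) ** h a b ** w_a ** n ** u'"
      unfolding g v(2) using v'(2) by (simp add: matrix_mul_assoc)
    also have "\<dots> = v' ** x_a t ** h r (inverse (r\<^sup>2)) ** w_a ** x_a t ** (w_a ** h a b ** w_a) ** n ** u'"
      unfolding 1 by (simp add: matrix_mul_assoc)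
    also have "\<dots> = v' ** x_a t ** h r (inverse (r\<^sup>2)) ** (w_a ** h (- (a * b)) (inverse b)) ** (x_a (t * b) ** n) ** u'"
      unfolding wh by (simp add: mult_ext[OF 2] flip: matrix_mul_assoc)
    also have "\<dots> = v' ** x_a t ** (h r (inverse (r\<^sup>2)) ** h (- a) b) ** w_a ** n ** y ** u'"
      unfolding 3 y(2) by (simp add: matrix_mul_assoc)
    also have "\<dots> = (v' ** x_a t) ** (h (r * - a) (inverse (r\<^sup>2) * b) ** ((w_a ** n) ** (y ** u')))"
      unfolding h_mult by (simp add: matrix_mul_assoc)
    finally have "w_a ** g \<in> cell (w_a ** n)"
      by (rule cellI2) (use v'(1) V'_subset_U u ab y(1) False in auto)
    then show ?thesis by simp
  qed
qed

lemma w_b_cell: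
  assumes good: "\<And>r. \<exists>u\<in>carrier U. x_b r ** n = n ** u" and g: "g \<in> cell n"
  shows "w_b ** g \<in> cell (w_b ** n)"
proof -
  from g obtain u u' a b where g: "g = u ** (h a b ** (n ** u'))" and u: "u \<in> carrier U" "u' \<in> carrier U"
    and ab: "a \<noteq> 0" "b \<noteq> 0" by (rule cellE)
  obtain v r where v: "v \<in> V" "u = v ** x_b r" using U_decomp_b[OF u(1)] by blast
  obtain v' where v': "v' \<in> V" "w_b ** v = v' ** w_b" using w_b_conj_V[OF v(1)] by blast
  obtain y where y: "y \<in> carrier U" "x_b (r * b / a) ** n = n ** y" using good by blast
  have hx: "x_b r ** h a b = h a b ** x_b (r * b / a)" using ab h_x_b[of a b "r * b / a"] by simp
  have "w_b ** g = v' ** (h b a ** ((w_b ** n) ** (y ** u')))"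
    unfolding g v(2)
    by (simp add: mult_ext[OF v'(2)] mult_ext[OF y(2)] mult_ext[OF hx] mult_ext[OF w_b_h] flip: matrix_mul_assoc)
  then show ?thesis by (rule cellI2) (use v'(1) V_subset_U y(1) u ab in auto)
qed

lemma w_b_cell':
  assumes good: "\<And>r. \<exists>u\<in>carrier U. x_b r ** n = n ** u" and g: "g \<in> cell (w_b ** n)"
  shows "w_b ** g \<in> cell n \<union> cell (w_b ** n)"
proof -
  from g obtain u u' a b where g: "g = u ** (h a b ** ((w_b ** n) ** u'))"
    and u: "u \<in> carrier U" "u' \<in> carrier U"
    and ab: "a \<noteq> 0" "b \<noteq> 0" by (rule cellE)
  obtain v r where v: "v \<in> V" "u = v ** x_b r" using U_decomp_b[OF u(1)] by blast
  obtain v' where v': "v' \<in> V" "w_b ** v = v' ** w_b" using w_b_conj_V[OF v(1)] by blast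
  have wh: "w_b ** h a b ** w_b = h (- b) (- a)"
    by (simp add: w_b_h w_b_w_b h_mult flip: matrix_mul_assoc)
  show ?thesis
  proof (cases "r = 0")
    case True
    have wh': "w_b ** (h a b ** (w_b ** X)) = h (- b) (- a) ** X" for X
      unfolding wh[symmetric] by (simp add: matrix_mul_assoc)
    have "w_b ** g = v' ** (h (- b) (- a) ** (n ** u'))"
      unfolding g v(2) True x_b_0 by (simp add: mult_ext[OF v'(2)] wh' flip: matrix_mul_assoc)
    then have "w_b ** g \<in> cell n" by (rule cellI2) (use v'(1) V_subset_U u ab in auto)
    then show ?thesis by simp
  next
    case False
    define t where "t = inverse (- r)"
    have t: "- r \<noteq> 0" "t \<noteq> 0" using False by (simp_all add: t_def)
    obtain y where y: "y \<in> carrier U" "x_b (t * a / b) ** n = n ** y" using good by blast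
    have 1: "w_b ** x_b r = x_b t ** h (inverse r) r ** w_b ** x_b t ** w_b"
      using x_mb_decomp[OF t(1)] w_b_x_b[of r] by (simp add: t_def)
    have 2: "x_b t ** h (- b) (- a) = h (- b) (- a) ** x_b (t * a / b)"
      using ab h_x_b[of "- b" "- a" "t * a / b"] by simp
    have "w_b ** g = v' ** (w_b ** x_b r) ** h a b ** w_b ** n ** u'"
      unfolding g v(2) using v'(2) by (simp add: matrix_mul_assoc)
    also have "\<dots> = v' ** x_b t ** h (inverse r) r ** w_b ** x_b t ** (w_b ** h a b ** w_b) ** n ** u'"
      unfolding 1 by (simp add: matrix_mul_assoc)
    also have "\<dots> = v' ** x_b t ** h (inverse r) r ** (w_b ** h (- b) (- a)) ** (x_b (t * a / b) ** n) ** u'"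
      unfolding wh by (simp add: mult_ext[OF 2] flip: matrix_mul_assoc)
    also have "\<dots> = v' ** x_b t ** (h (inverse r) r ** h (- a) (- b)) ** w_b ** n ** y ** u'"
      unfolding w_b_h y(2) by (simp add: matrix_mul_assoc)
    also have "\<dots> = (v' ** x_b t) ** (h (inverse r * - a) (r * - b) ** ((w_b ** n) ** (y ** u')))"
      unfolding h_mult by (simp add: matrix_mul_assoc)
    finally have "w_b ** g \<in> cell (w_b ** n)"
      by (rule cellI2) (use v'(1) V_subset_U u ab y(1) False in auto)
    then show ?thesis by simp
  qed
qed

definition bruhat_cells :: "('k::field^7^7) set" where
  "bruhat_cells = (\<Union>b. \<Union>i\<in>{..6}. cell (alt_word b i))"

text \<open>The braid relation of length six, which here holds for the matrices themselves and not
  only up to the torus. It allows the longest word to be read with either first letter.\<close>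

lemma alt_word_6: "alt_word True 6 = (alt_word False 6 :: 'k::field^7^7)"
  by (simp add: numeral_eq_Suc, rule matrix7_eqI) (simp add: act_simps)

lemma w_a_bruhat_cells:
  assumes "g \<in> bruhat_cells"
  shows "w_a ** g \<in> bruhat_cells"
proof -
  from assms obtain c i where ci: "i \<le> 6" "g \<in> cell (alt_word c i)" by (auto simp: bruhat_cells_def)
  \<comment> \<open>A word beginning with \<open>w_a\<close> is stripped of that letter, and one of
    length six is first rewritten to begin with it. What remains begins with \<open>w_b\<close> and
    has length at most five, as \<open>alt_word_b_x_a\<close> requires.\<close>
  have "\<exists>i<6. g \<in> cell (alt_word False i) \<or> g \<in> cell (alt_word True (Suc i))"
  proof (cases "c \<and> i > 0 \<or> i = 6")
    case True
    then have "g \<in> cell (alt_word True i) \<and> i > 0"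
      using ci alt_word_6 by (metis (full_types) zero_less_numeral)
    then show ?thesis using ci(1) by (intro exI[of _ "i - 1"]) auto
  next
    case False
    then have "g \<in> cell (alt_word False i)" using ci by (cases c) auto
    then show ?thesis using False ci(1) by (intro exI[of _ i]) auto
  qed
  then obtain i where i: "i < 6" "g \<in> cell (alt_word False i) \<or> g \<in> cell (w_a ** alt_word False i)"
    by auto
  have "w_a ** g \<in> cell (alt_word False i) \<union> cell (w_a ** alt_word False i)"
    using i(2) w_a_cell[OF alt_word_b_x_a[OF i(1)]] w_a_cell'[OF alt_word_b_x_a[OF i(1)]] by blast
  also have "w_a ** alt_word False i = alt_word True (Suc i)" by simp
  finally show ?thesis using i(1) unfolding bruhat_cells_def
    by (metis (no_types, lifting) UN_I UNIV_I Un_iff Suc_leI atMost_iff less_imp_le)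
qed

lemma w_b_bruhat_cells:
  assumes "g \<in> bruhat_cells"
  shows "w_b ** g \<in> bruhat_cells"
proof -
  from assms obtain c i where ci: "i \<le> 6" "g \<in> cell (alt_word c i)" by (auto simp: bruhat_cells_def)
  have "\<exists>i<6. g \<in> cell (alt_word True i) \<or> g \<in> cell (alt_word False (Suc i))"
  proof (cases "\<not> c \<and> i > 0 \<or> i = 6")
    case True
    then have "g \<in> cell (alt_word False i) \<and> i > 0"
      using ci alt_word_6 by (metis (full_types) zero_less_numeral)
    then show ?thesis using ci(1) by (intro exI[of _ "i - 1"]) auto
  next
    case False
    then have "g \<in> cell (alt_word True i)" using ci by (cases c) auto
    then show ?thesis using False ci(1) by (intro exI[of _ i]) auto
  qed
  then obtain i where i: "i < 6" "g \<in> cell (alt_word True i) \<or> g \<in> cell (w_b ** alt_word True i)"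
    by auto
  have "w_b ** g \<in> cell (alt_word True i) \<union> cell (w_b ** alt_word True i)"
    using i(2) w_b_cell[OF alt_word_a_x_b[OF i(1)]] w_b_cell'[OF alt_word_a_x_b[OF i(1)]] by blast
  also have "w_b ** alt_word True i = alt_word False (Suc i)" by simp
  finally show ?thesis using i(1) unfolding bruhat_cells_def
    by (metis (no_types, lifting) UN_I UNIV_I Un_iff Suc_leI atMost_iff less_imp_le)
qed

lemma U_bruhat_cells:
  assumes "u \<in> carrier U" "g \<in> bruhat_cells"
  shows "u ** g \<in> bruhat_cells"
proof -
  have "u ** g \<in> cell n" if "g \<in> cell n" for n
  proof -
    from that obtain v v' a b where g: "g = v ** (h a b ** (n ** v'))" "v \<in> carrier U" "v' \<in> carrier U"
      "a \<noteq> 0" "b \<noteq> 0" by (rule cellE)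
    then have "u ** g = (u ** v) ** (h a b ** (n ** v'))" by (simp add: matrix_mul_assoc)
    then show ?thesis by (rule cellI2) (use g assms in auto)
  qed
  then show ?thesis using assms by (auto simp: bruhat_cells_def)
qed

text \<open>The union of the cells contains the identity and is stable under left multiplication by
  U and by both Weyl elements, hence by all generators: the negative root elements are Weyl
  conjugates of positive ones.\<close>

theorem bruhat_decomposition:
  assumes "g \<in> carrier G2"
  shows "g \<in> bruhat_cells"
  using assms unfolding G2_carrier
proof (induction rule: generate_GL7_induct)
  case (inv x)
  then show ?case by auto
next
  case one
  have "mat 1 \<in> cell (alt_word True 0)"
    by (rule cellI2[of _ "mat 1" 1 1 _ "mat 1"]) (simp_all add: h_1_1)
  then show ?case by (force simp: bruhat_cells_def)
next
  case (mult x y)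
  have wa: "w_a ** (w_a ** (w_a ** w_a)) = (mat 1 :: 'a^7^7)"
    by (rule matrix7_eqI) (simp add: act_simps)
  have wb: "w_b ** (w_b ** (w_b ** w_b)) = (mat 1 :: 'a^7^7)"
    by (rule matrix7_eqI) (simp add: act_simps)
  \<comment> \<open>The fourth power of \<open>w_a\<close> is 1, so its third power stands for the
    inverse.\<close>
  have ma: "x_ma s = w_a ** (x_a (- s) ** (w_a ** (w_a ** w_a)))" for s :: 'a
    by (simp add: mult_ext[OF w_a_x_a] wa)
  have mb: "x_mb s = w_b ** (x_b (- s) ** (w_b ** (w_b ** w_b)))" for s :: 'a
    by (simp add: mult_ext[OF w_b_x_b] wb)
  consider s where "x = x_a s \<or> x = x_b s" | s where "x = x_ma s" | s where "x = x_mb s"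
    using mult(1) by auto
  then show ?case
  proof cases
    case 1
    then have "x \<in> carrier U" by auto
    then show ?thesis using mult(3) U_bruhat_cells by blast
  next
    case 2
    then have "x ** y = w_a ** (x_a (- s) ** (w_a ** (w_a ** (w_a ** y))))"
      by (simp add: ma matrix_mul_assoc)
    then show ?thesis using mult by (simp add: w_a_bruhat_cells U_bruhat_cells)
  next
    case 3
    then have "x ** y = w_b ** (x_b (- s) ** (w_b ** (w_b ** (w_b ** y))))"
      by (simp add: mb matrix_mul_assoc)
    then show ?thesis using mult by (simp add: w_b_bruhat_cells U_bruhat_cells)
  qed
qed

section \<open>Uniqueness of the Whittaker functional\<close>

text \<open>A nonzero polynomial of least degree annihilating \<open>w0\<close> under T has a root
  c. The cofactor q of X - c has smaller degree, so q(T) w0 is not zero, and it is an eigenvector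
  for c. It stays in W because W is stable under T.\<close>

lemma eigenvector_in_subspace:
  fixes scale :: "complex \<Rightarrow> 'v::ab_group_add \<Rightarrow> 'v"
  assumes "vector_space scale" "finite B" "module.span scale B = UNIV"
    and W: "module.subspace scale W" "w0 \<in> W" "w0 \<noteq> 0"
    and T: "Vector_Spaces.linear scale scale T" "T ` W \<subseteq> W"
  obtains c w where "w \<in> W" "w \<noteq> 0" "T w = scale c w"
proof -
  interpret vector_space scale by fact
  interpret T: Vector_Spaces.linear scale scale T by fact
  \<comment> \<open>\<open>ev p\<close> is p(T) applied to \<open>w0\<close>, evaluated by Horner's
    scheme.\<close>
  define ev where "ev p = fold_coeffs (\<lambda>a x. scale a w0 + T x) p 0" for p
  have ev_0: "ev 0 = 0" by (simp add: ev_def)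
  have ev_pCons: "ev (pCons a p) = scale a w0 + T (ev p)" for a p
    by (cases "p = 0 \<and> a = 0") (auto simp: ev_def T.zero)
  have ev_add: "ev (p + q) = ev p + ev q" for p q
    by (induction p q rule: poly_induct2) (simp_all add: ev_0 ev_pCons T.add scale_left_distrib)
  have ev_diff: "ev (p - q) = ev p - ev q" for p q
    using ev_add[of "p - q" q] by simp
  have ev_smult: "ev (smult c p) = scale c (ev p)" for c p
    by (induction p) (simp_all add: ev_0 ev_pCons T.scale scale_right_distrib)
  have ev_W: "ev p \<in> W" for p
    by (induction p) (use W T in \<open>auto simp: ev_0 ev_pCons subspace_0 subspace_add subspace_scale\<close>)
  have ev_monom: "ev (monom c i) = scale c ((T ^^ i) w0)" for c i
    by (induction i) (simp_all add: monom_0 monom_Suc ev_pCons ev_0 T.zero T.scale)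
  have ev_sum: "ev (sum f I) = (\<Sum>i\<in>I. ev (f i))" for f :: "nat \<Rightarrow> complex poly" and I
    by (induction I rule: infinite_finite_induct) (simp_all add: ev_0 ev_add)
  \<comment> \<open>There is one more iterate of \<open>w0\<close> than there are elements of B.
    Either two iterates coincide, or they form a set too large to be independent; linear dependence
    of a set does not see repetitions, hence the two cases.\<close>
  have "\<exists>p. p \<noteq> 0 \<and> ev p = 0"
  proof (cases "inj_on (\<lambda>i. (T ^^ i) w0) {..card B}")
    case False
    then obtain i m where im: "i \<noteq> m" "(T ^^ i) w0 = (T ^^ m) w0" by (auto simp: inj_on_def)
    have "ev (monom 1 i + monom (- 1) m) = 0" using im by (simp add: ev_add ev_monom)
    moreover have "coeff (monom 1 i + monom (- 1 :: complex) m) i \<noteq> 0" using im by simp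
    ultimately show ?thesis by (metis coeff_0)
  next
    case True
    let ?S = "(\<lambda>i. (T ^^ i) w0) ` {..card B}"
    have "card ?S = Suc (card B)" using True by (simp add: card_image)
    then have "dependent ?S"
      using independent_span_bound[OF assms(2), of ?S] assms(3) by auto
    then obtain u v where u: "(\<Sum>x\<in>?S. scale (u x) x) = 0" "v \<in> ?S" "u v \<noteq> 0"
      using dependent_finite[of ?S] by auto
    let ?p = "\<Sum>i\<le>card B. monom (u ((T ^^ i) w0)) i"
    have "ev ?p = 0" using u(1) by (simp add: ev_sum ev_monom sum.reindex[OF True])
    moreover obtain i where "i \<le> card B" "v = (T ^^ i) w0" using u(2) by auto
    then have "coeff ?p i \<noteq> 0" using u(3) by (simp add: coeff_sum)
    ultimately show ?thesis by (metis coeff_0)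
  qed
  then obtain p where p: "p \<noteq> 0" "ev p = 0" and
    least: "\<And>q. q \<noteq> 0 \<Longrightarrow> ev q = 0 \<Longrightarrow> degree p \<le> degree q"
    using exists_least_iff[of "\<lambda>n. \<exists>p. p \<noteq> 0 \<and> ev p = 0 \<and> degree p = n"]
    by (metis not_le_imp_less)
  have "degree p > 0"
  proof (rule ccontr)
    assume "\<not> degree p > 0"
    then obtain a where "p = [:a:]" by (metis degree_eq_zeroE gr0I)
    then show False using p W(3) by (simp add: ev_pCons ev_0 T.zero)
  qed
  then obtain c where "poly p c = 0" by (metis alg_closed_imp_poly_has_root)
  then obtain q where q: "p = [:- c, 1:] * q" by (auto simp: poly_eq_0_iff_dvd)
  then have "q \<noteq> 0" using p by auto
  have "degree p = Suc (degree q)"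
    unfolding q using \<open>q \<noteq> 0\<close> by (subst degree_mult_eq) auto
  then have "ev q \<noteq> 0" using least[OF \<open>q \<noteq> 0\<close>] by auto
  moreover have "p = smult (- c) q + pCons 0 q" unfolding q by simp
  then have "ev p = T (ev q) - scale c (ev q)"
    by (simp add: ev_diff ev_smult ev_pCons)
  then have "T (ev q) = scale c (ev q)" using p(2) by simp
  ultimately show ?thesis using ev_W that by blast
qed

section \<open>The anti-involution and its fixed elements\<close>

lemma U_in_G2: "u \<in> carrier U \<Longrightarrow> u \<in> carrier G2"
  using U_subset_G2 by blast

definition tau :: "'k::field^7^7 \<Rightarrow> 'k^7^7" where
  "tau g = h 1 (- 1) ** matrix_inv g ** h 1 (- 1)"

lemma h_sign_square: "h 1 (- 1) ** h 1 (- 1) = mat 1"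
  by (simp add: h_mult h_1_1)

lemma h_sign_in_G2 [simp]: "(h 1 (- 1) :: 'a::field^7^7) \<in> carrier G2"
proof -
  have "h 1 (- 1) = (w_a ** w_a ** (w_b ** w_b) :: 'a^7^7)" by (simp add: w_a_w_a w_b_w_b h_mult)
  then show ?thesis by simp
qed

lemma tau_in_G2 [simp]: "g \<in> carrier G2 \<Longrightarrow> tau g \<in> carrier G2"
  by (simp add: tau_def)

lemma matrix_inv_mult:
  assumes "invertible (A::'k::field^'n^'n)" "invertible (B::'k::field^'n^'n)"
  shows "matrix_inv (A ** B) = matrix_inv B ** matrix_inv A"
proof (rule matrix_inv_unique)
  have "A ** B ** (matrix_inv B ** matrix_inv A) = A ** (B ** matrix_inv B) ** matrix_inv A"
    by (simp only: matrix_mul_assoc)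
  then show "A ** B ** (matrix_inv B ** matrix_inv A) = mat 1"
    using assms by (simp add: matrix_inv_cancel)
  have "matrix_inv B ** matrix_inv A ** (A ** B) = matrix_inv B ** (matrix_inv A ** A) ** B"
    by (simp only: matrix_mul_assoc)
  then show "matrix_inv B ** matrix_inv A ** (A ** B) = mat 1"
    using assms by (simp add: matrix_inv_cancel)
qed

lemma tau_mult:
  assumes "g \<in> carrier G2" "g' \<in> carrier G2"
  shows "tau (g ** g') = tau g' ** tau g"
proof -
  have "tau g' ** tau g = h 1 (- 1) ** matrix_inv g' ** (h 1 (- 1) ** h 1 (- 1)) ** matrix_inv g ** h 1 (- 1)"
    unfolding tau_def by (simp only: matrix_mul_assoc)
  then show ?thesis
    using assms by (simp add: tau_def h_sign_square matrix_inv_mult G2_invertible matrix_mul_assoc)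
qed

lemma matrix_inv_inv: "invertible A \<Longrightarrow> matrix_inv (matrix_inv A) = (A::'k::field^'n^'n)"
  by (rule matrix_inv_unique) (simp_all add: matrix_inv_cancel)

lemma tau_tau:
  assumes "g \<in> carrier G2"
  shows "tau (tau g) = g"
proof -
  have h: "matrix_inv (h 1 (- 1)) = h 1 (- 1)" by (rule matrix_inv_unique) (simp_all add: h_sign_square)
  have "tau (tau g) = (h 1 (- 1) ** h 1 (- 1)) ** g ** (h 1 (- 1) ** h 1 (- 1))"
    using assms
    by (simp add: tau_def matrix_inv_mult G2_invertible matrix_inv_inv h matrix_mul_assoc h_invertible)
  then show ?thesis by (simp add: h_sign_square)
qed

text \<open>With t = \<open>h 1 (- 1)\<close>, the equation t m^(-1) t = m is equivalent to m t m =
  t, which contains no inverse and can be checked as a matrix identity.\<close>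

lemma tau_fixedI:
  assumes "m \<in> carrier G2" "m ** h 1 (- 1) ** m = h 1 (- 1)"
  shows "tau m = m"
proof -
  have "matrix_inv m ** (m ** h 1 (- 1) ** m) = matrix_inv m ** h 1 (- 1)" using assms(2) by simp
  then have *: "h 1 (- 1) ** m = matrix_inv m ** h 1 (- 1)"
    using matrix_inv_cancel(2)[OF G2_invertible[OF assms(1)]] by (simp add: matrix_mul_assoc)
  have "tau m = h 1 (- 1) ** (matrix_inv m ** h 1 (- 1))" by (simp add: tau_def matrix_mul_assoc)
  also have "\<dots> = m" unfolding *[symmetric] by (simp add: matrix_mul_assoc h_sign_square)
  finally show ?thesis .
qed

text \<open>Each word of length one to four carries some simple root to a positive root that is not
  simple. There \<theta> is trivial, so a function that is equivariant on both sides vanishes on the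
  whole double coset. Words of length five carry one simple root to itself, and only the torus part
  can then force vanishing.\<close>

lemma alt_word_1_x_a: "alt_word False (Suc 0) ** x_a r = x_ab r ** alt_word False (Suc 0)"
  by (simp, rule matrix7_eqI, simp add: act_simps algebra_simps)

lemma alt_word_2_x_a: "alt_word True 2 ** x_a r = x_2ab r ** alt_word True 2"
  by (simp add: numeral_eq_Suc, rule matrix7_eqI, simp add: act_simps algebra_simps)

lemma alt_word_3_x_a: "alt_word False 3 ** x_a r = x_2ab r ** alt_word False 3"
  by (simp add: numeral_eq_Suc, rule matrix7_eqI, simp add: act_simps algebra_simps)

lemma alt_word_4_x_a: "alt_word True 4 ** x_a r = x_ab (- r) ** alt_word True 4"
  by (simp add: numeral_eq_Suc, rule matrix7_eqI, simp add: act_simps algebra_simps)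

lemma alt_word_5_x_a: "alt_word False 5 ** x_a r = x_a r ** alt_word False 5"
  by (simp add: numeral_eq_Suc, rule matrix7_eqI, simp add: act_simps algebra_simps)

lemma alt_word_1_x_b: "alt_word True (Suc 0) ** x_b r = x_3ab r ** alt_word True (Suc 0)"
  by (simp, rule matrix7_eqI, simp add: act_simps algebra_simps)

lemma alt_word_2_x_b: "alt_word False 2 ** x_b r = x_3a2b r ** alt_word False 2"
  by (simp add: numeral_eq_Suc, rule matrix7_eqI, simp add: act_simps algebra_simps)

lemma alt_word_3_x_b: "alt_word True 3 ** x_b r = x_3a2b r ** alt_word True 3"
  by (simp add: numeral_eq_Suc, rule matrix7_eqI, simp add: act_simps algebra_simps)

lemma alt_word_4_x_b: "alt_word False 4 ** x_b r = x_3ab (- r) ** alt_word False 4"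
  by (simp add: numeral_eq_Suc, rule matrix7_eqI, simp add: act_simps algebra_simps)

lemma alt_word_5_x_b: "alt_word True 5 ** x_b r = x_b r ** alt_word True 5"
  by (simp add: numeral_eq_Suc, rule matrix7_eqI, simp add: act_simps algebra_simps)

text \<open>\<open>h a 1\<close> runs over the torus elements on which \<alpha> is trivial, and
  \<open>h a a\<close> in the next lemma over those on which \<beta> is trivial: these are the torus
  parts left over after the vanishing argument for words of length five.\<close>

lemma alt_word_5_fixed_a:
  assumes "a \<noteq> 0"
  shows "h a 1 ** alt_word False 5 ** h 1 (- 1) ** (h a 1 ** alt_word False 5) = h 1 (- 1)"
  by (simp add: numeral_eq_Suc, rule matrix7_eqI, use assms in \<open>simp add: act_simps\<close>)

lemma alt_word_5_fixed_b:
  assumes "a \<noteq> 0"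
  shows "h a a ** alt_word True 5 ** h 1 (- 1) ** (h a a ** alt_word True 5) = h 1 (- 1)"
  by (simp add: numeral_eq_Suc, rule matrix7_eqI, use assms in \<open>simp add: act_simps\<close>, use assms in \<open>simp add: field_simps\<close>)

lemma alt_word_6_fixed:
  assumes "a \<noteq> 0" "b \<noteq> 0"
  shows "h a b ** alt_word False 6 ** h 1 (- 1) ** (h a b ** alt_word False 6) = h 1 (- 1)"
  by (simp add: numeral_eq_Suc, rule matrix7_eqI, use assms in \<open>simp add: act_simps\<close>, use assms in \<open>simp add: field_simps\<close>)

section \<open>Functions equivariant under U on both sides\<close>

locale whittaker_char =
  fixes \<psi> :: "'k::{field,finite} \<Rightarrow> complex" and \<theta> :: "'k^7^7 \<Rightarrow> complex"
  assumes psi: "nontrivial_additive_character \<psi>"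
    and theta: "is_psi_U \<psi> \<theta>"
begin

lemma psi_add: "\<psi> (r + t) = \<psi> r * \<psi> t" and psi_nz [simp]: "\<psi> r \<noteq> 0"
  using psi by (auto simp: nontrivial_additive_character_def hom_def additive_group_def units_group_def)

lemma psi_0 [simp]: "\<psi> 0 = 1"
  using psi_add[of 0 0] by simp

lemma psi_minus: "\<psi> (- r) = inverse (\<psi> r)"
  using psi_add[of r "- r"] by (simp add: inverse_unique)

lemma psi_nontrivial: "a \<noteq> 0 \<Longrightarrow> \<exists>r. \<psi> (a * r) \<noteq> 1"
proof -
  assume "a \<noteq> 0"
  obtain r where "\<psi> r \<noteq> 1" using psi by (auto simp: nontrivial_additive_character_def)
  then have "\<psi> (a * (r / a)) \<noteq> 1" using \<open>a \<noteq> 0\<close> by simp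
  then show ?thesis by blast
qed

lemma psi_sum:
  "(\<Sum>r\<in>UNIV. \<psi> (a * r)) = (if a = 0 then of_nat CARD('k) else 0)"
proof (cases "a = 0")
  case False
  then obtain t where t: "\<psi> (a * t) \<noteq> 1" using psi_nontrivial by blast
  have "(\<Sum>r\<in>UNIV. \<psi> (a * r)) = (\<Sum>r\<in>UNIV. \<psi> (a * (r + t)))"
    by (rule sum.reindex_bij_witness[of _ "\<lambda>r. r + t" "\<lambda>r. r - t"]) auto
  also have "\<dots> = (\<Sum>r\<in>UNIV. \<psi> (a * r)) * \<psi> (a * t)"
    by (simp add: distrib_left psi_add sum_distrib_right)
  finally show ?thesis using t False by simp
qed simp

lemma theta_mult: "u \<in> carrier U \<Longrightarrow> u' \<in> carrier U \<Longrightarrow> \<theta> (u ** u') = \<theta> u * \<theta> u'"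
  and theta_nz [simp]: "u \<in> carrier U \<Longrightarrow> \<theta> u \<noteq> 0"
  using theta by (auto simp: is_psi_U_def hom_def units_group_def)

lemma theta_x [simp]: "\<theta> (x_a r) = \<psi> r" "\<theta> (x_b r) = \<psi> r" "\<theta> (x_ab r) = 1" "\<theta> (x_2ab r) = 1"
  "\<theta> (x_3ab r) = 1" "\<theta> (x_3a2b r) = 1"
  using theta by (auto simp: is_psi_U_def)

lemma theta_1 [simp]: "\<theta> (mat 1) = 1"
  using theta_x(3)[of 0] by (simp add: x_ab_0)

text \<open>Inversion negates the parameter of a root element. \<open>h 1 (- 1)\<close> takes the
  value -1 on both simple roots, so conjugation by it restores the sign exactly where \<theta> is
  nontrivial.\<close>

lemma tau_U:
  assumes "u \<in> carrier U"
  shows "tau u \<in> carrier U \<and> \<theta> (tau u) = \<theta> u"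
  using assms unfolding U_carrier
proof (induction rule: generate_GL7_induct)
  case (inv x)
  then show ?case by auto
next
  case one
  have "matrix_inv (mat 1 :: 'k^7^7) = mat 1" by (rule matrix_inv_unique) simp_all
  then show ?case by (simp add: tau_def h_sign_square one_generate)
next
  case (mult x y)
  have c: "h 1 (- 1) ** h 1 (- 1) = (mat 1 :: 'k^7^7)" by (rule h_sign_square)
  have "tau x \<in> carrier U \<and> \<theta> (tau x) = \<theta> x"
    using mult(1) by (auto simp: tau_def mult_ext[OF h_x_a] mult_ext[OF h_x_b] mult_ext[OF h_x_ab]
        mult_ext[OF h_x_2ab] mult_ext[OF h_x_3ab] mult_ext[OF h_x_3a2b] c
        simp flip: matrix_mul_assoc)
  moreover have "x \<in> carrier U" "y \<in> carrier U" using mult(1,2) by (auto simp flip: U_carrier)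
  ultimately show ?case using mult(3) by (auto simp: tau_mult theta_mult U_in_G2 simp flip: U_carrier)
qed

text \<open>Besides the identity, the double cosets that can support \<open>F\<close> are those of \<open>w\<^sub>0\<close>,
  \<open>w\<^sub>0 w_a\<close> and \<open>w\<^sub>0 w_b\<close>; each of them has representatives fixed by \<open>tau\<close>.\<close>

lemma tau_invariant:
  fixes F :: "'k^7^7 \<Rightarrow> 'v::ab_group_add" and scale :: "complex \<Rightarrow> 'v \<Rightarrow> 'v"
  assumes "vector_space scale"
    and F: "\<And>u g u'. \<lbrakk>u \<in> carrier U; g \<in> carrier G2; u' \<in> carrier U\<rbrakk> \<Longrightarrow>
      F (u ** g ** u') = scale (\<theta> u * \<theta> u') (F g)"
    and "g \<in> carrier G2"
  shows "F (tau g) = F g"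
proof -
  interpret vector_space scale by fact
  have vanish: "F m = 0" if "m \<in> carrier G2" "u \<in> carrier U" "u' \<in> carrier U" "m ** u = u' ** m" "\<theta> u \<noteq> \<theta> u'"
    for m u u'
  proof -
    have "scale (\<theta> u) (F m) = scale (\<theta> u') (F m)"
      using F[of "mat 1" m u] F[of u' m "mat 1"] that by simp
    then have "scale (\<theta> u - \<theta> u') (F m) = 0" by (simp add: scale_left_diff_distrib)
    then show ?thesis using that(5) by simp
  qed
  \<comment> \<open>\<open>tau\<close> reverses products, so it turns the relation that forces
    vanishing at m into one that forces vanishing at \<open>tau m\<close>; both sides are then
    zero.\<close>
  have vanish_tau: "F (tau m) = F m"
    if m: "m \<in> carrier G2" "u \<in> carrier U" "u' \<in> carrier U" "m ** u = u' ** m" "\<theta> u \<noteq> \<theta> u'" for m u u'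
  proof -
    have "u \<in> carrier G2" "u' \<in> carrier G2" using m U_in_G2 by auto
    then have "tau m ** tau u' = tau u ** tau m"
      using m by (simp flip: tau_mult)
    then have "F (tau m) = 0" using m tau_U by (intro vanish[of "tau m" "tau u'" "tau u"]) auto
    then show ?thesis using vanish[OF that] by simp
  qed
  from bruhat_decomposition[OF assms(3)] obtain c i where i: "i \<le> 6" "g \<in> cell (alt_word c i)"
    by (auto simp: bruhat_cells_def)
  from i(2) obtain u u' a b where g: "g = u ** (h a b ** (alt_word c i ** u'))"
    and u: "u \<in> carrier U" "u' \<in> carrier U" and ab: "a \<noteq> 0" "b \<noteq> 0" by (rule cellE)
  \<comment> \<open>\<open>tau\<close> exchanges the two unipotent factors and preserves \<theta>,
    so the values of F at g and at \<open>tau g\<close> differ from those at m and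
    \<open>tau m\<close> by the same scalar. It is enough to treat m.\<close>
  define m where "m = h a b ** alt_word c i"
  have g': "g = u ** m ** u'" by (simp add: g m_def matrix_mul_assoc)
  have uG: "u \<in> carrier G2" "u' \<in> carrier G2" using u U_subset_G2 by auto
  have "matrix_inv u ** g ** matrix_inv u' = (matrix_inv u ** u) ** m ** (u' ** matrix_inv u')"
    unfolding g' by (simp only: matrix_mul_assoc)
  also have "\<dots> = m" using uG by (simp add: matrix_inv_cancel G2_invertible)
  finally have mG: "m \<in> carrier G2" using assms(3) uG by (metis G2_mult G2_inv)
  have kill: "F (tau m) = F m"
    if "alt_word c i ** x = y ** alt_word c i" "h a b ** y = y' ** h a b" "x \<in> carrier U" "y' \<in> carrier U"
      "\<theta> x \<noteq> \<theta> y'" for x y y'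
  proof -
    have "m ** x = h a b ** (alt_word c i ** x)" by (simp add: m_def matrix_mul_assoc)
    also have "\<dots> = (h a b ** y) ** alt_word c i" unfolding that(1) by (simp add: matrix_mul_assoc)
    also have "\<dots> = y' ** m" unfolding that(2) by (simp add: m_def matrix_mul_assoc)
    finally show ?thesis using that by (intro vanish_tau[OF mG, of x y'])
  qed
  obtain r where r: "\<psi> r \<noteq> 1" using psi_nontrivial[of 1] by auto
  \<comment> \<open>The torus part scales the parameter of \<open>x_a\<close> by b. If b is not 1,
    then \<psi> separates t from b t for some t. The same reasoning with the scaling factor a / b
    gives \<open>b_kill\<close>.\<close>
  have a_kill: "F (tau m) = F m" if ne: "b \<noteq> 1" and eq: "\<And>r::'k. alt_word c i ** x_a r = x_a r ** alt_word c i"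
  proof -
    obtain t where "\<psi> ((b - 1) * t) \<noteq> 1" using psi_nontrivial[of "b - 1"] ne by auto
    then have "\<psi> t \<noteq> \<psi> (b * t)" using psi_add[of "(b - 1) * t" t] by (auto simp: algebra_simps)
    then show ?thesis using h_x_a[OF ab] by (intro kill[OF eq[of t], of "x_a (b * t)"]) auto
  qed
  have b_kill: "F (tau m) = F m" if ne: "a \<noteq> b" and eq: "\<And>r::'k. alt_word c i ** x_b r = x_b r ** alt_word c i"
  proof -
    obtain t where "\<psi> ((a / b - 1) * t) \<noteq> 1" using psi_nontrivial[of "a / b - 1"] ne ab by auto
    then have "\<psi> t \<noteq> \<psi> (a / b * t)" using psi_add[of "(a / b - 1) * t" t] by (auto simp: algebra_simps)
    then show ?thesis using h_x_b[OF ab] by (intro kill[OF eq[of t], of "x_b (a / b * t)"]) auto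
  qed
  consider "i = 0" | "i = Suc 0" | "i = 2" | "i = 3" | "i = 4" | "i = 5" | "i = 6"
    using i(1) by linarith
  then have "F (tau m) = F m"
  proof cases
    case 1
    show ?thesis
    proof (cases "a = 1 \<and> b = 1")
      case True
      then have "m = mat 1" using 1 by (simp add: m_def h_1_1)
      then have "tau m = m" using mG by (intro tau_fixedI) auto
      then show ?thesis by simp
    qed (use 1 a_kill b_kill in auto)
  next
    case 2
    show ?thesis
    proof (cases c)
      case True
      show ?thesis using r True 2 h_x_3ab[OF ab] by (intro kill[of "x_b r" "x_3ab r"]) (auto simp: alt_word_1_x_b simp del: alt_word.simps)
    next
      case False
      show ?thesis using r False 2 h_x_ab[OF ab] by (intro kill[of "x_a r" "x_ab r"]) (auto simp: alt_word_1_x_a simp del: alt_word.simps)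
    qed
  next
    case 3
    show ?thesis
    proof (cases c)
      case True
      show ?thesis using r True 3 h_x_2ab[OF ab] by (intro kill[of "x_a r" "x_2ab r"]) (auto simp: alt_word_2_x_a)
    next
      case False
      show ?thesis using r False 3 h_x_3a2b[OF ab] by (intro kill[of "x_b r" "x_3a2b r"]) (auto simp: alt_word_2_x_b)
    qed
  next
    case 4
    show ?thesis
    proof (cases c)
      case True
      show ?thesis using r True 4 h_x_3a2b[OF ab] by (intro kill[of "x_b r" "x_3a2b r"]) (auto simp: alt_word_3_x_b)
    next
      case False
      show ?thesis using r False 4 h_x_2ab[OF ab] by (intro kill[of "x_a r" "x_2ab r"]) (auto simp: alt_word_3_x_a)
    qed
  next
    case 5
    show ?thesis
    proof (cases c)
      case True
      show ?thesis using r True 5 h_x_ab[OF ab] by (intro kill[of "x_a r" "x_ab (- r)"]) (auto simp: alt_word_4_x_a)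
    next
      case False
      show ?thesis using r False 5 h_x_3ab[OF ab] by (intro kill[of "x_b r" "x_3ab (- r)"]) (auto simp: alt_word_4_x_b)
    qed
  next
    case 6
    show ?thesis
    proof (cases c)
      case True
      show ?thesis
      proof (cases "a = b")
        case eq: True
        have "tau m = m" using mG alt_word_5_fixed_b[OF ab(1)] True 6 eq
          by (intro tau_fixedI) (simp_all add: m_def)
        then show ?thesis by simp
      qed (use True 6 b_kill alt_word_5_x_b in auto)
    next
      case False
      show ?thesis
      proof (cases "b = 1")
        case eq: True
        have "tau m = m" using mG alt_word_5_fixed_a[OF ab(1)] False 6 eq
          by (intro tau_fixedI) (simp_all add: m_def)
        then show ?thesis by simp
      qed (use False 6 a_kill alt_word_5_x_a in auto)
    qed
  next
    case 7
    have "m = h a b ** alt_word False 6" using 7 alt_word_6[where 'k='k] by (cases c) (auto simp: m_def)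
    then have "tau m = m" using mG alt_word_6_fixed[OF ab] by (intro tau_fixedI) simp_all
    then show ?thesis by simp
  qed
  moreover have "tau g = tau u' ** tau m ** tau u"
    unfolding g' using uG mG by (simp add: tau_mult matrix_mul_assoc)
  ultimately show ?thesis
    using F[of "tau u'" "tau m" "tau u"] F[of u m u'] u tau_U mG g' by (simp add: mult.commute)
qed

end

section \<open>The Whittaker projection and the operators compressed by it\<close>

locale g2_rep = whittaker_char \<psi> \<theta> + vector_space scale
  for \<psi> :: "'k::{field,finite} \<Rightarrow> complex" and \<theta> :: "'k^7^7 \<Rightarrow> complex"
    and scale :: "complex \<Rightarrow> 'v::ab_group_add \<Rightarrow> 'v" (infixr "\<cdot>" 75) +
  fixes \<pi> :: "'k^7^7 \<Rightarrow> 'v \<Rightarrow> 'v"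
  assumes irreducible: "irreducible_rep scale G2 \<pi>"
begin

lemma pi_linear: "g \<in> carrier G2 \<Longrightarrow> Vector_Spaces.linear scale scale (\<pi> g)"
  and pi_one [simp]: "\<pi> (mat 1) v = v"
  and pi_mult: "\<lbrakk>g \<in> carrier G2; g' \<in> carrier G2\<rbrakk> \<Longrightarrow> \<pi> (g ** g') v = \<pi> g (\<pi> g' v)"
  and finite_dim: "\<exists>B. finite B \<and> span B = UNIV"
  and irred: "\<lbrakk>subspace S; \<And>g. g \<in> carrier G2 \<Longrightarrow> \<pi> g ` S \<subseteq> S\<rbrakk> \<Longrightarrow> S = {0} \<or> S = UNIV"
  using irreducible by (auto simp: irreducible_rep_def Defs.representation_def)

context
  fixes g :: "'k^7^7"
  assumes g: "g \<in> carrier G2"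
begin

interpretation pi: Vector_Spaces.linear scale scale "\<pi> g" using g by (rule pi_linear)

lemma pi_add: "\<pi> g (v + v') = \<pi> g v + \<pi> g v'" by (rule pi.add)
lemma pi_scale: "\<pi> g (c \<cdot> v) = c \<cdot> \<pi> g v" by (rule pi.scale)
lemma pi_sum: "\<pi> g (\<Sum>i\<in>I. f i) = (\<Sum>i\<in>I. \<pi> g (f i))" by (rule pi.sum)

end

definition whittaker_proj :: "'v \<Rightarrow> 'v" where
  "whittaker_proj v = inverse (of_nat (card (carrier (U :: ('k^7^7) monoid)))) \<cdot>
     (\<Sum>u\<in>carrier U. inverse (\<theta> u) \<cdot> \<pi> u v)"

lemma card_U: "of_nat (card (carrier (U :: ('k^7^7) monoid))) \<noteq> (0::complex)"
  using U_one by (auto simp: card_eq_0_iff)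

lemma proj_add: "whittaker_proj (v + v') = whittaker_proj v + whittaker_proj v'"
  by (simp add: whittaker_proj_def pi_add U_in_G2 scale_right_distrib sum.distrib)

lemma proj_scale: "whittaker_proj (c \<cdot> v) = c \<cdot> whittaker_proj v"
  by (simp add: whittaker_proj_def pi_scale U_in_G2 scale_sum_right mult.left_commute mult.assoc mult.commute)

lemma proj_linear: "Vector_Spaces.linear scale scale whittaker_proj"
  by unfold_locales (simp_all add: proj_add proj_scale)

lemma proj_sum: "whittaker_proj (\<Sum>i\<in>I. f i) = (\<Sum>i\<in>I. whittaker_proj (f i))"
proof -
  interpret proj: Vector_Spaces.linear scale scale whittaker_proj by (rule proj_linear)
  show ?thesis by (rule proj.sum)
qed

lemma U_reindex_left:
  assumes "u \<in> carrier U"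
  shows "bij_betw ((**) u) (carrier U) (carrier (U :: ('k^7^7) monoid))"
proof (rule bij_betwI[where g = "(**) (matrix_inv u)"])
  have *: "u ** matrix_inv u = mat 1" "matrix_inv u ** u = mat 1"
    using matrix_inv_cancel[OF G2_invertible[OF U_in_G2[OF assms]]] by auto
  show "matrix_inv u ** (u ** x) = x" "u ** (matrix_inv u ** x) = x" for x
    by (simp_all add: matrix_mul_assoc *)
qed (use assms in auto)

lemma U_reindex_right:
  assumes "u \<in> carrier U"
  shows "bij_betw (\<lambda>x. x ** u) (carrier U) (carrier (U :: ('k^7^7) monoid))"
proof (rule bij_betwI[where g = "\<lambda>x. x ** matrix_inv u"])
  have *: "u ** matrix_inv u = mat 1" "matrix_inv u ** u = mat 1"
    using matrix_inv_cancel[OF G2_invertible[OF U_in_G2[OF assms]]] by auto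
  show "x ** u ** matrix_inv u = x" "x ** matrix_inv u ** u = x" for x
    by (simp_all add: * flip: matrix_mul_assoc)
qed (use assms in auto)

lemma pi_proj:
  assumes u: "u \<in> carrier U"
  shows "\<pi> u (whittaker_proj v) = \<theta> u \<cdot> whittaker_proj v"
proof -
  have "(\<Sum>x\<in>carrier U. inverse (\<theta> x) \<cdot> \<pi> x v) = (\<Sum>x\<in>carrier U. inverse (\<theta> (u ** x)) \<cdot> \<pi> (u ** x) v)"
    by (rule sum.reindex_bij_betw[OF U_reindex_left[OF u], symmetric])
  also have "\<dots> = inverse (\<theta> u) \<cdot> (\<Sum>x\<in>carrier U. inverse (\<theta> x) \<cdot> \<pi> u (\<pi> x v))"
    by (simp add: theta_mult u pi_mult U_in_G2 scale_sum_right)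
  finally have "\<theta> u \<cdot> (\<Sum>x\<in>carrier U. inverse (\<theta> x) \<cdot> \<pi> x v) = (\<Sum>x\<in>carrier U. inverse (\<theta> x) \<cdot> \<pi> u (\<pi> x v))"
    using u by simp
  then have "\<pi> u (whittaker_proj v) = inverse (of_nat (card (carrier (U :: ('k^7^7) monoid)))) \<cdot>
      \<theta> u \<cdot> (\<Sum>x\<in>carrier U. inverse (\<theta> x) \<cdot> \<pi> x v)"
    using u by (simp add: whittaker_proj_def pi_scale pi_sum U_in_G2)
  then show ?thesis by (simp add: whittaker_proj_def mult.commute)
qed

lemma proj_pi:
  assumes u: "u \<in> carrier U"
  shows "whittaker_proj (\<pi> u v) = \<theta> u \<cdot> whittaker_proj v"
proof -
  have "(\<Sum>x\<in>carrier U. inverse (\<theta> x) \<cdot> \<pi> x v) = (\<Sum>x\<in>carrier U. inverse (\<theta> (x ** u)) \<cdot> \<pi> (x ** u) v)"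
    by (rule sum.reindex_bij_betw[OF U_reindex_right[OF u], symmetric])
  also have "\<dots> = inverse (\<theta> u) \<cdot> (\<Sum>x\<in>carrier U. inverse (\<theta> x) \<cdot> \<pi> x (\<pi> u v))"
    by (simp add: theta_mult u pi_mult U_in_G2 scale_sum_right mult.commute)
  finally have "\<theta> u \<cdot> (\<Sum>x\<in>carrier U. inverse (\<theta> x) \<cdot> \<pi> x v) = (\<Sum>x\<in>carrier U. inverse (\<theta> x) \<cdot> \<pi> x (\<pi> u v))"
    using u by simp
  then have "whittaker_proj (\<pi> u v) = inverse (of_nat (card (carrier (U :: ('k^7^7) monoid)))) \<cdot>
      \<theta> u \<cdot> (\<Sum>x\<in>carrier U. inverse (\<theta> x) \<cdot> \<pi> x v)"
    by (simp add: whittaker_proj_def)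
  then show ?thesis by (simp add: whittaker_proj_def mult.commute)
qed

lemma proj_proj [simp]: "whittaker_proj (whittaker_proj v) = whittaker_proj v"
proof -
  have "whittaker_proj (whittaker_proj v) = inverse (of_nat (card (carrier (U :: ('k^7^7) monoid)))) \<cdot>
     (\<Sum>u\<in>carrier (U :: ('k^7^7) monoid). whittaker_proj v)"
    by (subst whittaker_proj_def) (simp add: pi_proj)
  also have "(\<Sum>u\<in>carrier (U :: ('k^7^7) monoid). whittaker_proj v) =
      of_nat (card (carrier (U :: ('k^7^7) monoid))) \<cdot> whittaker_proj v"
    by (rule sum_constant_scale)
  finally show ?thesis using card_U by simp
qed

definition hecke :: "'k^7^7 \<Rightarrow> 'v \<Rightarrow> 'v" where
  "hecke g v = whittaker_proj (\<pi> g (whittaker_proj v))"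

lemma hecke_equivariant:
  assumes "u \<in> carrier U" "g \<in> carrier G2" "u' \<in> carrier U"
  shows "hecke (u ** g ** u') v = (\<theta> u * \<theta> u') \<cdot> hecke g v"
  using assms
  by (simp add: hecke_def pi_mult U_in_G2 proj_pi pi_proj pi_scale proj_scale)

lemma hecke_tau: "g \<in> carrier G2 \<Longrightarrow> hecke (tau g) v = hecke g v"
  by (rule tau_invariant[where F = "\<lambda>g. hecke g v" and scale = scale])
     (auto simp: hecke_equivariant intro: vector_space_axioms)

lemma hecke_hecke:
  assumes "g \<in> carrier G2" "g' \<in> carrier G2"
  shows "hecke g (hecke g' v) = inverse (of_nat (card (carrier (U :: ('k^7^7) monoid)))) \<cdot>
    (\<Sum>u\<in>carrier U. inverse (\<theta> u) \<cdot> hecke (g ** u ** g') v)"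
proof -
  have "hecke g (hecke g' v) = whittaker_proj (\<pi> g (whittaker_proj (\<pi> g' (whittaker_proj v))))"
    by (simp add: hecke_def)
  also have "\<dots> = inverse (of_nat (card (carrier (U :: ('k^7^7) monoid)))) \<cdot>
    (\<Sum>u\<in>carrier U. inverse (\<theta> u) \<cdot> whittaker_proj (\<pi> g (\<pi> u (\<pi> g' (whittaker_proj v)))))"
    by (subst whittaker_proj_def[of "\<pi> g' (whittaker_proj v)"])
       (simp add: assms pi_scale pi_sum proj_scale proj_sum)
  finally show ?thesis using assms by (simp add: hecke_def pi_mult U_in_G2)
qed

text \<open>Gelfand's trick. By \<open>hecke_hecke\<close> the product is an average of the
  operators at g u g'. Applying \<open>tau\<close> inside changes no operator, permutes the u
  without changing \<theta>, and reverses the order of the factors; a last use of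
  \<open>hecke_tau\<close> removes \<open>tau\<close> from g and g'.\<close>

lemma hecke_commute:
  assumes "g \<in> carrier G2" "g' \<in> carrier G2"
  shows "hecke g (hecke g' v) = hecke g' (hecke g v)"
proof -
  have bij: "bij_betw tau (carrier U) (carrier (U :: ('k^7^7) monoid))"
    by (rule bij_betwI[where g = tau]) (auto simp: tau_U tau_tau U_in_G2)
  have "(\<Sum>u\<in>carrier U. inverse (\<theta> u) \<cdot> hecke (g ** u ** g') v) =
      (\<Sum>u\<in>carrier U. inverse (\<theta> (tau u)) \<cdot> hecke (g ** tau u ** g') v)"
    by (rule sum.reindex_bij_betw[OF bij, symmetric])
  also have "\<dots> = (\<Sum>u\<in>carrier U. inverse (\<theta> u) \<cdot> hecke (tau g' ** u ** tau g) v)"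
  proof (intro sum.cong refl)
    fix u :: "'k^7^7" assume u: "u \<in> carrier U"
    have "tau (g ** tau u ** g') = tau g' ** u ** tau g"
      using assms u by (simp add: tau_mult tau_tau U_in_G2 matrix_mul_assoc)
    then show "inverse (\<theta> (tau u)) \<cdot> hecke (g ** tau u ** g') v =
        inverse (\<theta> u) \<cdot> hecke (tau g' ** u ** tau g) v"
      using hecke_tau[of "g ** tau u ** g'" v] assms u tau_U by (simp add: U_in_G2)
  qed
  finally have "hecke g (hecke g' v) = hecke (tau g') (hecke (tau g) v)"
    using assms by (simp add: hecke_hecke)
  then show ?thesis using assms by (simp add: hecke_tau)
qed

lemma span_orbit:
  assumes "S \<noteq> {}" "S \<noteq> {0}"
  shows "span (\<Union>g\<in>carrier G2. \<pi> g ` S) = UNIV"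
proof -
  let ?S = "\<Union>g\<in>carrier G2. \<pi> g ` S"
  have "\<pi> g ` span ?S \<subseteq> span ?S" if g: "g \<in> carrier G2" for g
  proof -
    interpret pi: Vector_Spaces.linear scale scale "\<pi> g" using g by (rule pi_linear)
    have "\<pi> g ` ?S \<subseteq> ?S"
    proof safe
      fix g' x assume "g' \<in> carrier (G2 :: ('k^7^7) monoid)" "x \<in> S"
      then show "\<pi> g (\<pi> g' x) \<in> ?S" using g by (auto simp flip: pi_mult)
    qed
    then show ?thesis
      by (metis pi.span_image span_mono)
  qed
  then have "span ?S = {0} \<or> span ?S = UNIV" using irred[of "span ?S"] by blast
  moreover obtain x where "x \<in> S" "x \<noteq> 0" using assms by auto
  moreover have "x \<in> ?S" using G2_one pi_one \<open>x \<in> S\<close> by (metis UN_I image_eqI)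
  then have "x \<in> span ?S" by (rule span_base)
  ultimately show ?thesis by auto
qed

text \<open>The form in which irreducibility passes to the image of the projection: starting from a
  nonzero vector of the image, the operators \<open>hecke g\<close> already span all of it.\<close>

lemma proj_span_orbit:
  assumes "S \<noteq> {}" "S \<noteq> {0}" "\<And>x. x \<in> S \<Longrightarrow> whittaker_proj x = x" "subspace W"
    and "\<And>g x. g \<in> carrier G2 \<Longrightarrow> x \<in> S \<Longrightarrow> hecke g x \<in> W"
  shows "whittaker_proj v \<in> W"
proof -
  interpret proj: Vector_Spaces.linear scale scale whittaker_proj by (rule proj_linear)
  have "v \<in> span (\<Union>g\<in>carrier G2. \<pi> g ` S)" using span_orbit[OF assms(1,2)] by simp
  then show ?thesis
  proof (induction rule: span_induct_alt)
    case base
    then show ?case using assms(4) by (simp add: proj.zero subspace_0)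
  next
    case (step c x y)
    then obtain g z where g: "g \<in> carrier G2" "z \<in> S" "x = \<pi> g z" by blast
    then have "whittaker_proj x \<in> W" using assms(5)[OF g(1,2)] assms(3)[OF g(2)] by (simp add: hecke_def)
    then show ?case using assms(4) step by (simp add: proj_add proj_scale subspace_add subspace_scale)
  qed
qed

text \<open>Schur's argument: \<open>hecke g\<close> has an eigenvector in the image of the
  projection, and the eigenspace is stable under the commuting operators \<open>hecke g'\<close>,
  hence contains the whole image.\<close>

lemma hecke_scalar:
  assumes "g \<in> carrier G2"
  shows "\<exists>c. \<forall>v. hecke g v = c \<cdot> whittaker_proj v"
proof (cases "\<forall>v. whittaker_proj v = 0")
  case True
  then show ?thesis by (simp add: hecke_def)
next
  case False
  interpret proj: Vector_Spaces.linear scale scale whittaker_proj by (rule proj_linear)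
  interpret pi: Vector_Spaces.linear scale scale "\<pi> g" using assms by (rule pi_linear)
  obtain v where v: "whittaker_proj v \<noteq> 0" using False by blast
  have W: "subspace (range whittaker_proj)"
    using proj.subspace_image[OF subspace_UNIV] .
  have lin: "Vector_Spaces.linear scale scale (hecke g)"
    by unfold_locales (simp_all add: hecke_def proj_add proj_scale pi_add[OF assms] pi_scale[OF assms])
  obtain B where "finite B" "span B = UNIV" using finite_dim by blast
  moreover have "hecke g ` range whittaker_proj \<subseteq> range whittaker_proj" by (auto simp: hecke_def)
  ultimately obtain c w where w: "w \<in> range whittaker_proj" "w \<noteq> 0" "hecke g w = c \<cdot> w"
    using eigenvector_in_subspace[OF vector_space_axioms _ _ W rangeI v lin] by metis
  interpret hecke: Vector_Spaces.linear scale scale "hecke g" by (rule lin)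
  let ?W = "{x. hecke g x = c \<cdot> x}"
  have "subspace ?W"
    by (auto simp: subspace_def hecke.zero hecke.add hecke.scale scale_right_distrib mult.commute)
  moreover have "hecke g' w \<in> ?W" if "g' \<in> carrier G2" for g'
  proof -
    interpret pi': Vector_Spaces.linear scale scale "\<pi> g'" using that by (rule pi_linear)
    have "hecke g' (c \<cdot> w) = c \<cdot> hecke g' w"
      by (simp add: hecke_def proj_scale pi_scale[OF that])
    then show ?thesis using w(3) hecke_commute[OF assms that, of w] by simp
  qed
  ultimately have "whittaker_proj x \<in> ?W" for x
    using w by (intro proj_span_orbit[of "{w}"]) auto
  then show ?thesis by (intro exI[of _ c]) (auto simp: hecke_def)
qed

text \<open>Operators that are scalar on the image preserve every line in it, while the orbit of a
  single nonzero vector spans it. So the image is at most a line.\<close>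

lemma proj_rank_one: "\<exists>v0. \<forall>v. \<exists>c. whittaker_proj v = c \<cdot> v0"
proof (cases "\<forall>v. whittaker_proj v = 0")
  case True
  then show ?thesis by (metis scale_zero_left)
next
  case False
  then obtain v where v: "whittaker_proj v \<noteq> 0" by blast
  let ?v0 = "whittaker_proj v"
  have "hecke g ?v0 \<in> span {?v0}" if g: "g \<in> carrier G2" for g
  proof -
    obtain c where "hecke g ?v0 = c \<cdot> whittaker_proj ?v0" using hecke_scalar[OF g] by blast
    then show ?thesis by (simp add: span_scale span_base)
  qed
  then have "whittaker_proj x \<in> span {?v0}" for x
    using v by (intro proj_span_orbit[of "{?v0}"]) auto
  then have "\<exists>c. whittaker_proj x = c \<cdot> ?v0" for x
    by (auto simp: span_singleton image_iff)
  then show ?thesis by blast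
qed

lemma Hom_U_proj:
  assumes "l \<in> Hom_U scale \<pi> \<theta>"
  shows "l (whittaker_proj v) = l v"
proof -
  interpret l: Vector_Spaces.linear scale "(*)" l using assms by (simp add: Hom_U_def)
  have "l (\<pi> u v) = \<theta> u * l v" if "u \<in> carrier U" for u
    using assms that by (simp add: Hom_U_def)
  then show ?thesis using card_U
    by (simp add: whittaker_proj_def l.scale l.sum flip: mult.assoc)
qed

lemma Hom_U_unique:
  assumes "l \<in> Hom_U scale \<pi> \<theta>" "l v \<noteq> 0" "l' \<in> Hom_U scale \<pi> \<theta>"
  shows "\<exists>c. \<forall>x. l' x = c * l x"
proof -
  interpret l: Vector_Spaces.linear scale "(*)" l using assms by (simp add: Hom_U_def)
  interpret l': Vector_Spaces.linear scale "(*)" l' using assms by (simp add: Hom_U_def)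
  obtain v0 where v0: "\<And>v. \<exists>c. whittaker_proj v = c \<cdot> v0" using proj_rank_one by blast
  have l0: "\<exists>c. l x = c * l v0 \<and> l' x = c * l' v0" for x
    using v0[of x] Hom_U_proj[OF assms(1), of x] Hom_U_proj[OF assms(3), of x]
    by (metis l.scale l'.scale)
  then have "l v0 \<noteq> 0" using assms(2) by force
  then have "l' x = l' v0 / l v0 * l x" for x using l0[of x] by auto
  then show ?thesis by blast
qed

end

section \<open>Root exchange\<close>

text \<open>Conjugation by \<open>w_b ** w_a\<close> maps the roots of \<open>V'\<close> to those of
  \<open>V\<close> with one exception: 3\<alpha>+\<beta> goes to -\<beta>, while \<alpha>+\<beta> is
  not reached. These two are the roots to be exchanged. The root 2\<alpha>+\<beta>, carrying the
  character, goes to the simple root \<alpha>.\<close>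

lemma w_rel:
  "w_b ** w_a ** x_b r = x_3a2b r ** (w_b ** w_a)" "w_b ** w_a ** x_ab r = x_2ab r ** (w_b ** w_a)"
  "w_b ** w_a ** x_2ab r = x_a r ** (w_b ** w_a)" "w_b ** w_a ** x_3ab r = x_mb r ** (w_b ** w_a)"
  "w_b ** w_a ** x_3a2b r = x_3ab (- r) ** (w_b ** w_a)"
  by (rule matrix7_eqI, simp add: act_simps algebra_simps)+

lemma w_h:
  assumes "a \<noteq> 0"
  shows "w_b ** w_a ** h a (inverse a) = h a 1 ** (w_b ** w_a)"
  by (rule matrix7_eqI) (use assms in \<open>simp add: act_simps\<close>)

lemma h_1_in_G2 [simp]:
  assumes "a \<noteq> 0"
  shows "h a 1 \<in> carrier G2"
  by (rule G2_conj_closed[OF _ _ w_h[OF assms]]) (use assms in simp_all)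

lemma x_ab_x_a_conj: "x_ab z ** x_a r =
  x_a r ** x_2ab (2 * z * r) ** x_3ab (- (3 * z * r\<^sup>2)) ** x_3a2b (3 * z\<^sup>2 * r) ** x_ab z"
  by (rule matrix7_eqI) (simp add: act_simps algebra_simps power2_eq_square power3_eq_cube)

text \<open>The commutator of -\<beta> and \<alpha>+\<beta> has a component in \<alpha>. Through
  \<psi> it makes y and z dual variables, which is the mechanism of root exchange; the other
  commutator factors lie in roots on which the functional in question is trivial.\<close>

lemma x_mb_exchange: "x_mb (- y) ** x_ab z ** x_mb y =
  x_a (- z * y) ** x_2ab (- (y * z\<^sup>2)) ** x_3ab (- (y\<^sup>2 * z ^ 3)) ** x_3a2b (- (y * z ^ 3)) ** x_ab z"
  by (rule matrix7_eqI) (simp add: act_simps algebra_simps power2_eq_square power3_eq_cube)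

lemma sum_UNIV_shift: "(\<Sum>x\<in>UNIV. f (x + a)) = (\<Sum>x\<in>UNIV. f (x :: 'a::ab_group_add))"
  by (rule sum.reindex_bij_witness[of _ "\<lambda>x. x - a" "\<lambda>x. x + a"]) auto

lemma sum_UNIV_scale:
  "a \<noteq> 0 \<Longrightarrow> (\<Sum>x\<in>UNIV. f (a * x)) = (\<Sum>x\<in>UNIV. f (x :: 'a::field))"
  by (rule sum.reindex_bij_witness[of _ "\<lambda>x. x / a" "\<lambda>x. a * x"]) auto

section \<open>Functionals on a generic cuspidal representation\<close>

locale g2_cuspidal = g2_rep \<psi> \<theta> scale \<pi>
  for \<psi> :: "'k::{field,finite} \<Rightarrow> complex" and \<theta> :: "'k^7^7 \<Rightarrow> complex"
    and scale :: "complex \<Rightarrow> 'v::ab_group_add \<Rightarrow> 'v" (infixr "\<cdot>" 75)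
    and \<pi> :: "'k^7^7 \<Rightarrow> 'v \<Rightarrow> 'v" +
  fixes l :: "'v \<Rightarrow> complex"
  assumes cusp: "cuspidal \<pi>"
    and l_Hom: "l \<in> Hom_U scale \<pi> \<theta>" and l_nonzero: "\<exists>v. l v \<noteq> 0"
begin

abbreviation functional :: "('v \<Rightarrow> complex) \<Rightarrow> bool" where
  "functional \<Lambda> \<equiv> Vector_Spaces.linear scale (*) \<Lambda>"

lemma functional_iff: "functional \<Lambda> \<longleftrightarrow> (\<forall>v w. \<Lambda> (v + w) = \<Lambda> v + \<Lambda> w) \<and> (\<forall>c v. \<Lambda> (c \<cdot> v) = c * \<Lambda> v)"
proof
  assume "functional \<Lambda>"
  then interpret Vector_Spaces.linear scale "(*)" \<Lambda> .
  show "(\<forall>v w. \<Lambda> (v + w) = \<Lambda> v + \<Lambda> w) \<and> (\<forall>c v. \<Lambda> (c \<cdot> v) = c * \<Lambda> v)" by (simp add: add scale)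
qed (unfold_locales, auto simp: algebra_simps)

lemma functional_sum:
  assumes "functional \<Lambda>"
  shows "\<Lambda> (\<Sum>i\<in>I. f i) = (\<Sum>i\<in>I. \<Lambda> (f i))"
proof -
  interpret Vector_Spaces.linear scale "(*)" \<Lambda> by fact
  show ?thesis by (rule sum)
qed

lemma functional_pi: "functional \<Lambda> \<Longrightarrow> g \<in> carrier G2 \<Longrightarrow> functional (\<lambda>v. \<Lambda> (\<pi> g v))"
  by (simp add: functional_iff pi_add pi_scale)

lemma functional_lincomb: "(\<And>i. i \<in> I \<Longrightarrow> functional (f i)) \<Longrightarrow> functional (\<lambda>v. \<Sum>i\<in>I. c i * f i v)"
  by (simp add: functional_iff distrib_left sum.distrib sum_distrib_left mult.left_commute)

lemma functional_sum_pi: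
  "functional \<Lambda> \<Longrightarrow> (\<And>i. i \<in> I \<Longrightarrow> g i \<in> carrier G2) \<Longrightarrow> functional (\<lambda>v. \<Sum>i\<in>I. c i * \<Lambda> (\<pi> (g i) v))"
  by (intro functional_lincomb functional_pi)

lemma pi_rel:
  "\<lbrakk>A ** B = C; A \<in> carrier G2; B \<in> carrier G2\<rbrakk> \<Longrightarrow> \<pi> A (\<pi> B v) = \<pi> C v"
  by (auto simp: pi_mult)

lemma l_functional: "functional l" and l_U: "u \<in> carrier U \<Longrightarrow> l (\<pi> u v) = \<theta> u * l v"
  using l_Hom by (auto simp: Hom_U_def)

lemma Hom_U_I:
  assumes "functional \<Lambda>"
    and "\<And>r v. \<Lambda> (\<pi> (x_a r) v) = \<psi> r * \<Lambda> v" "\<And>r v. \<Lambda> (\<pi> (x_b r) v) = \<psi> r * \<Lambda> v"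
    "\<And>r v. \<Lambda> (\<pi> (x_ab r) v) = \<Lambda> v" "\<And>r v. \<Lambda> (\<pi> (x_2ab r) v) = \<Lambda> v"
    "\<And>r v. \<Lambda> (\<pi> (x_3ab r) v) = \<Lambda> v" "\<And>r v. \<Lambda> (\<pi> (x_3a2b r) v) = \<Lambda> v"
  shows "\<Lambda> \<in> Hom_U scale \<pi> \<theta>"
proof -
  have "\<Lambda> (\<pi> u v) = \<theta> u * \<Lambda> v" if "u \<in> carrier U" for u v
    using that unfolding U_carrier
  proof (induction rule: generate_GL7_induct)
    case (inv x)
    then show ?case by auto
  next
    case one
    show ?case by simp
  next
    case (mult x y)
    have xy: "x \<in> carrier U" "y \<in> carrier U" using mult(1,2) by (auto simp flip: U_carrier)
    have "\<Lambda> (\<pi> x v) = \<theta> x * \<Lambda> v" for v using mult(1) assms(2-) by auto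
    then show ?case using mult(3) xy by (simp add: pi_mult U_in_G2 theta_mult)
  qed
  then show ?thesis using assms(1) by (simp add: Hom_U_def)
qed

text \<open>Cuspidality speaks of fixed vectors. Averaging v over \<open>V'\<close> produces one,
  which must be zero, and an invariant functional takes on the sum the value at v times the order of
  \<open>V'\<close>.\<close>

lemma V'_invariant_zero:
  assumes "functional \<Lambda>"
    and "\<And>r v. \<Lambda> (\<pi> (x_b r) v) = \<Lambda> v"
    "\<And>r v. \<Lambda> (\<pi> (x_ab r) v) = \<Lambda> v" "\<And>r v. \<Lambda> (\<pi> (x_2ab r) v) = \<Lambda> v"
    "\<And>r v. \<Lambda> (\<pi> (x_3ab r) v) = \<Lambda> v" "\<And>r v. \<Lambda> (\<pi> (x_3a2b r) v) = \<Lambda> v"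
  shows "\<Lambda> v = 0"
proof -
  have inv: "\<Lambda> (\<pi> u v) = \<Lambda> v" if "u \<in> V'" for u v
    using that unfolding V'_def
  proof (induction rule: generate_GL7_induct)
    case (inv x)
    then show ?case by auto
  next
    case one
    show ?case by simp
  next
    case (mult x y)
    have "y \<in> carrier G2" using mult(2) V'_subset_G2 by (auto simp flip: V'_def)
    moreover have "x \<in> carrier G2" using mult(1) by auto
    moreover have "\<Lambda> (\<pi> x v) = \<Lambda> v" for v using mult(1) assms(2-) by auto
    ultimately show ?case using mult(3) by (simp add: pi_mult)
  qed
  have G2: "u \<in> carrier G2" if "u \<in> V'" for u :: "'k^7^7" using that V'_subset_G2 by blast
  let ?v = "\<Sum>u\<in>V'. \<pi> u v"
  have "\<pi> n ?v = ?v" if n: "n \<in> V'" for n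
  proof -
    have c: "n ** matrix_inv n = mat 1" "matrix_inv n ** n = mat 1"
      using matrix_inv_cancel[OF G2_invertible[OF G2[OF n]]] by auto
    have n': "matrix_inv n \<in> V'" using n unfolding V'_def by (intro generate_GL7_inv) auto
    have "bij_betw ((**) n) V' V'"
      by (rule bij_betwI[where g = "(**) (matrix_inv n)"]) (use n n' in \<open>auto simp: matrix_mul_assoc c\<close>)
    then have "(\<Sum>u\<in>V'. \<pi> (n ** u) v) = ?v" by (rule sum.reindex_bij_betw)
    then show ?thesis using n by (simp add: pi_sum G2 pi_mult)
  qed
  moreover have "V' \<in> (unipotent_radicals :: ('k^7^7) set set)"
  proof -
    have "matrix_inv (mat 1 :: 'k^7^7) = mat 1" by (rule matrix_inv_unique) simp_all
    then have "V' = (\<lambda>n. mat 1 ** n ** matrix_inv (mat 1 :: 'k^7^7)) ` V'" by simp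
    then show ?thesis unfolding unipotent_radicals_def by blast
  qed
  ultimately have "?v = 0" using cusp unfolding cuspidal_def by blast
  moreover have "\<Lambda> 0 = 0" using assms(1) unfolding functional_iff by (metis add_cancel_left_left)
  ultimately have "(\<Sum>u\<in>V'. \<Lambda> (\<pi> u v)) = 0" using functional_sum[OF assms(1), of "\<lambda>u. \<pi> u v" V'] by simp
  then have "of_nat (card (V' :: ('k^7^7) set)) * \<Lambda> v = 0" by (simp add: inv)
  moreover have "V' \<noteq> ({} :: ('k^7^7) set)" using V'_one by blast
  ultimately show ?thesis by simp
qed

text \<open>The inner sum over y in the zeta sum. It averages over the one root of \<open>V'\<close>
  that \<open>w_b ** w_a\<close> makes negative, where the Whittaker functional has no equivariance
  to offer.\<close>

definition L0 :: "'v \<Rightarrow> complex" where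
  "L0 v = (\<Sum>y\<in>UNIV. l (\<pi> (w_b ** w_a ** x_3ab y) v))"

definition V'_equivariant :: "('v \<Rightarrow> complex) \<Rightarrow> bool" where
  "V'_equivariant \<Lambda> \<longleftrightarrow> functional \<Lambda> \<and>
     (\<forall>r v. \<Lambda> (\<pi> (x_b r) v) = \<Lambda> v \<and> \<Lambda> (\<pi> (x_ab r) v) = \<Lambda> v \<and> \<Lambda> (\<pi> (x_2ab r) v) = \<psi> r * \<Lambda> v \<and>
        \<Lambda> (\<pi> (x_3ab r) v) = \<Lambda> v \<and> \<Lambda> (\<pi> (x_3a2b r) v) = \<Lambda> v)"

lemma V'_equivariantD:
  assumes "V'_equivariant \<Lambda>"
  shows "functional \<Lambda>" "\<Lambda> (\<pi> (x_b r) v) = \<Lambda> v" "\<Lambda> (\<pi> (x_ab r) v) = \<Lambda> v"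
    "\<Lambda> (\<pi> (x_2ab r) v) = \<psi> r * \<Lambda> v" "\<Lambda> (\<pi> (x_3ab r) v) = \<Lambda> v" "\<Lambda> (\<pi> (x_3a2b r) v) = \<Lambda> v"
  using assms by (auto simp: V'_equivariant_def)

text \<open>The roots \<beta>, \<alpha>+\<beta>, 2\<alpha>+\<beta> and 3\<alpha>+2\<beta> are moved
  into U, and only 2\<alpha>+\<beta> lands on a simple root, which gives the character. The root
  3\<alpha>+\<beta> is absorbed by a shift of y.\<close>

lemma L0_equivariant: "V'_equivariant L0"
proof -
  let ?w = "w_b ** w_a :: 'k^7^7"
  have rel: "l (\<pi> (?w ** x_3ab y) (\<pi> (X) v)) = \<theta> u * l (\<pi> (?w ** x_3ab y) v)"
    if "?w ** x_3ab y ** X = u ** (?w ** x_3ab y)" "u \<in> carrier U" "X \<in> carrier G2" for X u y v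
  proof -
    have "\<pi> (?w ** x_3ab y) (\<pi> (X) v) = \<pi> (u ** (?w ** x_3ab y)) v"
      using that by (intro pi_rel) auto
    also have "\<dots> = \<pi> u (\<pi> (?w ** x_3ab y) v)" using that(2) by (intro pi_mult) (auto intro: U_in_G2)
    finally show ?thesis using that(2) by (simp add: l_U)
  qed
  have b: "?w ** x_3ab y ** x_b r = (x_3a2b r ** x_3ab (y * r)) ** (?w ** x_3ab y)" for y r
    by (rule matrix7_eqI) (simp add: act_simps algebra_simps)
  have ab: "?w ** x_3ab y ** x_ab r = x_2ab r ** (?w ** x_3ab y)" for y r
    by (rule matrix7_eqI) (simp add: act_simps algebra_simps)
  have ab2: "?w ** x_3ab y ** x_2ab r = x_a r ** (?w ** x_3ab y)" for y r
    by (rule matrix7_eqI) (simp add: act_simps algebra_simps)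
  have a3b2: "?w ** x_3ab y ** x_3a2b r = x_3ab (- r) ** (?w ** x_3ab y)" for y r
    by (rule matrix7_eqI) (simp add: act_simps algebra_simps)
  have a3b: "L0 (\<pi> (x_3ab r) v) = L0 v" for r v
  proof -
    have "l (\<pi> (?w ** x_3ab y) (\<pi> (x_3ab r) v)) = l (\<pi> (?w ** x_3ab (y + r)) v)" for y
      by (subst pi_rel) (simp_all add: x_3ab_add flip: matrix_mul_assoc)
    then show ?thesis unfolding L0_def
      using sum_UNIV_shift[of "\<lambda>y. l (\<pi> (?w ** x_3ab y) v)" r] by simp
  qed
  have "functional L0"
    unfolding L0_def using functional_sum_pi[OF l_functional, of UNIV "\<lambda>y. ?w ** x_3ab y" "\<lambda>_. 1"] by simp
  then show ?thesis
    unfolding V'_equivariant_def using a3b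
    by (simp add: L0_def rel[OF b] rel[OF ab] rel[OF ab2] rel[OF a3b2] theta_mult sum_distrib_left)
qed

lemma Hom_U_multiple:
  assumes "\<Lambda> \<in> Hom_U scale \<pi> \<theta>"
  shows "\<exists>c. \<forall>v. \<Lambda> v = c * l v"
  using Hom_U_unique[OF l_Hom _ assms] l_nonzero by blast

text \<open>Fourier expansion of \<open>\<kappa>\<close> along the root subgroup of \<open>\<beta>\<close>: cuspidality removes the
  trivial character, and the torus \<open>h c 1\<close> moves the remaining ones to \<open>\<psi>\<close>.\<close>

lemma V_functional_expansion:
  assumes lin: "functional \<kappa>"
    and a: "\<And>r v. \<kappa> (\<pi> (x_a r) v) = \<psi> r * \<kappa> v"
    and ab: "\<And>r v. \<kappa> (\<pi> (x_ab r) v) = \<kappa> v" and ab2: "\<And>r v. \<kappa> (\<pi> (x_2ab r) v) = \<kappa> v"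
    and a3b: "\<And>r v. \<kappa> (\<pi> (x_3ab r) v) = \<kappa> v" and a3b2: "\<And>r v. \<kappa> (\<pi> (x_3a2b r) v) = \<kappa> v"
  shows "\<exists>m. \<forall>v. \<kappa> v = (\<Sum>c\<in>UNIV - {0}. m c * l (\<pi> (h c 1) v))"
proof -
  define K where "K c v = (\<Sum>b\<in>UNIV. inverse (\<psi> (c * b)) * \<kappa> (\<pi> (x_b b) v))" for c v
  have K_fun: "functional (K c)" for c
    unfolding K_def by (rule functional_sum_pi[OF lin]) simp
  \<comment> \<open>The commutators of \<open>x_b b\<close> and \<open>x_a r\<close> lie in roots on
    which \<kappa> is trivial, so every Fourier component keeps the character of \<kappa> on
    U_\<alpha>.\<close>
  have K_a: "K c (\<pi> (x_a r) v) = \<psi> r * K c v" for c r v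
  proof -
    have "\<pi> (x_b b) (\<pi> (x_a r) v) = \<pi> (x_a r) (\<pi> (x_ab (b * r)) (\<pi> (x_2ab (b * r\<^sup>2))
        (\<pi> (x_3ab (- (b * r ^ 3))) (\<pi> (x_3a2b (- (2 * b\<^sup>2 * r ^ 3))) (\<pi> (x_b b) v)))))" for b
      by (simp add: pi_rel[OF x_b_x_a_conj] pi_mult)
    then show ?thesis by (simp add: K_def a ab ab2 a3b a3b2 sum_distrib_left mult.left_commute)
  qed
  have K_ab: "K c (\<pi> (x_ab r) v) = K c v" and K_2ab: "K c (\<pi> (x_2ab r) v) = K c v"
    and K_3a2b: "K c (\<pi> (x_3a2b r) v) = K c v" for c r v
    by (simp_all add: K_def pi_rel[OF x_ab_x_b[symmetric]] pi_rel[OF x_2ab_x_b[symmetric]]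
        pi_rel[OF x_3a2b_x_b[symmetric]]) (simp_all add: pi_mult ab ab2 a3b2)
  have K_3ab: "K c (\<pi> (x_3ab r) v) = K c v" for c r v
    by (simp add: K_def pi_rel[OF x_b_x_3ab] pi_mult a3b a3b2)
  have K_b: "K c (\<pi> (x_b r) v) = \<psi> (c * r) * K c v" for c r v
  proof -
    have "K c (\<pi> (x_b r) v) = (\<Sum>b\<in>UNIV. inverse (\<psi> (c * b)) * \<kappa> (\<pi> (x_b (b + r)) v))"
      by (simp add: K_def pi_rel[OF x_b_add])
    also have "\<dots> = (\<Sum>b\<in>UNIV. inverse (\<psi> (c * (b - r))) * \<kappa> (\<pi> (x_b b) v))"
      using sum_UNIV_shift[of "\<lambda>b. inverse (\<psi> (c * (b - r))) * \<kappa> (\<pi> (x_b b) v)" r] by simp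
    also have "\<dots> = \<psi> (c * r) * K c v"
      using psi_minus by (simp add: K_def sum_distrib_left right_diff_distrib psi_add
          diff_conv_add_uminus[of "c * _"] mult.assoc mult.left_commute del: add_uminus_conv_diff)
    finally show ?thesis .
  qed
  have K_0: "K 0 v = 0" for v
    by (rule V'_invariant_zero[OF K_fun]) (simp_all add: K_b K_ab K_2ab K_3ab K_3a2b)
  have "\<exists>m. \<forall>v. K c v = m * l (\<pi> (h c 1) v)" if c: "c \<noteq> 0" for c
  proof -
    \<comment> \<open>On this torus element \<alpha> takes the value 1 and \<beta> the value
      \<open>inverse c\<close>: it normalizes the character on U_\<beta> and leaves the one on
      U_\<alpha> unchanged.\<close>
    let ?t = "h (inverse c) 1 :: 'k^7^7"
    have t: "?t \<in> carrier G2" "inverse c \<noteq> 0" "(1::'k) \<noteq> 0" using c by simp_all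
    have c_inv: "c * (inverse c * r) = r" for r using c by (simp flip: mult.assoc)
    note rel = h_x_a[OF t(2,3)] h_x_b[OF t(2,3)] h_x_ab[OF t(2,3)] h_x_2ab[OF t(2,3)] h_x_3ab[OF t(2,3)]
      h_x_3a2b[OF t(2,3)]
    have "(\<lambda>v. K c (\<pi> ?t v)) \<in> Hom_U scale \<pi> \<theta>"
      using K_fun t(1) c
      by (intro Hom_U_I functional_pi)
         (simp_all add: rel[THEN pi_rel] pi_mult K_a K_b K_ab K_2ab K_3ab K_3a2b c_inv)
    then obtain m where m: "\<And>v. K c (\<pi> ?t v) = m * l v" using Hom_U_multiple by blast
    have "?t ** h c 1 = mat 1" using c by (simp add: h_mult h_1_1)
    then have "\<pi> ?t (\<pi> (h c 1) v) = v" for v using pi_rel[of ?t "h c 1"] t(1) c by simp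
    then have "K c v = m * l (\<pi> (h c 1) v)" for v using m[of "\<pi> (h c 1) v"] by simp
    then show ?thesis by blast
  qed
  then obtain m where m: "\<And>c v. c \<noteq> 0 \<Longrightarrow> K c v = m c * l (\<pi> (h c 1) v)" by metis
  have "\<kappa> v = (\<Sum>c\<in>UNIV - {0}. m c / of_nat CARD('k) * l (\<pi> (h c 1) v))" for v
  proof -
    \<comment> \<open>Fourier inversion at the identity: summing over all c isolates b = 0.\<close>
    have "(\<Sum>c\<in>UNIV. K c v) = (\<Sum>b\<in>UNIV. \<Sum>c\<in>UNIV. inverse (\<psi> (c * b)) * \<kappa> (\<pi> (x_b b) v))"
      unfolding K_def by (rule sum.swap)
    also have "\<dots> = (\<Sum>b\<in>UNIV. (\<Sum>c\<in>UNIV. \<psi> (- b * c)) * \<kappa> (\<pi> (x_b b) v))"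
      using psi_minus by (simp add: sum_distrib_right mult.commute[of _ "_ :: 'k"])
    also have "\<dots> = (\<Sum>b\<in>(UNIV :: 'k set). if b = 0 then of_nat CARD('k) * \<kappa> v else 0)"
      unfolding psi_sum by (intro sum.cong) (auto simp: x_b_0)
    finally have "of_nat CARD('k) * \<kappa> v = (\<Sum>c\<in>UNIV. K c v)" by simp
    also have "\<dots> = (\<Sum>c\<in>UNIV - {0}. K c v)"
      by (rule sum.mono_neutral_right) (auto simp: K_0)
    also have "\<dots> = of_nat CARD('k) * (\<Sum>c\<in>UNIV - {0}. m c / of_nat CARD('k) * l (\<pi> (h c 1) v))"
      unfolding sum_distrib_left by (intro sum.cong) (simp_all add: m)
    finally show ?thesis by simp
  qed
  then show ?thesis by (intro exI[of _ "\<lambda>c. m c / of_nat CARD('k)"] allI)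
qed

text \<open>Root exchange: integrating over the root subgroup of \<open>\<alpha>+\<beta>\<close> turns the conjugate of
  \<open>\<Lambda>\<close> into a functional \<open>\<kappa>\<close> on which \<open>V\<close> acts by a character, and integrating \<open>\<kappa>\<close> over the
  root subgroup of \<open>-\<beta>\<close> recovers it.\<close>

lemma V'_equivariant_expansion:
  assumes "V'_equivariant \<Lambda>"
  shows "\<exists>m. \<forall>v. \<Lambda> v = (\<Sum>c\<in>UNIV - {0}. m c * L0 (\<pi> (h c (inverse c)) v))"
proof -
  note D = V'_equivariantD[OF assms]
  define w where "w = (w_b ** w_a :: 'k^7^7)"
  define w' where "w' = matrix_inv w"
  have wG: "w \<in> carrier G2" "w' \<in> carrier G2" by (simp_all add: w_def w'_def)
  have ww: "w' ** w = mat 1" "w ** w' = mat 1"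
    using matrix_inv_cancel[OF G2_invertible[OF wG(1)]] by (auto simp: w'_def)
  have conj: "w' ** B = A ** w'" if "w ** A = B ** w" for A B
  proof -
    have "w' ** B = w' ** (B ** w) ** w'" by (simp add: ww flip: matrix_mul_assoc)
    also have "\<dots> = A ** w'" unfolding that[symmetric] by (simp add: ww matrix_mul_assoc)
    finally show ?thesis .
  qed
  note rel = w_rel[where 'a='k, folded w_def, THEN conj, THEN pi_rel, OF wG(2)]
  \<comment> \<open>Transported by w, the functional has character \<psi> on \<alpha> and is trivial
    on -\<beta>, 2\<alpha>+\<beta>, 3\<alpha>+\<beta> and 3\<alpha>+2\<beta>. For equivariance under
    \<open>V\<close> only \<alpha>+\<beta> is missing, and the average \<kappa> supplies it.\<close>
  define M where "M v = \<Lambda> (\<pi> w' v)" for v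
  have M_fun: "functional M" unfolding M_def by (rule functional_pi[OF D(1) wG(2)])
  have M_a: "M (\<pi> (x_a r) v) = \<psi> r * M v" and M_2ab: "M (\<pi> (x_2ab r) v) = M v"
    and M_mb: "M (\<pi> (x_mb r) v) = M v" and M_3a2b: "M (\<pi> (x_3a2b r) v) = M v" for r v
    using wG(2) by (simp_all add: M_def rel pi_mult D)
  have M_3ab: "M (\<pi> (x_3ab r) v) = M v" for r v
    using wG(2) rel(5)[of "- r" v] by (simp add: M_def pi_mult D)
  define \<kappa> where "\<kappa> v = (\<Sum>z\<in>UNIV. M (\<pi> (x_ab z) v))" for v
  have \<kappa>_fun: "functional \<kappa>"
    unfolding \<kappa>_def using functional_sum_pi[OF M_fun, of UNIV x_ab "\<lambda>_. 1"] by simp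
  have \<kappa>_a: "\<kappa> (\<pi> (x_a r) v) = \<psi> r * \<kappa> v" for r v
    by (simp add: \<kappa>_def pi_rel[OF x_ab_x_a_conj] pi_mult M_a M_2ab M_3ab M_3a2b sum_distrib_left)
  have \<kappa>_ab: "\<kappa> (\<pi> (x_ab r) v) = \<kappa> v" for r v
    using sum_UNIV_shift[of "\<lambda>z. M (\<pi> (x_ab z) v)" r] by (simp add: \<kappa>_def pi_rel[OF x_ab_add])
  have \<kappa>_2ab: "\<kappa> (\<pi> (x_2ab r) v) = \<kappa> v" for r v
    by (simp add: \<kappa>_def pi_rel[OF x_ab_x_2ab] pi_mult M_2ab M_3a2b)
  have \<kappa>_3ab: "\<kappa> (\<pi> (x_3ab r) v) = \<kappa> v" and \<kappa>_3a2b: "\<kappa> (\<pi> (x_3a2b r) v) = \<kappa> v" for r v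
    by (simp_all add: \<kappa>_def pi_rel[OF x_3ab_x_ab[symmetric]] pi_rel[OF x_3a2b_x_ab[symmetric]])
       (simp_all add: pi_mult M_3ab M_3a2b)
  \<comment> \<open>Invariance under -\<beta> and \<open>x_mb_exchange\<close> turn the double sum
    into one with kernel \<psi>(- z y); orthogonality in y leaves only z = 0.\<close>
  have M_\<kappa>: "of_nat CARD('k) * M v = (\<Sum>y\<in>UNIV. \<kappa> (\<pi> (x_mb y) v))" for v
  proof -
    have "M (\<pi> (x_ab z) (\<pi> (x_mb y) v)) = \<psi> (- z * y) * M (\<pi> (x_ab z) v)" for y z
    proof -
      have "M (\<pi> (x_ab z) (\<pi> (x_mb y) v)) = M (\<pi> (x_mb (- y)) (\<pi> (x_ab z) (\<pi> (x_mb y) v)))"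
        by (rule M_mb[symmetric])
      also have "\<dots> = M (\<pi> (x_mb (- y) ** x_ab z ** x_mb y) v)" by (simp add: pi_mult)
      also have "\<dots> = \<psi> (- z * y) * M (\<pi> (x_ab z) v)"
        unfolding x_mb_exchange by (simp add: pi_mult M_a M_2ab M_3ab M_3a2b)
      finally show ?thesis .
    qed
    then have "(\<Sum>y\<in>UNIV. \<kappa> (\<pi> (x_mb y) v)) = (\<Sum>y\<in>UNIV. \<Sum>z\<in>UNIV. \<psi> (- z * y) * M (\<pi> (x_ab z) v))"
      by (simp add: \<kappa>_def)
    also have "\<dots> = (\<Sum>z\<in>UNIV. (\<Sum>y\<in>UNIV. \<psi> (- z * y)) * M (\<pi> (x_ab z) v))"
      unfolding sum_distrib_right by (rule sum.swap)
    also have "\<dots> = (\<Sum>z\<in>(UNIV :: 'k set). if z = 0 then of_nat CARD('k) * M v else 0)"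
      unfolding psi_sum by (intro sum.cong) (auto simp: x_ab_0)
    finally show ?thesis by simp
  qed
  obtain m where m: "\<And>v. \<kappa> v = (\<Sum>c\<in>UNIV - {0}. m c * l (\<pi> (h c 1) v))"
    using V_functional_expansion[OF \<kappa>_fun \<kappa>_a \<kappa>_ab \<kappa>_2ab \<kappa>_3ab \<kappa>_3a2b] by blast
  have "of_nat CARD('k) * \<Lambda> v = (\<Sum>c\<in>UNIV - {0}. m c * L0 (\<pi> (h c (inverse c)) v))" for v
  proof -
    \<comment> \<open>Here \<open>x_mb y ** w\<close> is \<open>w ** x_3ab y\<close>, and
      \<open>h c 1\<close> passes through w as \<open>h c (inverse c)\<close>, on which
      3\<alpha>+\<beta> takes the value \<open>inverse c\<close>. Each term thus becomes a torus
      translate of a summand of \<open>L0\<close>, up to rescaling y.\<close>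
    have h: "l (\<pi> (h c 1) (\<pi> (x_mb y) (\<pi> w v))) = l (\<pi> (w_b ** w_a ** x_3ab (inverse c * y)) (\<pi> (h c (inverse c)) v))"
      if "c \<noteq> 0" for c y
    proof -
      have "h c 1 ** (x_mb y ** w) = (w_b ** w_a ** x_3ab (inverse c * y)) ** h c (inverse c)"
        by (rule matrix7_eqI) (use that in \<open>simp add: w_def act_simps algebra_simps\<close>)
      then have "\<pi> (h c 1 ** (x_mb y ** w)) v = \<pi> (w_b ** w_a ** x_3ab (inverse c * y) ** h c (inverse c)) v"
        by simp
      then show ?thesis using that wG(1) by (simp add: pi_mult)
    qed
    have "\<Lambda> v = M (\<pi> w v)" using wG ww(1) pi_rel[of w' w] by (simp add: M_def)
    then have "of_nat CARD('k) * \<Lambda> v = (\<Sum>y\<in>UNIV. \<kappa> (\<pi> (x_mb y) (\<pi> w v)))" using M_\<kappa> by simp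
    also have "\<dots> = (\<Sum>c\<in>UNIV - {0}. m c * (\<Sum>y\<in>UNIV. l (\<pi> (h c 1) (\<pi> (x_mb y) (\<pi> w v)))))"
      unfolding m sum_distrib_left by (rule sum.swap)
    also have "\<dots> = (\<Sum>c\<in>UNIV - {0}. m c * L0 (\<pi> (h c (inverse c)) v))"
    proof (intro sum.cong refl)
      fix c :: 'k assume "c \<in> UNIV - {0}"
      then have c: "c \<noteq> 0" by simp
      then have "(\<Sum>y\<in>UNIV. l (\<pi> (h c 1) (\<pi> (x_mb y) (\<pi> w v)))) = L0 (\<pi> (h c (inverse c)) v)"
        using sum_UNIV_scale[of "inverse c" "\<lambda>y. l (\<pi> (w_b ** w_a ** x_3ab y) (\<pi> (h c (inverse c)) v))"]
        by (simp only: h[OF c] L0_def) (simp add: c)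
      then show "m c * (\<Sum>y\<in>UNIV. l (\<pi> (h c 1) (\<pi> (x_mb y) (\<pi> w v)))) = m c * L0 (\<pi> (h c (inverse c)) v)"
        by simp
    qed
    finally show ?thesis .
  qed
  then have "\<Lambda> v = (\<Sum>c\<in>UNIV - {0}. (m c / of_nat CARD('k)) * L0 (\<pi> (h c (inverse c)) v))" for v
    by (simp add: sum_divide_distrib[symmetric] field_simps)
  then show ?thesis by (intro exI[of _ "\<lambda>c. m c / of_nat CARD('k)"]) simp
qed

end

section \<open>The zeta sums\<close>

lemma SL2_reindex_left:
  fixes A :: "'k::field^2^2"
  assumes "A \<in> carrier SL2"
  shows "bij_betw ((**) A) (carrier SL2) (carrier SL2)"
proof (rule bij_betwI[where g = "(**) (matrix_inv A)"])
  show "matrix_inv A ** (A ** X) = X" "A ** (matrix_inv A ** X) = X" for X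
    by (simp_all add: matrix_mul_assoc SL2_inv[OF assms])
qed (use assms SL2_inv(1)[OF assms] in auto)

lemma sum_SL2_shift:
  fixes A :: "'k::{field,finite}^2^2"
  assumes "A \<in> carrier SL2"
  shows "(\<Sum>g\<in>carrier SL2. f (A ** g)) = (\<Sum>g\<in>carrier SL2. f g)"
  by (rule sum.reindex_bij_betw[OF SL2_reindex_left[OF assms]])

lemma N_SL2_subgroup: "subgroup N_SL2 (SL2 :: ('k::field^2^2) monoid)"
proof (rule group.subgroupI[OF group_SL2])
  show "N_SL2 \<subseteq> carrier SL2" by (auto simp: N_SL2_def)
  show "N_SL2 \<noteq> {}" by (auto simp: N_SL2_def)
  fix a b :: "'k^2^2"
  assume "a \<in> N_SL2" "b \<in> N_SL2"
  then obtain r t where a: "a = mat2 1 r 0 1" "b = mat2 1 t 0 1" by (auto simp: N_SL2_def)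
  show "a \<otimes>\<^bsub>SL2\<^esub> b \<in> N_SL2" by (auto simp: a N_SL2_def mat2_mult)
  have "inv\<^bsub>SL2\<^esub> a = mat2 1 (- r) 0 1"
    by (rule group.inv_equality[OF group_SL2]) (simp_all add: a mat2_mult mat2_1)
  then show "inv\<^bsub>SL2\<^esub> a \<in> N_SL2" by (auto simp: N_SL2_def)
qed

text \<open>Each coset consists of q elements with the same value. A sum over the whole group can be
  shifted by any element on the left, which a sum over cosets of N cannot.\<close>

lemma sum_rcosets_N:
  fixes F :: "'k::{field,finite}^2^2 \<Rightarrow> complex"
  assumes F: "\<And>r g. g \<in> carrier SL2 \<Longrightarrow> F (mat2 1 r 0 1 ** g) = F g"
  shows "of_nat CARD('k) * (\<Sum>C\<in>rcosets\<^bsub>SL2\<^esub> N_SL2. F (SOME g. g \<in> C)) = (\<Sum>g\<in>carrier SL2. F g)"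
proof -
  have C: "of_nat CARD('k) * F (SOME g. g \<in> C) = sum F C" if "C \<in> rcosets\<^bsub>SL2\<^esub> N_SL2" for C
  proof -
    from that obtain g where g: "g \<in> carrier SL2" "C = range (\<lambda>r. mat2 1 r 0 1 ** g)"
      by (auto simp: RCOSETS_def r_coset_def N_SL2_def)
    have "inj (\<lambda>r. mat2 1 r 0 1 ** g)"
    proof (rule injI)
      fix r t assume "mat2 1 r 0 1 ** g = mat2 1 t 0 1 ** g"
      then have "mat2 1 r 0 1 ** g ** matrix_inv g = mat2 1 t 0 1 ** g ** matrix_inv g" by simp
      then show "r = t" by (simp add: SL2_inv(2)[OF g(1)] flip: matrix_mul_assoc)
    qed
    then have "sum F C = (\<Sum>r\<in>(UNIV :: 'k set). F g)"
      by (simp add: g(2) sum.reindex F[OF g(1)])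
    then have "sum F C = of_nat CARD('k) * F g" by simp
    moreover have "F x = F g" if "x \<in> C" for x using that g F by auto
    moreover have "(SOME g. g \<in> C) \<in> C" by (rule someI[of _ "mat2 1 0 0 1 ** g"]) (simp add: g(2))
    ultimately show ?thesis by metis
  qed
  have "(\<Sum>g\<in>carrier SL2. F g) = (\<Sum>g\<in>\<Union>(rcosets\<^bsub>SL2\<^esub> N_SL2). F g)"
    by (simp add: group.rcosets_part_G[OF group_SL2 N_SL2_subgroup])
  also have "\<dots> = (\<Sum>C\<in>rcosets\<^bsub>SL2\<^esub> N_SL2. sum F C)"
    using group.rcos_disjoint[OF group_SL2 N_SL2_subgroup]
    by (subst sum.Union_disjoint) (auto simp: pairwise_def disjnt_def)
  finally show ?thesis by (simp add: sum_distrib_left C)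
qed

lemma j_eq: "j g = w_b ** w_a ** g ** matrix_inv (w_b ** w_a)"
  by (simp add: j_def matrix_inv_mult matrix_mul_assoc)

section \<open>Bilinear forms built from the Weil representation\<close>

locale g2_zeta = g2_cuspidal \<psi> \<theta> scale \<pi> l
  for \<psi> :: "'k::{field,finite} \<Rightarrow> complex" and \<theta> :: "'k^7^7 \<Rightarrow> complex"
    and scale :: "complex \<Rightarrow> 'v::ab_group_add \<Rightarrow> 'v" (infixr "\<cdot>" 75)
    and \<pi> :: "'k^7^7 \<Rightarrow> 'v \<Rightarrow> 'v" and l :: "'v \<Rightarrow> complex" +
  fixes \<omega> :: "'k^7^7 \<Rightarrow> ('k \<Rightarrow> complex) \<Rightarrow> ('k \<Rightarrow> complex)"
  assumes weil: "is_weil (\<lambda>r. inverse (\<psi> r)) \<omega>"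
begin

definition delta :: "'k \<Rightarrow> 'k \<Rightarrow> complex" where
  "delta x y = (if y = x then 1 else 0)"

lemma omega_linear: "g \<in> carrier J \<Longrightarrow> Vector_Spaces.linear (\<lambda>c \<phi> \<xi>. c * \<phi> \<xi>) (\<lambda>c \<phi> \<xi>. c * \<phi> \<xi>) (\<omega> g)"
  and omega_1 [simp]: "\<omega> (mat 1) \<phi> = \<phi>"
  and omega_mult: "\<lbrakk>g \<in> carrier J; g' \<in> carrier J\<rbrakk> \<Longrightarrow> \<omega> (g ** g') \<phi> = \<omega> g (\<omega> g' \<phi>)"
  using weil by (auto simp: is_weil_def Defs.representation_def)

lemma omega_V: "\<omega> (x_a r1 ** x_2ab r3 ** x_3ab r4 ** x_3a2b r5) \<phi> \<xi> = inverse (\<psi> r3) * \<phi> (\<xi> + r1)"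
  and omega_x_ab [simp]: "\<omega> (x_ab r) \<phi> = (\<lambda>\<xi>. inverse (\<psi> (- 2 * \<xi> * r)) * \<phi> \<xi>)"
  and omega_h: "a \<noteq> 0 \<Longrightarrow> \<omega> (h a (inverse a)) \<phi> = (\<lambda>\<xi>. quad_char a * \<phi> (a * \<xi>))"
  and omega_x_b [simp]: "\<omega> (x_b r) \<phi> = (\<lambda>\<xi>. inverse (\<psi> (r * \<xi>\<^sup>2)) * \<phi> \<xi>)"
  using weil unfolding is_weil_def by auto

lemma omega_x [simp]:
  "\<omega> (x_a r) \<phi> = (\<lambda>\<xi>. \<phi> (\<xi> + r))" "\<omega> (x_2ab r) \<phi> = (\<lambda>\<xi>. inverse (\<psi> r) * \<phi> \<xi>)"
  "\<omega> (x_3ab r) \<phi> = \<phi>" "\<omega> (x_3a2b r) \<phi> = \<phi>"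
  using omega_V[of r 0 0 0 \<phi>] omega_V[of 0 r 0 0 \<phi>] omega_V[of 0 0 r 0 \<phi>] omega_V[of 0 0 0 r \<phi>]
  by (auto simp: x_a_0 x_2ab_0 x_3ab_0 x_3a2b_0)

lemma omega_expand:
  assumes "g \<in> carrier J"
  shows "\<omega> g \<phi> \<xi> = (\<Sum>x\<in>UNIV. \<phi> x * \<omega> g (delta x) \<xi>)"
proof -
  interpret Vector_Spaces.linear "\<lambda>c \<phi> \<xi>. c * \<phi> \<xi>" "\<lambda>c \<phi> \<xi>. c * \<phi> \<xi>" "\<omega> g"
    by (rule omega_linear[OF assms])
  have app: "(\<Sum>x\<in>A. f x) \<xi> = (\<Sum>x\<in>A. f x \<xi>)" for A :: "'k set" and f :: "'k \<Rightarrow> 'k \<Rightarrow> complex" and \<xi>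
    by (induction A rule: infinite_finite_induct) auto
  have "\<phi> = (\<Sum>x\<in>UNIV. (\<lambda>\<xi>. \<phi> x * delta x \<xi>))"
    by (rule ext) (simp add: app delta_def if_distrib cong: if_cong)
  then have "\<omega> g \<phi> = (\<Sum>x\<in>UNIV. \<omega> g (\<lambda>\<xi>. \<phi> x * delta x \<xi>))" using sum by metis
  then show ?thesis by (simp add: app scale)
qed

definition L :: "'v \<Rightarrow> ('k \<Rightarrow> complex) \<Rightarrow> complex" where
  "L v \<phi> = (\<Sum>x\<in>UNIV. \<phi> x * L0 (\<pi> (x_a x) v))"

lemmas L0 = V'_equivariantD[OF L0_equivariant]

lemma psi_cancel: "inverse (\<psi> r) * a * (\<psi> r * b) = a * b"
  by simp

lemma L_x_a: "L (\<pi> (x_a r) v) (\<omega> (x_a r) \<phi>) = L v \<phi>"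
  using sum_UNIV_shift[of "\<lambda>x. \<phi> x * L0 (\<pi> (x_a x) v)" r]
  by (simp add: L_def pi_rel[OF x_a_add])

text \<open>Moving \<open>x_a x\<close> past the root element produces a component in
  2\<alpha>+\<beta>, on which \<open>L0\<close> has character \<psi>; the resulting factor is
  cancelled by the multiplier of the Weil representation for \<psi>^(-1). The same cancellation
  governs \<open>L_x_2ab\<close> and \<open>L_x_b\<close>.\<close>

lemma L_x_ab: "L (\<pi> (x_ab r) v) (\<omega> (x_ab r) \<phi>) = L v \<phi>"
proof -
  have "L0 (\<pi> (x_a x) (\<pi> (x_ab r) v)) = \<psi> (- (2 * x * r)) * L0 (\<pi> (x_a x) v)" for x
    by (simp add: pi_rel[OF x_a_x_ab] pi_mult L0 ac_simps)
  then show ?thesis by (simp add: L_def psi_cancel)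
qed

lemma L_x_2ab: "L (\<pi> (x_2ab r) v) (\<omega> (x_2ab r) \<phi>) = L v \<phi>"
  by (simp add: L_def pi_rel[OF x_a_x_2ab] pi_mult L0 psi_cancel)

lemma L_x_3ab: "L (\<pi> (x_3ab r) v) (\<omega> (x_3ab r) \<phi>) = L v \<phi>"
  by (simp add: L_def pi_rel[OF x_3ab_x_a[symmetric]]) (simp add: pi_mult L0)

lemma L_x_3a2b: "L (\<pi> (x_3a2b r) v) (\<omega> (x_3a2b r) \<phi>) = L v \<phi>"
  by (simp add: L_def pi_rel[OF x_3a2b_x_a[symmetric]]) (simp add: pi_mult L0)

lemma L_x_b: "L (\<pi> (x_b r) v) (\<omega> (x_b r) \<phi>) = L v \<phi>"
  by (simp add: L_def pi_rel[OF x_a_x_b] pi_mult L0 psi_cancel)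

lemma L_V:
  assumes "u \<in> V"
  shows "L (\<pi> u v) (\<omega> u \<phi>) = L v \<phi>"
  using assms unfolding V_def
proof (induction rule: generate_GL7_induct)
  case (inv x)
  then show ?case by auto
next
  case one
  show ?case by simp
next
  case (mult x y)
  have xy: "x \<in> V" "y \<in> V" using mult(1,2) by (auto simp flip: V_def)
  have "L (\<pi> x v) (\<omega> x \<phi>) = L v \<phi>" for v \<phi>
    using mult(1) L_x_a L_x_ab L_x_2ab L_x_3ab L_x_3a2b by blast
  moreover have "x \<in> carrier G2" "y \<in> carrier G2" using xy V_subset_G2 by auto
  ultimately show ?case using mult(3) xy by (simp add: pi_mult omega_mult)
qed

definition K :: "'k^2^2 \<Rightarrow> 'v \<Rightarrow> ('k \<Rightarrow> complex) \<Rightarrow> complex" where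
  "K g v \<phi> = L (\<pi> (levi g) v) (\<omega> (levi g) \<phi>)"

lemma K_mult:
  assumes "g \<in> carrier SL2" "g' \<in> carrier SL2"
  shows "K (g ** g') v \<phi> = K g (\<pi> (levi g') v) (\<omega> (levi g') \<phi>)"
  using assms by (simp add: K_def levi_mult pi_mult omega_mult)

lemma K_N:
  assumes "g \<in> carrier SL2"
  shows "K (mat2 1 r 0 1 ** g) v \<phi> = K g v \<phi>"
proof -
  have "K (mat2 1 r 0 1 ** g) v \<phi> = K (mat2 1 r 0 1) (\<pi> (levi g) v) (\<omega> (levi g) \<phi>)"
    using assms by (intro K_mult) auto
  also have "\<dots> = L (\<pi> (levi g) v) (\<omega> (levi g) \<phi>)"
    unfolding K_def[of "mat2 1 r 0 1"] levi_upper by (rule L_x_b)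
  finally show ?thesis by (simp add: K_def)
qed

text \<open>\<open>levi g\<close> normalizes \<open>V\<close>, so invariance under \<open>V\<close>
  survives translation of L by any element of SL_2, whereas invariance under N survives only as left
  invariance in g.\<close>

lemma K_V:
  assumes "g \<in> carrier SL2" "u \<in> V"
  shows "K g (\<pi> u v) (\<omega> u \<phi>) = K g v \<phi>"
proof -
  obtain y where y: "y \<in> V" "levi g ** u = y ** levi g" using levi_conj_V[OF assms] by blast
  have G: "u \<in> carrier G2" "y \<in> carrier G2" using assms(2) y(1) V_subset_G2 by auto
  have "\<pi> (levi g) (\<pi> u v) = \<pi> y (\<pi> (levi g) v)" "\<omega> (levi g) (\<omega> u \<phi>) = \<omega> y (\<omega> (levi g) \<phi>)"
    using assms y G by (simp_all flip: pi_mult omega_mult)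
  then show ?thesis by (simp add: K_def L_V[OF y(1)])
qed

lemma K_functional: "g \<in> carrier SL2 \<Longrightarrow> functional (\<lambda>v. K g v \<phi>)"
  unfolding K_def L_def
  by (intro functional_lincomb functional_pi[where \<Lambda> = "\<lambda>v. L0 (\<pi> (x_a _) v)"] functional_pi[where \<Lambda> = L0] L0) auto

lemma K_expand:
  assumes "g \<in> carrier SL2"
  shows "K g v \<phi> = (\<Sum>x\<in>UNIV. \<phi> x * K g v (delta x))"
proof -
  have "K g v \<phi> = (\<Sum>\<xi>\<in>UNIV. (\<Sum>x\<in>UNIV. \<phi> x * \<omega> (levi g) (delta x) \<xi>) * L0 (\<pi> (x_a \<xi>) (\<pi> (levi g) v)))"
    unfolding K_def L_def by (subst omega_expand) (simp_all add: assms)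
  also have "\<dots> = (\<Sum>x\<in>UNIV. \<phi> x * K g v (delta x))"
    unfolding K_def L_def sum_distrib_right sum_distrib_left by (subst sum.swap) (simp add: mult.assoc)
  finally show ?thesis .
qed

text \<open>\<open>x_a x\<close> carries \<open>delta x\<close> to \<open>delta 0\<close>, so
  invariance under \<open>V\<close> moves the whole dependence on \<phi> into the vector v.\<close>

lemma K_delta:
  assumes "g \<in> carrier SL2"
  shows "K g v \<phi> = (\<Sum>x\<in>UNIV. \<phi> x * K g (\<pi> (x_a x) v) (delta 0))"
proof -
  have "K g v (delta x) = K g (\<pi> (x_a x) v) (delta 0)" for x
  proof -
    have "\<omega> (x_a x) (delta x) = delta 0" by (auto simp: delta_def)
    then show ?thesis using K_V[OF assms, of "x_a x" v "delta x"] by simp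
  qed
  then show ?thesis using K_expand[OF assms, of v \<phi>] by simp
qed

lemma functional_scale: "functional \<Lambda> \<Longrightarrow> functional (\<lambda>v. c * \<Lambda> v)"
  using functional_lincomb[of "{0::nat}" "\<lambda>_. \<Lambda>" "\<lambda>_. c"] by simp

text \<open>\<open>P g0\<close> averages \<open>K\<close> over the Borel subgroup of \<open>SL\<^sub>2\<close> against \<open>chi\<close>; \<open>g0\<close> is the
  identity for the zeta sum itself and the Weyl element for its image under the intertwiner.\<close>

context
  fixes chi :: "'k \<Rightarrow> complex"
  assumes chi: "chi \<in> hom units_group units_group"
begin

lemma chi_mult: "a \<noteq> 0 \<Longrightarrow> b \<noteq> 0 \<Longrightarrow> chi (a * b) = chi a * chi b"
  and chi_nz: "a \<noteq> 0 \<Longrightarrow> chi a \<noteq> 0"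
  using chi by (auto simp: hom_def units_group_def)

definition borel :: "'k \<Rightarrow> 'k \<Rightarrow> 'k^2^2" where
  "borel t r = mat2 t 0 0 (inverse t) ** mat2 1 r 0 1"

lemma borel_eq: "borel t r = mat2 t (t * r) 0 (inverse t)"
  by (simp add: borel_def mat2_mult)

lemma borel_in_SL2 [simp]: "t \<noteq> 0 \<Longrightarrow> borel t r \<in> carrier SL2"
  by (simp add: borel_eq)

definition P :: "'k^2^2 \<Rightarrow> 'v \<Rightarrow> ('k \<Rightarrow> complex) \<Rightarrow> complex" where
  "P g0 v \<phi> = (\<Sum>t\<in>UNIV - {0}. chi t * (\<Sum>r\<in>UNIV. K (g0 ** borel t r) v \<phi>))"

lemma P_V:
  assumes "g0 \<in> carrier SL2" "u \<in> V"
  shows "P g0 (\<pi> u v) (\<omega> u \<phi>) = P g0 v \<phi>"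
  unfolding P_def using assms by (intro sum.cong refl) (simp add: K_V)

lemma P_functional: "g0 \<in> carrier SL2 \<Longrightarrow> functional (\<lambda>v. P g0 v \<phi>)"
  unfolding P_def sum_distrib_left
  by (intro functional_lincomb[where c = "\<lambda>_. 1", simplified] functional_scale K_functional) auto

lemma P_delta:
  assumes "g0 \<in> carrier SL2"
  shows "P g0 v \<phi> = (\<Sum>x\<in>UNIV. \<phi> x * P g0 (\<pi> (x_a x) v) (delta 0))"
proof -
  have "P g0 v \<phi> = (\<Sum>t\<in>UNIV - {0}. \<Sum>r\<in>UNIV. \<Sum>x\<in>UNIV.
      \<phi> x * (chi t * K (g0 ** borel t r) (\<pi> (x_a x) v) (delta 0)))"
    unfolding P_def sum_distrib_left
    by (intro sum.cong refl, subst K_delta) (use assms in \<open>auto simp: sum_distrib_left mult.left_commute\<close>)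
  also have "\<dots> = (\<Sum>t\<in>UNIV - {0}. \<Sum>x\<in>UNIV. \<Sum>r\<in>UNIV.
      \<phi> x * (chi t * K (g0 ** borel t r) (\<pi> (x_a x) v) (delta 0)))"
    by (intro sum.cong refl sum.swap)
  also have "\<dots> = (\<Sum>x\<in>UNIV. \<Sum>t\<in>UNIV - {0}. \<Sum>r\<in>UNIV.
      \<phi> x * (chi t * K (g0 ** borel t r) (\<pi> (x_a x) v) (delta 0)))"
    by (rule sum.swap)
  finally show ?thesis by (simp add: P_def sum_distrib_left)
qed

lemma P_x_b:
  assumes "g0 \<in> carrier SL2"
  shows "P g0 (\<pi> (x_b s) v) (\<omega> (x_b s) \<phi>) = P g0 v \<phi>"
proof -
  have "(\<Sum>r\<in>UNIV. K (g0 ** borel t r) (\<pi> (x_b s) v) (\<omega> (x_b s) \<phi>)) = (\<Sum>r\<in>UNIV. K (g0 ** borel t r) v \<phi>)"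
    if t: "t \<noteq> 0" for t
  proof -
    have "K (g0 ** borel t r) (\<pi> (x_b s) v) (\<omega> (x_b s) \<phi>) = K (g0 ** borel t (r + s)) v \<phi>" for r
    proof -
      have "g0 ** borel t (r + s) = (g0 ** borel t r) ** mat2 1 s 0 1"
        by (simp add: borel_eq mat2_mult distrib_left add.commute flip: matrix_mul_assoc)
      then show ?thesis
        using K_mult[of "g0 ** borel t r" "mat2 1 s 0 1" v \<phi>] assms t by (simp add: levi_upper del: omega_x_b)
    qed
    then show ?thesis using sum_UNIV_shift[of "\<lambda>r. K (g0 ** borel t r) v \<phi>" s] by simp
  qed
  then show ?thesis by (simp add: P_def del: omega_x_b)
qed

lemma sum_units_scale:
  "a \<noteq> 0 \<Longrightarrow> (\<Sum>t\<in>UNIV - {0}. f (t * a)) = (\<Sum>t\<in>UNIV - {0}. f (t :: 'k))"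
  by (rule sum.reindex_bij_witness[of _ "\<lambda>t. t / a" "\<lambda>t. t * a"]) auto

text \<open>Right multiplication by the torus reparametrizes the Borel subgroup: t becomes t a, and
  r is rescaled by a^(-2). The factor \<open>chi a\<close> matches the change of variable in
  t.\<close>

lemma P_h:
  assumes "g0 \<in> carrier SL2" "a \<noteq> 0"
  shows "chi a * P g0 (\<pi> (h a (inverse a)) v) (\<omega> (h a (inverse a)) \<phi>) = P g0 v \<phi>"
proof -
  let ?K = "\<lambda>t r. K (g0 ** borel t r) v \<phi>"
  have "K (g0 ** borel t r) (\<pi> (h a (inverse a)) v) (\<omega> (h a (inverse a)) \<phi>) = ?K (t * a) (inverse (a\<^sup>2) * r)"
    if "t \<noteq> 0" for t r
  proof -
    have "borel t r ** mat2 a 0 0 (inverse a) = borel (t * a) (inverse (a\<^sup>2) * r)"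
      using assms that by (simp add: borel_eq mat2_mult field_simps power2_eq_square)
    then have "g0 ** borel (t * a) (inverse (a\<^sup>2) * r) = (g0 ** borel t r) ** mat2 a 0 0 (inverse a)"
      by (simp flip: matrix_mul_assoc)
    then show ?thesis
      using K_mult[of "g0 ** borel t r" "mat2 a 0 0 (inverse a)" v \<phi>] assms that by (simp add: levi_diag)
  qed
  then have "chi a * P g0 (\<pi> (h a (inverse a)) v) (\<omega> (h a (inverse a)) \<phi>) =
      (\<Sum>t\<in>UNIV - {0}. chi (t * a) * (\<Sum>r\<in>UNIV. ?K (t * a) (inverse (a\<^sup>2) * r)))"
    unfolding P_def sum_distrib_left[of "chi a"] using assms(2)
    by (intro sum.cong refl) (simp add: chi_mult mult.left_commute)
  also have "\<dots> = (\<Sum>t\<in>UNIV - {0}. chi (t * a) * (\<Sum>r\<in>UNIV. ?K (t * a) r))"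
    using assms(2) sum_UNIV_scale[of "inverse (a\<^sup>2)" "?K _"] by simp
  also have "\<dots> = P g0 v \<phi>"
    unfolding P_def by (rule sum_units_scale[OF assms(2)])
  finally show ?thesis .
qed

definition mu :: "'k \<Rightarrow> complex" where
  "mu a = chi a * quad_char a"

lemma quad_char_nz [simp]: "quad_char (a::'k) \<noteq> 0"
  by (simp add: quad_char_def)

text \<open>Read off from the Weil representation: on the constant function 1 the torus acts by
  \<open>quad_char\<close>, so multiplicativity follows from that of \<omega>, without counting
  squares.\<close>

lemma quad_char_mult:
  assumes "a \<noteq> 0" "b \<noteq> 0"
  shows "quad_char (a * b) = quad_char a * quad_char (b::'k)"
proof -
  have J: "h c (inverse c) \<in> carrier J" if "c \<noteq> 0" for c :: 'k
    using levi_in_J[of "mat2 c 0 0 (inverse c)"] levi_diag[OF that] that by simp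
  have "h (a * b) (inverse (a * b)) = h a (inverse a) ** h b (inverse b)"
    by (simp add: h_mult)
  then have "\<omega> (h (a * b) (inverse (a * b))) (\<lambda>_. 1) = \<omega> (h a (inverse a)) (\<omega> (h b (inverse b)) (\<lambda>_. 1))"
    using omega_mult[OF J J] assms by simp
  then show ?thesis using assms omega_h[of "a * b"] by (simp add: omega_h fun_eq_iff)
qed

lemma mu_mult: "a \<noteq> 0 \<Longrightarrow> b \<noteq> 0 \<Longrightarrow> mu (a * b) = mu a * mu b"
  and mu_nz: "a \<noteq> 0 \<Longrightarrow> mu a \<noteq> 0"
  by (auto simp: mu_def chi_mult quad_char_mult chi_nz)

lemma P_equivariant:
  assumes "g0 \<in> carrier SL2"
  shows "V'_equivariant (\<lambda>v. P g0 v (delta 0))"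
    and "a \<noteq> 0 \<Longrightarrow> mu a * P g0 (\<pi> (h a (inverse a)) v) (delta 0) = P g0 v (delta 0)"
proof -
  have scale: "P g0 v (\<lambda>\<xi>. c * \<phi> \<xi>) = c * P g0 v \<phi>" for c v \<phi>
    unfolding P_delta[OF assms, of v "\<lambda>\<xi>. c * \<phi> \<xi>"] P_delta[OF assms, of v \<phi>]
    by (simp add: sum_distrib_left mult.assoc)
  \<comment> \<open>Both multipliers depend on \<xi> only through an argument of \<psi> that
    vanishes at \<xi> = 0.\<close>
  have d: "(\<lambda>\<xi>. inverse (\<psi> (- (2 * \<xi> * r))) * delta 0 \<xi>) = delta 0"
    "(\<lambda>\<xi>. inverse (\<psi> (r * \<xi>\<^sup>2)) * delta 0 \<xi>) = delta 0" for r
    by (auto simp: delta_def)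
  note V = P_V[OF assms, of _ _ "delta 0"]
  have "inverse (\<psi> r) * P g0 (\<pi> (x_2ab r) v) (delta 0) = P g0 v (delta 0)" for r v
    using V[of "x_2ab r" v] by (simp add: scale)
  then have "P g0 (\<pi> (x_2ab r) v) (delta 0) = \<psi> r * P g0 v (delta 0)" for r v
    by (simp add: field_simps)
  then show "V'_equivariant (\<lambda>v. P g0 v (delta 0))"
    unfolding V'_equivariant_def
    using P_functional[OF assms] P_x_b[OF assms, of _ _ "delta 0"] V[of "x_ab _"] V[of "x_3ab _"] V[of "x_3a2b _"]
    by (simp add: d)
  assume a: "a \<noteq> 0"
  then have "(\<lambda>\<xi>. quad_char a * delta 0 (a * \<xi>)) = (\<lambda>\<xi>. quad_char a * delta 0 \<xi>)"
    by (auto simp: delta_def)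
  then show "mu a * P g0 (\<pi> (h a (inverse a)) v) (delta 0) = P g0 v (delta 0)"
    using P_h[OF assms a, of v "delta 0"] a by (simp add: omega_h scale mu_def mult.assoc)
qed

text \<open>The projection of \<open>L0\<close> to the eigenspace of the torus of SL_2 on which the
  averages \<open>P\<close> restricted to \<open>delta 0\<close> lie.\<close>

definition M0 :: "'v \<Rightarrow> complex" where
  "M0 v = (\<Sum>a\<in>UNIV - {0}. mu a * L0 (\<pi> (h a (inverse a)) v))"

text \<open>Averaging the expansion in torus translates of \<open>L0\<close> against
  \<open>mu\<close> leaves the left side unchanged up to the order of the torus and turns the
  translate by c into \<open>M0\<close> divided by \<open>mu c\<close>.\<close>

lemma P_multiple:
  assumes "g0 \<in> carrier SL2"
  shows "\<exists>c. \<forall>v. P g0 v (delta 0) = c * M0 v"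
proof -
  obtain m where m: "\<And>v. P g0 v (delta 0) = (\<Sum>c\<in>UNIV - {0}. m c * L0 (\<pi> (h c (inverse c)) v))"
    using V'_equivariant_expansion[OF P_equivariant(1)[OF assms]] by blast
  have card: "of_nat (card (UNIV - {0 :: 'k})) \<noteq> (0::complex)"
  proof -
    have "(1::'k) \<in> UNIV - {0}" by simp
    then have "UNIV - {0::'k} \<noteq> {}" by blast
    then show ?thesis by (simp only: of_nat_eq_0_iff card_eq_0_iff) simp
  qed
  have "of_nat (card (UNIV - {0 :: 'k})) * P g0 v (delta 0) = (\<Sum>c\<in>UNIV - {0}. m c / mu c) * M0 v" for v
  proof -
    have "of_nat (card (UNIV - {0 :: 'k})) * P g0 v (delta 0) =
        (\<Sum>a\<in>UNIV - {0}. mu a * P g0 (\<pi> (h a (inverse a)) v) (delta 0))"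
      using P_equivariant(2)[OF assms, of _ v] by simp
    also have "\<dots> = (\<Sum>a\<in>UNIV - {0}. \<Sum>c\<in>UNIV - {0}. mu a * (m c * L0 (\<pi> (h (a * c) (inverse (a * c))) v)))"
    proof (intro sum.cong refl)
      fix a :: 'k assume "a \<in> UNIV - {0}"
      then have "\<pi> (h c (inverse c)) (\<pi> (h a (inverse a)) v) = \<pi> (h (a * c) (inverse (a * c))) v" if "c \<noteq> 0" for c
        using that by (intro pi_rel) (simp_all add: h_mult mult.commute)
      then show "mu a * P g0 (\<pi> (h a (inverse a)) v) (delta 0) =
          (\<Sum>c\<in>UNIV - {0}. mu a * (m c * L0 (\<pi> (h (a * c) (inverse (a * c))) v)))"
        by (simp add: m sum_distrib_left)
    qed
    also have "\<dots> = (\<Sum>c\<in>UNIV - {0}. \<Sum>a\<in>UNIV - {0}. mu a * (m c * L0 (\<pi> (h (a * c) (inverse (a * c))) v)))"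
      by (rule sum.swap)
    also have "\<dots> = (\<Sum>c\<in>UNIV - {0}. m c / mu c * (\<Sum>a\<in>UNIV - {0}. mu (a * c) * L0 (\<pi> (h (a * c) (inverse (a * c))) v)))"
      unfolding sum_distrib_left by (intro sum.cong refl) (simp add: mu_mult mu_nz)
    also have "\<dots> = (\<Sum>c\<in>UNIV - {0}. m c / mu c * M0 v)"
    proof (intro sum.cong refl)
      fix c :: 'k assume "c \<in> UNIV - {0}"
      then have c: "c \<noteq> 0" by simp
      show "m c / mu c * (\<Sum>a\<in>UNIV - {0}. mu (a * c) * L0 (\<pi> (h (a * c) (inverse (a * c))) v)) = m c / mu c * M0 v"
        unfolding sum_units_scale[OF c, of "\<lambda>a. mu a * L0 (\<pi> (h a (inverse a)) v)"] M0_def ..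
    qed
    finally show ?thesis by (simp add: sum_distrib_right)
  qed
  then have "P g0 v (delta 0) = (\<Sum>c\<in>UNIV - {0}. m c / mu c) / of_nat (card (UNIV - {0 :: 'k})) * M0 v" for v
    using card by (simp add: field_simps)
  then show ?thesis by blast
qed

text \<open>For the identity the multiple of \<open>M0\<close> is q, which is not zero. Hence any
  other average can be expressed through this one without dividing by a form that might
  vanish.\<close>

lemma P_one: "P (mat 1) v (delta 0) = of_nat CARD('k) * M0 v"
proof -
  have "K (borel t r) v (delta 0) = quad_char t * L0 (\<pi> (h t (inverse t)) v)" if t: "t \<noteq> 0" for t r
  proof -
    \<comment> \<open>With the unipotent factor on the left, invariance of K under N removes it, and
      every r contributes equally.\<close>
    have "borel t r = mat2 1 (t\<^sup>2 * r) 0 1 ** mat2 t 0 0 (inverse t)"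
      using t by (simp add: borel_eq mat2_mult power2_eq_square)
    then have "K (borel t r) v (delta 0) = K (mat2 t 0 0 (inverse t)) v (delta 0)"
      using t by (simp add: K_N)
    also have "\<dots> = (\<Sum>x\<in>UNIV. quad_char t * (delta 0 (t * x) * L0 (\<pi> (x_a x) (\<pi> (h t (inverse t)) v))))"
      using t by (simp add: K_def L_def levi_diag omega_h mult.assoc)
    also have "\<dots> = (\<Sum>x\<in>(UNIV :: 'k set). if x = 0 then quad_char t * L0 (\<pi> (h t (inverse t)) v) else 0)"
      using t by (intro sum.cong) (auto simp: delta_def x_a_0)
    finally show ?thesis by simp
  qed
  then show ?thesis
    by (simp add: P_def M0_def mu_def sum_distrib_left mult.assoc mult.left_commute)
qed

lemma P_gamma:
  assumes "g0 \<in> carrier SL2"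
  shows "\<exists>c. \<forall>v \<phi>. P g0 v \<phi> = c * P (mat 1) v \<phi>"
proof -
  obtain c where "\<And>v. P g0 v (delta 0) = c * M0 v" using P_multiple[OF assms] by blast
  then have c: "P g0 v (delta 0) = c / of_nat CARD('k) * P (mat 1) v (delta 0)" for v
    by (simp add: P_one)
  have "P g0 v \<phi> = c / of_nat CARD('k) * P (mat 1) v \<phi>" for v \<phi>
    unfolding P_delta[OF assms, of v \<phi>] P_delta[OF SL2_one, of v \<phi>] c
    by (simp add: sum_distrib_left mult.left_commute)
  then show ?thesis by blast
qed

end

end

section \<open>The functional equation\<close>

lemma zeta_sum_scale: "zeta_sum \<omega> (\<lambda>g. c * W g) \<phi> f = c * zeta_sum \<omega> W \<phi> f"
  by (simp add: zeta_sum_def Let_def sum_distrib_left mult.assoc)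

context g2_zeta
begin

text \<open>Of the two conjugating factors in \<open>j\<close>, the left one builds
  \<open>L0\<close> and the right one is absorbed into v. The hypothesis on f is only invariance
  under N, so the lemma serves for both f and \<open>intertwiner f\<close>.\<close>

lemma zeta_sum_eq:
  assumes f: "\<And>r g. g \<in> carrier SL2 \<Longrightarrow> f (mat2 1 r 0 1 ** g) = f g"
  shows "of_nat CARD('k) * zeta_sum \<omega> (\<lambda>g. l (\<pi> g v)) \<phi> f =
    (\<Sum>g\<in>carrier SL2. f g * K g (\<pi> (matrix_inv (w_b ** w_a)) v) \<phi>)"
proof -
  let ?v = "\<pi> (matrix_inv (w_b ** w_a)) v"
  have summand: "(\<Sum>x\<in>UNIV. \<Sum>y\<in>UNIV. l (\<pi> (j (x_3ab y ** x_a x ** levi g)) v) * \<omega> (levi g) \<phi> x * f g) =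
      f g * K g ?v \<phi>" if g: "g \<in> carrier SL2" for g
  proof -
    have "\<pi> (j (x_3ab y ** x_a x ** levi g)) v = \<pi> (w_b ** w_a ** x_3ab y) (\<pi> (x_a x) (\<pi> (levi g) ?v))" for x y
      using g by (subst j_eq) (simp_all add: pi_mult)
    then show ?thesis
      by (simp add: K_def L_def L0_def sum_distrib_left mult_ac)
  qed
  have some: "(SOME g. g \<in> C) \<in> carrier SL2" if C: "C \<in> rcosets\<^bsub>SL2\<^esub> N_SL2" for C :: "('k^2^2) set"
  proof -
    from C obtain g where g: "g \<in> carrier SL2" "C = range (\<lambda>r. mat2 1 r 0 1 ** g)"
      by (auto simp: RCOSETS_def r_coset_def N_SL2_def)
    have "(SOME g. g \<in> C) \<in> C" by (rule someI[of _ "mat2 1 0 0 1 ** g"]) (simp add: g(2))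
    then show ?thesis using g by auto
  qed
  have "zeta_sum \<omega> (\<lambda>g. l (\<pi> g v)) \<phi> f =
      (\<Sum>C\<in>rcosets\<^bsub>SL2\<^esub> N_SL2. f (SOME g. g \<in> C) * K (SOME g. g \<in> C) ?v \<phi>)"
    unfolding zeta_sum_def Let_def by (intro sum.cong refl summand some)
  then show ?thesis
    using sum_rcosets_N[of "\<lambda>g. f g * K g ?v \<phi>"] by (simp add: f K_N)
qed

context
  fixes chi :: "'k \<Rightarrow> complex"
  assumes chi: "chi \<in> hom units_group units_group"
begin

text \<open>Shifting the sum over SL_2 by an element of the Borel subgroup multiplies f by
  \<open>chi t\<close>. Averaging over all (q - 1) q shifts replaces K by its Borel average, in
  which f is only a weight.\<close>

lemma borel_average:
  assumes "g0 \<in> carrier SL2" "f \<in> induced chi"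
  shows "of_nat (card (UNIV - {0::'k}) * CARD('k)) * (\<Sum>g\<in>carrier SL2. f g * K (g0 ** g) v \<phi>) =
    (\<Sum>g\<in>carrier SL2. f g * P chi g0 (\<pi> (levi g) v) (\<omega> (levi g) \<phi>))"
proof -
  let ?S = "\<Sum>g\<in>carrier SL2. f g * K (g0 ** g) v \<phi>"
  have S: "?S = (\<Sum>g\<in>carrier SL2. f g * (chi t * K (g0 ** borel t r) (\<pi> (levi g) v) (\<omega> (levi g) \<phi>)))"
    if t: "t \<noteq> 0" for t r
  proof -
    have "?S = (\<Sum>g\<in>carrier SL2. f (borel t r ** g) * K (g0 ** (borel t r ** g)) v \<phi>)"
      by (rule sum_SL2_shift[symmetric]) (use t borel_in_SL2[OF chi] in simp)
    also have "\<dots> = (\<Sum>g\<in>carrier SL2. f g * (chi t * K (g0 ** borel t r) (\<pi> (levi g) v) (\<omega> (levi g) \<phi>)))"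
    proof (intro sum.cong refl)
      fix g :: "'k^2^2" assume g: "g \<in> carrier SL2"
      have "f (borel t r ** g) = chi t * f g"
        using assms(2) t g unfolding borel_eq[OF chi] induced_def by blast
      moreover have "K (g0 ** (borel t r ** g)) v \<phi> = K (g0 ** borel t r) (\<pi> (levi g) v) (\<omega> (levi g) \<phi>)"
        unfolding matrix_mul_assoc using assms(1) t g borel_in_SL2[OF chi] by (intro K_mult) auto
      ultimately show "f (borel t r ** g) * K (g0 ** (borel t r ** g)) v \<phi> =
          f g * (chi t * K (g0 ** borel t r) (\<pi> (levi g) v) (\<omega> (levi g) \<phi>))" by simp
    qed
    finally show ?thesis .
  qed
  have "of_nat (card (UNIV - {0::'k}) * CARD('k)) * ?S = (\<Sum>t\<in>UNIV - {0::'k}. \<Sum>r\<in>(UNIV::'k set). ?S)"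
    by (simp only: sum_constant of_nat_mult mult.assoc)
  also have "\<dots> = (\<Sum>t\<in>UNIV - {0}. \<Sum>r\<in>UNIV. \<Sum>g\<in>carrier SL2.
      f g * (chi t * K (g0 ** borel t r) (\<pi> (levi g) v) (\<omega> (levi g) \<phi>)))"
    by (intro sum.cong refl S) simp
  also have "\<dots> = (\<Sum>t\<in>UNIV - {0}. \<Sum>g\<in>carrier SL2. \<Sum>r\<in>UNIV.
      f g * (chi t * K (g0 ** borel t r) (\<pi> (levi g) v) (\<omega> (levi g) \<phi>)))"
    by (intro sum.cong refl sum.swap)
  also have "\<dots> = (\<Sum>g\<in>carrier SL2. \<Sum>t\<in>UNIV - {0}. \<Sum>r\<in>UNIV.
      f g * (chi t * K (g0 ** borel t r) (\<pi> (levi g) v) (\<omega> (levi g) \<phi>)))"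
    by (rule sum.swap)
  finally show ?thesis by (simp only: P_def[OF chi] sum_distrib_left)
qed

lemma zeta_sum_functional_equation:
  "\<exists>\<gamma>. \<forall>v \<phi>. \<forall>f\<in>induced chi.
     zeta_sum \<omega> (\<lambda>g. l (\<pi> g v)) \<phi> (intertwiner f) = \<gamma> * zeta_sum \<omega> (\<lambda>g. l (\<pi> g v)) \<phi> f"
proof -
  let ?w = "mat2 0 1 (- 1) 0 :: 'k^2^2"
  let ?q = "of_nat CARD('k) :: complex"
  have w: "?w \<in> carrier SL2" by simp
  obtain c where c: "\<And>v \<phi>. P chi ?w v \<phi> = c * P chi (mat 1) v \<phi>" using P_gamma[OF chi w] by blast
  \<comment> \<open>The constant c compares the averages for the Weyl element and the identity; the
    extra factor q counts the terms of the intertwiner, which all contribute equally.\<close>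
  have "zeta_sum \<omega> (\<lambda>g. l (\<pi> g v)) \<phi> (intertwiner f) = ?q * c * zeta_sum \<omega> (\<lambda>g. l (\<pi> g v)) \<phi> f"
    if f: "f \<in> induced chi" for v \<phi> f
  proof -
    let ?v = "\<pi> (matrix_inv (w_b ** w_a)) v"
    let ?S = "\<lambda>g0. \<Sum>g\<in>carrier SL2. f g * K (g0 ** g) ?v \<phi>"
    have chi_1: "chi 1 = 1" using chi_mult[OF chi, of 1 1] chi_nz[OF chi, of 1] by simp
    have f_N: "f (mat2 1 r 0 1 ** g) = f g" if "g \<in> carrier SL2" for r g
    proof -
      have "f (mat2 1 r 0 (inverse 1) ** g) = chi 1 * f g"
        using f that one_neq_zero unfolding induced_def by blast
      then show ?thesis by (simp add: chi_1)
    qed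
    have Mf_N: "intertwiner f (mat2 1 r 0 1 ** g) = intertwiner f g" for r g
    proof -
      have "matrix_inv ?w ** mat2 1 x 0 1 ** (mat2 1 r 0 1 ** g) = matrix_inv ?w ** mat2 1 (x + r) 0 1 ** g" for x
      proof -
        have "mat2 1 (x + r) 0 1 = mat2 1 x 0 1 ** mat2 1 r 0 1" by (simp add: mat2_mult add.commute)
        then show ?thesis by (simp only: matrix_mul_assoc)
      qed
      then show ?thesis unfolding intertwiner_def
        using sum_UNIV_shift[of "\<lambda>x. f (matrix_inv ?w ** mat2 1 x 0 1 ** g)" r] by simp
    qed
    have card: "of_nat (card (UNIV - {0::'k}) * CARD('k)) \<noteq> (0::complex)"
    proof -
      have "(1::'k) \<in> UNIV - {0}" by simp
      then have "UNIV - {0::'k} \<noteq> {}" by blast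
      then show ?thesis by (simp only: of_nat_eq_0_iff mult_eq_0_iff card_eq_0_iff) simp
    qed
    let ?N = "of_nat (card (UNIV - {0::'k}) * CARD('k)) :: complex"
    have "?N * ?S ?w = (\<Sum>g\<in>carrier SL2. f g * (c * P chi (mat 1) (\<pi> (levi g) ?v) (\<omega> (levi g) \<phi>)))"
      unfolding c[symmetric] by (rule borel_average[OF w f])
    also have "\<dots> = c * (\<Sum>g\<in>carrier SL2. f g * P chi (mat 1) (\<pi> (levi g) ?v) (\<omega> (levi g) \<phi>))"
      by (simp add: sum_distrib_left mult.left_commute)
    also have "\<dots> = c * (?N * ?S (mat 1))"
      unfolding borel_average[OF SL2_one f] ..
    finally have "?N * ?S ?w = ?N * (c * ?S (mat 1))" by (simp only: mult.left_commute)
    then have S: "?S ?w = c * ?S (mat 1)" using card by (simp only: mult_cancel_left) simp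
    \<comment> \<open>The substitution by \<open>?A\<close>, the inverse of the element in the
      argument of f, frees that argument. The unipotent part of \<open>?A\<close> then drops out of
      K, so the result does not depend on x.\<close>
    have shift: "(\<Sum>g\<in>carrier SL2. f (matrix_inv ?w ** mat2 1 x 0 1 ** g) * K g ?v \<phi>) = ?S ?w" for x
    proof -
      let ?A = "mat2 1 (- x) 0 1 ** ?w"
      have A: "?A \<in> carrier SL2" by simp
      have 1: "matrix_inv ?w ** mat2 1 x 0 1 ** ?A = mat 1"
        by (simp add: matrix_inv_mat2 mat2_mult mat2_1)
      have "(\<Sum>g\<in>carrier SL2. f (matrix_inv ?w ** mat2 1 x 0 1 ** g) * K g ?v \<phi>) =
          (\<Sum>g\<in>carrier SL2. f (matrix_inv ?w ** mat2 1 x 0 1 ** (?A ** g)) * K (?A ** g) ?v \<phi>)"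
        by (rule sum_SL2_shift[OF A, symmetric])
      also have "\<dots> = ?S ?w"
      proof (intro sum.cong refl)
        fix g :: "'k^2^2" assume g: "g \<in> carrier SL2"
        have "matrix_inv ?w ** mat2 1 x 0 1 ** (?A ** g) = g"
          using 1 by (simp only: matrix_mul_assoc matrix_mul_lid)
        moreover have "K (?A ** g) ?v \<phi> = K (?w ** g) ?v \<phi>"
          using K_N[of "?w ** g" "- x"] g by (simp add: matrix_mul_assoc)
        ultimately show "f (matrix_inv ?w ** mat2 1 x 0 1 ** (?A ** g)) * K (?A ** g) ?v \<phi> = f g * K (?w ** g) ?v \<phi>"
          by simp
      qed
      finally show ?thesis .
    qed
    have "?q * zeta_sum \<omega> (\<lambda>g. l (\<pi> g v)) \<phi> (intertwiner f) =
        (\<Sum>g\<in>carrier SL2. intertwiner f g * K g ?v \<phi>)"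
      by (rule zeta_sum_eq) (rule Mf_N)
    also have "\<dots> = (\<Sum>x\<in>UNIV. \<Sum>g\<in>carrier SL2. f (matrix_inv ?w ** mat2 1 x 0 1 ** g) * K g ?v \<phi>)"
      unfolding intertwiner_def sum_distrib_right by (rule sum.swap)
    also have "\<dots> = ?q * (c * ?S (mat 1))" by (simp add: shift S)
    also have "?S (mat 1) = ?q * zeta_sum \<omega> (\<lambda>g. l (\<pi> g v)) \<phi> f"
      using zeta_sum_eq[of f v \<phi>] f_N by simp
    finally show ?thesis by (simp add: mult.assoc)
  qed
  then show ?thesis by blast
qed

end

end

theorem proposition5p8:
  fixes \<psi> chi :: "'k::{field,finite} \<Rightarrow> complex"
    and s :: "complex \<Rightarrow> 'v::ab_group_add \<Rightarrow> 'v"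
    and \<pi> :: "'k^7^7 \<Rightarrow> 'v \<Rightarrow> 'v"
    and \<psi>\<^sub>U :: "'k^7^7 \<Rightarrow> complex"
    and \<omega> :: "'k^7^7 \<Rightarrow> ('k \<Rightarrow> complex) \<Rightarrow> ('k \<Rightarrow> complex)"
  assumes "odd CHAR('k)"
    and "nontrivial_additive_character \<psi>"
    and "is_psi_U \<psi> \<psi>\<^sub>U"
    and "is_weil (\<lambda>r. inverse (\<psi> r)) \<omega>"
    and "irreducible_rep s G2 \<pi>"
    and "generic s \<pi> \<psi>\<^sub>U"
    and "cuspidal \<pi>"
    and "chi \<in> hom units_group units_group"
  shows "\<exists>\<gamma>::complex. \<forall>W\<in>whittaker_model s \<pi> \<psi>\<^sub>U. \<forall>\<phi>. \<forall>f\<in>induced chi.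
           zeta_sum \<omega> W \<phi> (intertwiner f) = \<gamma> * zeta_sum \<omega> W \<phi> f"
proof -
  obtain l where l: "l \<in> Hom_U s \<pi> \<psi>\<^sub>U" "\<exists>v. l v \<noteq> 0"
    using assms(6) by (auto simp: generic_def)
  have "vector_space s"
    using assms(5) by (simp add: irreducible_rep_def Defs.representation_def)
  then interpret vs: vector_space s .
  interpret g2_zeta \<psi> \<psi>\<^sub>U s \<pi> l \<omega>
    using assms l by unfold_locales auto
  obtain \<gamma> where \<gamma>: "\<And>v \<phi> f. f \<in> induced chi \<Longrightarrow>
      zeta_sum \<omega> (\<lambda>g. l (\<pi> g v)) \<phi> (intertwiner f) = \<gamma> * zeta_sum \<omega> (\<lambda>g. l (\<pi> g v)) \<phi> f"
    using zeta_sum_functional_equation[OF assms(8)] by blast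
  have "zeta_sum \<omega> W \<phi> (intertwiner f) = \<gamma> * zeta_sum \<omega> W \<phi> f"
    if W: "W \<in> whittaker_model s \<pi> \<psi>\<^sub>U" and f: "f \<in> induced chi" for W \<phi> f
  proof -
    from W obtain l' v where l': "W = (\<lambda>g. l' (\<pi> g v))" "l' \<in> Hom_U s \<pi> \<psi>\<^sub>U"
      by (auto simp: whittaker_model_def)
    \<comment> \<open>W may come from another Whittaker functional than the fixed l; by uniqueness
      it is a multiple of l, and both sides are linear in W, so \<gamma> does not change.\<close>
    obtain c where "\<And>x. l' x = c * l x" using Hom_U_multiple[OF l'(2)] by blast
    then have "W = (\<lambda>g. c * l (\<pi> g v))" by (simp add: l'(1))
    then show ?thesis by (simp add: zeta_sum_scale \<gamma>[OF f])
  qed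
  then show ?thesis by blast
qed

end
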